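(* For every $u\in[0,\infty]$ there exists a Lebesgue measure preserving transformation $T$ with good cyclic approximation whose upper measure-theoretic slow entropy with respect to the polynomial scale $a_n(t)=n^t$ satisfies $\overline{\mathrm{ent}}^{\mu}_{n^t}(T)=u$.
   Context: "Lebesgue measure preserving transformation" means an invertible transformation $T$ of $X$ preserving normalized Lebesgue measure $\mu$; the constructions can be viewed as taking place on $X=\mathbb{T}^2=\mathbb{R}^2/\mathbb{Z}^2$, the disc $\mathbb{D}$, or the annulus $\mathbb{A}=\mathbb{S}^1\times[0,1]$. Good cyclic approximation. A cyclic process of height $q$ on $(X,\mu)$ is a partition $\xi=\{c_1,\dots,c_q\}$ of $X$ into sets of equal measure (a single tower covering $X$) together with a cyclic measure-preserving permutation $\sigma$ with $\sigma(c_i)=c_{i+1}$, $c_{q+1}=c_1$. A sequence $(\xi_n,\sigma_n)$ of cyclic processes is exhaustive if $\xi_n$ converges to the decomposition into points as $n\to\infty$. An exhaustive sequence of cyclic processes, with heights $q_n$, is a cyclic approximation of $T$ if $\sum_{c\in\xi_n}\mu(Tc\,\triangle\,\sigma_nc)\to0$ as $n\to\infty$; it has speed $g(n)$ if $\sum_{c\in\xi_{n_k}}\mu(Tc\,\triangle\,\sigma_{n_k}c)<g(n_k)$ for a certain subsequence $\{n_k\}$. $T$ has a good cyclic approximation if it admits a cyclic approximation with speed $o(1/q_n)$. Slow entropy. For a finite measurable partition $\mathcal{P}=\{P_1,\dots,P_m\}$, the $n$-name of $x$ is $w(x)=(w_k(x))_{k=0}^{n-1}\in\{1,\dots,m\}^n$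 with $T^k(x)\in P_{w_k(x)}$. For words of length $n$, $d_n^H(w,w')=\frac1n\#\{0\le k\le n-1: w_k\ne w'_k\}$ (Hamming metric). Put $B_{\mathcal{P},n}(x,T,\epsilon)=\{y\in X: d_n^H(w(x),w(y))<\epsilon\}$ and let $S_{\mathcal{P}}(T,n,\epsilon)$ be the minimal cardinality of a family of such balls whose union has $\mu$-measure greater than $1-\epsilon$. For a family $\{a_n(t)\}_{n\in\mathbb{N},t>0}$ of positive sequences increasing to infinity and monotone in $t$, let $B(\epsilon,\mathcal{P})=\{t>0:\limsup_{n\to\infty}\frac{S_{\mathcal{P}}(T,n,\epsilon)}{a_n(t)}>0\}$, $A(\epsilon,\mathcal{P})=\sup B(\epsilon,\mathcal{P})$ if this set is nonempty and $A(\epsilon,\mathcal{P})=0$ otherwise. The upper slow entropy is $\overline{\mathrm{ent}}_{a_n(t)}^{\mu}(T)=\sup_{\mathcal{P}}\lim_{\epsilon\to0}A(\epsilon,\mathcal{P})$, the supremum being over finite measurable partitions. *)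

theory Defs
  imports "HOL-Analysis.Analysis" "HOL-Library.Landau_Symbols" "HOL-Library.Disjoint_Sets"
begin

(* As measure spaces, R^2/Z^2 and S^1 x [0,1] are given by fundamental domains,
   with R/Z = S^1 represented by [0,1). *)

definition torus_domain :: "(real \<times> real) set" where
  "torus_domain = {0..<1} \<times> {0..<1}"

definition disc_domain :: "(real \<times> real) set" where
  "disc_domain = cball 0 1"

definition annulus_domain :: "(real \<times> real) set" where
  "annulus_domain = {0..<1} \<times> {0..1}"

definition normalized_lebesgue :: "'a::euclidean_space set \<Rightarrow> 'a measure" where
  "normalized_lebesgue X = uniform_measure (lebesgue_on X) X"

definition invertible_mpt :: "'a measure \<Rightarrow> ('a \<Rightarrow> 'a) \<Rightarrow> bool" where
  "invertible_mpt M T \<longleftrightarrow>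
     bij_betw T (space M) (space M) \<and>
     T \<in> measurable M M \<and> the_inv_into (space M) T \<in> measurable M M \<and>
     (\<forall>A\<in>sets M. emeasure M (T -` A \<inter> space M) = emeasure M A)"

definition finite_measurable_partition :: "'a measure \<Rightarrow> 'a set set \<Rightarrow> bool" where
  "finite_measurable_partition M P \<longleftrightarrow> finite P \<and> P \<subseteq> sets M \<and> partition_on (space M) P"

(* The permutation sigma is a permutation of the atoms of the partition; it preserves the measure
   because the atoms have equal measure. The height q is the number of atoms, and the atoms
   are enumerated as c 0, ..., c (q - 1). *)

definition cyclic_process :: "'a measure \<Rightarrow> 'a set set \<Rightarrow> ('a set \<Rightarrow> 'a set) \<Rightarrow> bool" where
  "cyclic_process M \<xi> \<sigma> \<longleftrightarrow>
     finite_measurable_partition M \<xi> \<and>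
     (\<forall>c\<in>\<xi>. \<forall>d\<in>\<xi>. measure M c = measure M d) \<and>
     (\<exists>c. bij_betw c {..<card \<xi>} \<xi> \<and>
          (\<forall>i<card \<xi>. \<sigma> (c i) = c (Suc i mod card \<xi>)))"

(* Convergence to the decomposition into points: every measurable set is approximated
   in measure by unions of atoms. *)

definition exhaustive :: "'a measure \<Rightarrow> (nat \<Rightarrow> 'a set set) \<Rightarrow> bool" where
  "exhaustive M \<xi> \<longleftrightarrow>
     (\<forall>A\<in>sets M. \<exists>\<A>. (\<forall>n. \<A> n \<subseteq> \<xi> n) \<and>
        (\<lambda>n. measure M (sym_diff A (\<Union>(\<A> n)))) \<longlonglongrightarrow> 0)"

definition approx_error ::
  "'a measure \<Rightarrow> ('a \<Rightarrow> 'a) \<Rightarrow> 'a set set \<Rightarrow> ('a set \<Rightarrow> 'a set) \<Rightarrow> real" where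
  "approx_error M T \<xi> \<sigma> = (\<Sum>c\<in>\<xi>. measure M (sym_diff (T ` c) (\<sigma> c)))"

definition cyclic_approximation ::
  "'a measure \<Rightarrow> ('a \<Rightarrow> 'a) \<Rightarrow> (nat \<Rightarrow> 'a set set) \<Rightarrow> (nat \<Rightarrow> 'a set \<Rightarrow> 'a set) \<Rightarrow> bool" where
  "cyclic_approximation M T \<xi> \<sigma> \<longleftrightarrow>
     (\<forall>n. cyclic_process M (\<xi> n) (\<sigma> n)) \<and> exhaustive M \<xi> \<and>
     (\<lambda>n. approx_error M T (\<xi> n) (\<sigma> n)) \<longlonglongrightarrow> 0"

definition has_speed ::
  "'a measure \<Rightarrow> ('a \<Rightarrow> 'a) \<Rightarrow> (nat \<Rightarrow> 'a set set) \<Rightarrow> (nat \<Rightarrow> 'a set \<Rightarrow> 'a set) \<Rightarrow> (nat \<Rightarrow> real) \<Rightarrow> bool" where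
  "has_speed M T \<xi> \<sigma> g \<longleftrightarrow>
     (\<exists>r::nat \<Rightarrow> nat. strict_mono r \<and>
        (\<forall>k. approx_error M T (\<xi> (r k)) (\<sigma> (r k)) < g (r k)))"

definition good_cyclic_approximation :: "'a measure \<Rightarrow> ('a \<Rightarrow> 'a) \<Rightarrow> bool" where
  "good_cyclic_approximation M T \<longleftrightarrow>
     (\<exists>\<xi> \<sigma> g. cyclic_approximation M T \<xi> \<sigma> \<and> has_speed M T \<xi> \<sigma> g \<and>
        g \<in> o(\<lambda>n. 1 / real (card (\<xi> n))))"

(* The atoms of the partition serve as the letters. A word of length n is the restriction
   of a sequence of letters to the indices k < n. *)

definition itinerary :: "('a \<Rightarrow> 'a) \<Rightarrow> 'a set set \<Rightarrow> 'a \<Rightarrow> nat \<Rightarrow> 'a set" where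
  "itinerary T P x k = (THE c. c \<in> P \<and> (T ^^ k) x \<in> c)"

definition hamming_dist :: "nat \<Rightarrow> (nat \<Rightarrow> 'b) \<Rightarrow> (nat \<Rightarrow> 'b) \<Rightarrow> real" where
  "hamming_dist n w w' = real (card {k. k < n \<and> w k \<noteq> w' k}) / real n"

definition hamming_ball ::
  "'a measure \<Rightarrow> ('a \<Rightarrow> 'a) \<Rightarrow> 'a set set \<Rightarrow> nat \<Rightarrow> real \<Rightarrow> 'a \<Rightarrow> 'a set" where
  "hamming_ball M T P n \<epsilon> x =
     {y \<in> space M. hamming_dist n (itinerary T P x) (itinerary T P y) < \<epsilon>}"

definition covering_number ::
  "'a measure \<Rightarrow> ('a \<Rightarrow> 'a) \<Rightarrow> 'a set set \<Rightarrow> nat \<Rightarrow> real \<Rightarrow> nat" where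
  "covering_number M T P n \<epsilon> =
     (LEAST k. \<exists>\<B>. \<B> \<subseteq> hamming_ball M T P n \<epsilon> ` space M \<and> finite \<B> \<and> card \<B> = k \<and>
        measure M (\<Union>\<B>) > 1 - \<epsilon>)"

definition growth_params ::
  "(nat \<Rightarrow> real \<Rightarrow> real) \<Rightarrow> 'a measure \<Rightarrow> ('a \<Rightarrow> 'a) \<Rightarrow> real \<Rightarrow> 'a set set \<Rightarrow> real set" where
  "growth_params a M T \<epsilon> P =
     {t. t > 0 \<and> limsup (\<lambda>n. ereal (real (covering_number M T P n \<epsilon>) / a n t)) > 0}"

definition growth_exponent ::
  "(nat \<Rightarrow> real \<Rightarrow> real) \<Rightarrow> 'a measure \<Rightarrow> ('a \<Rightarrow> 'a) \<Rightarrow> real \<Rightarrow> 'a set set \<Rightarrow> ennreal" where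
  "growth_exponent a M T \<epsilon> P =
     (if growth_params a M T \<epsilon> P = {} then 0 else (SUP t\<in>growth_params a M T \<epsilon> P. ennreal t))"

(* The limit exists because the growth exponent is nonincreasing in epsilon. *)

definition upper_slow_entropy ::
  "(nat \<Rightarrow> real \<Rightarrow> real) \<Rightarrow> 'a measure \<Rightarrow> ('a \<Rightarrow> 'a) \<Rightarrow> ennreal" where
  "upper_slow_entropy a M T =
     (SUP P\<in>{P. finite_measurable_partition M P}.
        Lim (at_right 0) (\<lambda>\<epsilon>. growth_exponent a M T \<epsilon> P))"

end

theory Submission
  imports Defs "HOL-Real_Asymp.Real_Asymp"
begin

text \<open>
  Let \<open>S\<close> be the odometer on \<open>[0,1)\<close> with digit sizes \<open>Q (k+1) / Q k\<close>. The transformation is the skew product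
  \<open>(x,y) \<mapsto> (S x, y + h(S x) - h(x))\<close> over it with fibre \<open>\<real>/\<int>\<close>, where \<open>h\<close> is the formal sum of functions
  of the \<open>k\<close>-th digit \<open>d\<close> of \<open>x\<close>, equal to \<open>d / 2^(k+1)\<close> plus \<open>0\<close> or \<open>1/2\<close>. The drift \<open>d / 2^(k+1)\<close> joins
  the columns over a period of length \<open>Q k\<close> to a single cycle of \<open>q k = 2^(k+1) * Q k\<close> rectangles, and
  the map follows this cycle except on a set of measure \<open>1 / g k\<close>, where \<open>g k = m k * Q k\<close> is the time
  between two changes of the \<open>1/2\<close>-term. Hence the approximation is good as soon as \<open>q k / g k \<rightarrow> 0\<close>.

  The pattern of the \<open>1/2\<close>-terms runs through the \<open>N = 2^\<rho>\<close> words of a binary code of length \<open>8 * \<rho>\<close> and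
  linear minimum distance. Names of length \<open>16 * \<rho> * g k\<close> determine the position in this pattern, so
  they need about \<open>N\<close> Hamming balls; conversely, for all times between \<open>g k\<close> and \<open>g (k+1)\<close> a number
  of balls of order \<open>N\<close>, up to factors that are negligible powers of \<open>N\<close>, suffices. Choosing \<open>g k\<close> close to
  \<open>N powr (1/v)\<close> with \<open>v \<rightarrow> u\<close> gives the slow entropy \<open>u\<close>. The disc and the annulus
  carry the same system because a full subset of the square embeds into them preserving
  normalized measure.
\<close>

subsection \<open>Binary codes with linear distance\<close>

text \<open>Only the increments of \<open>h\<close> along \<open>S\<close> occur. Each is a finite
  sum, because \<open>S\<close> changes finitely many digits, whereas the sum for \<open>h\<close>
  itself need not converge. The two requirements pull in opposite directions: the approximation
  forces period \<open>q k\<close> up to times small against \<open>g k\<close>, while slow entropy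
  \<open>u\<close> asks for about \<open>n^u\<close> separated names of length \<open>n\<close>.
  They are compatible because \<open>N\<close> can be fixed after \<open>Q k\<close> is known:
  \<open>\<rho> k\<close> is taken so large that \<open>q k\<close>, \<open>\<rho> k\<close> and
  \<open>2^k\<close> together stay below \<open>N^(1/(k+1))\<close>, and \<open>g k\<close> can
  still be put near any chosen power of \<open>N\<close>. Separation in the Hamming metric must hold
  on a positive proportion of times; a code achieves this with words of length logarithmic in
  \<open>N\<close>, so the extra time is negligible. Adding \<open>1/2\<close> in the fibre acts as
  half a turn of the cycle at every stage and exchanges the two halves of the fibre. For the
  partition into these halves, differing code symbols therefore become differing letters throughout
  a block of length \<open>g k\<close>.\<close>

lemma sum_Pow_power_card:
  fixes x :: real
  assumes "finite A"
  shows "(\<Sum>B\<in>Pow A. x ^ card B) = (1 + x) ^ card A"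
  using assms
proof (induction A rule: finite_induct)
  case empty
  then show ?case by simp
next
  case (insert a A)
  have inj: "inj_on (insert a) (Pow A)"
    using insert.hyps by (auto simp: inj_on_def)
  have disj: "Pow A \<inter> insert a ` Pow A = {}"
    using insert.hyps by auto
  have "(\<Sum>B\<in>insert a ` Pow A. x ^ card B) = (\<Sum>B\<in>Pow A. x ^ card (insert a B))"
    using inj by (simp add: sum.reindex)
  also have "\<dots> = (\<Sum>B\<in>Pow A. x * x ^ card B)"
  proof (rule sum.cong[OF refl])
    fix B assume "B \<in> Pow A"
    then have "finite B" "a \<notin> B" using insert.hyps finite_subset by auto
    then show "x ^ card (insert a B) = x * x ^ card B" by simp
  qed
  also have "\<dots> = x * (1 + x) ^ card A"
    using insert.IH by (simp add: sum_distrib_left[symmetric])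
  finally show ?case
    using insert.hyps disj insert.IH
    by (simp add: Pow_insert sum.union_disjoint algebra_simps)
qed

text \<open>Exponential weighting: each counted set contributes at least \<open>(1/2)^\<rho>\<close>
  to the generating function \<open>(3/2)^(8 * \<rho>)\<close>, and \<open>(3/2)^8 * 2\<close> is
  about 51. The weaker bound \<open>128 = 2^7\<close> is what makes \<open>2^\<rho>\<close> such
  balls fit into the \<open>2^(8 * \<rho>)\<close> subsets.\<close>

lemma card_small_subsets:
  "card {B. B \<subseteq> {..<8 * \<rho>} \<and> card B < \<rho>} \<le> 128 ^ \<rho>"
proof -
  let ?V = "{B. B \<subseteq> {..<8 * \<rho>} \<and> card B < \<rho>}"
  have "real (card ?V) * (1/2) ^ \<rho> = (\<Sum>B\<in>?V. (1/2) ^ \<rho>)" by simp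
  also have "\<dots> \<le> (\<Sum>B\<in>?V. (1/2) ^ card B)"
    by (intro sum_mono power_decreasing) auto
  also have "\<dots> \<le> (\<Sum>B\<in>Pow {..<8 * \<rho>}. (1/2) ^ card B)"
    by (intro sum_mono2) auto
  also have "\<dots> = (3/2) ^ (8 * \<rho>)"
    by (subst sum_Pow_power_card) auto
  finally have "real (card ?V) \<le> (3/2) ^ (8 * \<rho>) * 2 ^ \<rho>"
    by (simp add: field_simps power_one_over)
  also have "\<dots> = ((3/2) ^ 8 * 2) ^ \<rho>"
    by (simp add: power_mult power_mult_distrib)
  also have "\<dots> \<le> 128 ^ \<rho>"
    by (intro power_mono) (auto simp: power_divide)
  finally show ?thesis
    by (metis of_nat_le_iff of_nat_numeral of_nat_power)
qed

lemma card_sym_diff_ball: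
  assumes "finite A" "C \<subseteq> A"
  shows "card {B. B \<subseteq> A \<and> card (sym_diff C B) < d} = card {B. B \<subseteq> A \<and> card B < d}"
proof (rule bij_betw_same_card[of "sym_diff C"])
  show "bij_betw (sym_diff C) {B. B \<subseteq> A \<and> card (sym_diff C B) < d} {B. B \<subseteq> A \<and> card B < d}"
  proof (rule bij_betw_byWitness[where f' = "sym_diff C"])
    have inv: "sym_diff C (sym_diff C B) = B" for B by auto
    show "\<forall>B\<in>{B. B \<subseteq> A \<and> card (sym_diff C B) < d}. sym_diff C (sym_diff C B) = B"
      "\<forall>B\<in>{B. B \<subseteq> A \<and> card B < d}. sym_diff C (sym_diff C B) = B"
      using inv by auto
    show "sym_diff C ` {B. B \<subseteq> A \<and> card (sym_diff C B) < d} \<subseteq> {B. B \<subseteq> A \<and> card B < d}"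
      using assms by auto
    show "sym_diff C ` {B. B \<subseteq> A \<and> card B < d} \<subseteq> {B. B \<subseteq> A \<and> card (sym_diff C B) < d}"
    proof clarify
      fix B assume "B \<subseteq> A" "card B < d"
      then show "sym_diff C B \<subseteq> A \<and> card (sym_diff C (sym_diff C B)) < d"
        using assms inv[of B] by auto
    qed
  qed
qed

text \<open>Greedy choice: while fewer than \<open>2^\<rho>\<close> words are chosen, the balls
  around them cannot exhaust all subsets of \<open>{..<8 * \<rho>}\<close>, and any uncovered subset
  can be added. Words are represented by subsets, with the size of the symmetric difference as
  Hamming distance.\<close>

lemma gilbert_varshamov_code:
  "\<exists>C :: nat \<Rightarrow> nat set. (\<forall>i<2 ^ \<rho>. C i \<subseteq> {..<8 * \<rho>}) \<and>
     (\<forall>i<2 ^ \<rho>. \<forall>j<2 ^ \<rho>. i \<noteq> j \<longrightarrow> \<rho> \<le> card (sym_diff (C i) (C j)))"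
proof -
  have "\<exists>C :: nat \<Rightarrow> nat set. (\<forall>i<n. C i \<subseteq> {..<8 * \<rho>}) \<and>
     (\<forall>i<n. \<forall>j<n. i \<noteq> j \<longrightarrow> \<rho> \<le> card (sym_diff (C i) (C j)))" if "n \<le> 2 ^ \<rho>" for n
    using that
  proof (induction n)
    case 0
    then show ?case by simp
  next
    case (Suc n)
    then have "n \<le> 2 ^ \<rho>" by simp
    from Suc.IH[OF this] obtain C :: "nat \<Rightarrow> nat set" where
      C': "(\<forall>i<n. C i \<subseteq> {..<8 * \<rho>}) \<and> (\<forall>i<n. \<forall>j<n. i \<noteq> j \<longrightarrow> \<rho> \<le> card (sym_diff (C i) (C j)))"
      by (rule exE)
    have C: "\<And>i. i < n \<Longrightarrow> C i \<subseteq> {..<8 * \<rho>}"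
      "\<And>i j. i < n \<Longrightarrow> j < n \<Longrightarrow> i \<noteq> j \<Longrightarrow> \<rho> \<le> card (sym_diff (C i) (C j))"
      using C' by simp_all
    let ?A = "{..<8 * \<rho>}"
    let ?ball = "\<lambda>i. {B. B \<subseteq> ?A \<and> card (sym_diff (C i) B) < \<rho>}"
    have "card (\<Union>i<n. ?ball i) \<le> (\<Sum>i<n. card (?ball i))"
      by (rule card_UN_le) simp
    also have "\<dots> \<le> (\<Sum>i<n. 128 ^ \<rho>)"
    proof (rule sum_mono)
      fix i assume "i \<in> {..<n}"
      then show "card (?ball i) \<le> 128 ^ \<rho>"
        using card_sym_diff_ball[of ?A "C i" \<rho>] C(1)[of i] card_small_subsets[of \<rho>] by simp
    qed
    also have "\<dots> = n * 128 ^ \<rho>" by simp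
    also have "\<dots> < 2 ^ \<rho> * 128 ^ \<rho>" using Suc.prems by simp
    also have "\<dots> = 2 ^ (8 * \<rho>)"
      by (simp add: power_mult power_mult_distrib[symmetric])
    also have "\<dots> = card (Pow ?A)" by (simp add: card_Pow)
    finally have lt: "card (\<Union>i<n. ?ball i) < card (Pow ?A)" .
    have "\<not> Pow ?A \<subseteq> (\<Union>i<n. ?ball i)"
    proof
      assume "Pow ?A \<subseteq> (\<Union>i<n. ?ball i)"
      then have "card (Pow ?A) \<le> card (\<Union>i<n. ?ball i)" by (intro card_mono) auto
      then show False using lt by linarith
    qed
    then obtain B where "B \<in> Pow ?A" "B \<notin> (\<Union>i<n. ?ball i)" by (meson subsetI)
    then have B: "B \<subseteq> ?A" "\<And>i. i < n \<Longrightarrow> \<rho> \<le> card (sym_diff (C i) B)"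
      by (simp_all add: not_less)
    have sym: "sym_diff B (C i) = sym_diff (C i) B" for i by auto
    show ?case
    proof (intro exI[of _ "C(n := B)"] conjI allI impI)
      fix i assume "i < Suc n"
      then show "(C(n := B)) i \<subseteq> ?A" using C(1) B(1) by (auto simp: less_Suc_eq)
    next
      fix i j assume "i < Suc n" "j < Suc n" "i \<noteq> j"
      then show "\<rho> \<le> card (sym_diff ((C(n := B)) i) ((C(n := B)) j))"
        using C(2) B(2) sym by (auto simp: less_Suc_eq)
    qed
  qed
  then show ?thesis by blast
qed

subsection \<open>Combinatorics of the towers\<close>

lemma div_add_le:
  fixes t n d :: nat
  assumes "0 < d"
  shows "(t + n) div d \<le> t div d + (n div d + 1)"
proof -
  have "t mod d + n mod d < 2 * d"
    using mod_less_divisor[OF assms, of t] mod_less_divisor[OF assms, of n] by linarith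
  then have "(t mod d + n mod d) div d < 2"
    using assms by (simp add: div_less_iff_less_mult)
  then show ?thesis unfolding div_add1_eq[of t n d] by simp
qed

text \<open>
  At stage \<open>k\<close> the space is divided into \<open>q k\<close> rectangles, \<open>Q k\<close> columns of \<open>2^(k+1)\<close> rectangles each, numbered
  in the order of the cycle: \<open>t mod Q k\<close> is the position of the column in the odometer and \<open>t div Q k\<close> the
  vertical position relative to the function \<open>h\<close>. The next digit ranges over \<open>b k\<close> blocks of length
  \<open>m k\<close>, and \<open>c k\<close> selects the blocks where \<open>h\<close> is increased by \<open>1/2\<close>. The map \<open>proj k\<close> sends a rectangle
  of stage \<open>k + 1\<close> to the rectangle of stage \<open>k\<close> containing it.
\<close>

locale tower_data =
  fixes Q m b :: "nat \<Rightarrow> nat" and c :: "nat \<Rightarrow> nat \<Rightarrow> bool"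
  assumes Q_0: "Q 0 = 1"
    and Q_Suc: "Q (Suc k) = b k * m k * Q k"
    and b_ge: "2 \<le> b k"
    and m_pos: "0 < m k"
    and m_dvd: "2 ^ Suc k dvd m k"
begin

definition q :: "nat \<Rightarrow> nat" where "q k = 2 ^ Suc k * Q k"

definition g :: "nat \<Rightarrow> nat" where "g k = m k * Q k"

definition shift :: "nat \<Rightarrow> nat \<Rightarrow> nat" where
  "shift k d = d + (if c k (d div m k) then 2 ^ k else 0)"

definition proj :: "nat \<Rightarrow> nat \<Rightarrow> nat" where
  "proj k t = t mod Q k +
     Q k * ((t div Q (Suc k) div 2 + shift k (t mod Q (Suc k) div Q k)) mod 2 ^ Suc k)"

lemma Q_pos: "0 < Q k"
proof (induction k)
  case (Suc k)
  then show ?case using b_ge[of k] m_pos[of k] by (simp add: Q_Suc)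
qed (simp add: Q_0)

lemma q_pos: "0 < q k" by (simp add: q_def Q_pos)

lemma g_pos: "0 < g k" by (simp add: g_def Q_pos m_pos)

lemma Q_Suc_g: "Q (Suc k) = b k * g k" by (simp add: Q_Suc g_def)

lemma q_Suc_g: "q (Suc k) = 2 ^ Suc (Suc k) * b k * g k" by (simp add: q_def Q_Suc_g)

lemma proj_less: "proj k t < q k"
proof -
  have "proj k t < Q k + Q k * (2 ^ Suc k - 1)"
    unfolding proj_def
    by (intro add_less_le_mono mult_left_mono) (auto simp: Q_pos less_Suc_eq_le[symmetric])
  also have "\<dots> = q k"
    by (simp add: q_def algebra_simps)
  finally show ?thesis .
qed

text \<open>Half a turn of the cycle of stage \<open>k + 1\<close> is translation of the fibre by
  \<open>1/2\<close>, which is half a turn at stage \<open>k\<close> as well. This carries a flip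
  down to the two halves of the fibre.\<close>

lemma proj_add_half:
  "proj k (t + 2 ^ Suc k * Q (Suc k)) = (proj k t + 2 ^ k * Q k) mod q k"
proof -
  let ?l = "t div Q (Suc k) div 2 + shift k (t mod Q (Suc k) div Q k)"
  have dvd: "Q k dvd Q (Suc k)" by (simp add: Q_Suc)
  have 1: "(t + 2 ^ Suc k * Q (Suc k)) mod Q k = t mod Q k"
    using dvd by (metis dvd_mult mod_add_right_eq dvd_imp_mod_0 add_0_right)
  have 2: "(t + 2 ^ Suc k * Q (Suc k)) div Q (Suc k) = t div Q (Suc k) + 2 ^ Suc k"
    by (metis Q_pos div_mult_self3 add.commute less_not_refl2)
  have 3: "(t + 2 ^ Suc k * Q (Suc k)) mod Q (Suc k) = t mod Q (Suc k)" by simp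
  have 4: "(t div Q (Suc k) + 2 ^ Suc k) div 2 = t div Q (Suc k) div 2 + 2 ^ k" by simp
  have "proj k (t + 2 ^ Suc k * Q (Suc k)) = t mod Q k + Q k * ((?l + 2 ^ k) mod 2 ^ Suc k)"
    unfolding proj_def 1 2 3 4 by (simp add: ac_simps)
  also have "\<dots> = (t mod Q k + Q k * (?l + 2 ^ k)) mod (Q k * 2 ^ Suc k)"
    by (simp add: mod_mult2_eq Q_pos)
  also have "\<dots> = ((t mod Q k + Q k * ?l) mod (Q k * 2 ^ Suc k) + 2 ^ k * Q k) mod (Q k * 2 ^ Suc k)"
    by (simp add: mod_simps algebra_simps)
  also have "(t mod Q k + Q k * ?l) mod (Q k * 2 ^ Suc k) = proj k t"
    by (simp add: mod_mult2_eq Q_pos proj_def)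
  finally show ?thesis by (simp add: q_def mult.commute)
qed

lemma proj_mod_eq: "proj k t = (t mod Q k +
     Q k * (t div Q (Suc k) div 2 + shift k (t mod Q (Suc k) div Q k))) mod q k"
  by (simp add: mod_mult2_eq Q_pos proj_def q_def mult.commute[of "2 ^ Suc k"] del: power_Suc)

lemma proj_add_q: "proj k (t + q (Suc k)) = proj k t"
proof -
  have "t + q (Suc k) = t + 2 ^ Suc k * Q (Suc k) + 2 ^ Suc k * Q (Suc k)"
    by (simp add: q_def)
  then have "proj k (t + q (Suc k)) = ((proj k t + 2 ^ k * Q k) mod q k + 2 ^ k * Q k) mod q k"
    by (simp only: proj_add_half)
  also have "\<dots> = (proj k t + (2 ^ k * Q k + 2 ^ k * Q k)) mod q k"
    by (simp only: mod_add_left_eq add.assoc)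
  also have "2 ^ k * Q k + 2 ^ k * Q k = q k" by (simp add: q_def)
  finally show ?thesis using proj_less by simp
qed

lemma proj_mod: "proj k (t mod q (Suc k)) = proj k t"
proof -
  have "proj k (s + n * q (Suc k)) = proj k s" for s n
  proof (induction n)
    case (Suc n)
    have "s + Suc n * q (Suc k) = s + n * q (Suc k) + q (Suc k)" by simp
    then show ?case using Suc by (simp only: proj_add_q)
  qed simp
  from this[of "t mod q (Suc k)" "t div q (Suc k)"] show ?thesis
    by (simp only: mod_div_mult_eq)
qed

text \<open>Inside a run of length \<open>Q k\<close> both positions advance by one. At its end the
  next digit grows by one, and the drift raises the vertical position by one, so the cycle
  continues. Only at the end of a block, where the \<open>1/2\<close>-term may change too, can it
  break.\<close>

lemma proj_Suc:
  assumes "\<not> g k dvd Suc t"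
  shows "proj k (Suc t) = Suc (proj k t) mod q k"
proof -
  define j where "j = t mod Q (Suc k)"
  define l where "l = t div Q (Suc k)"
  have gdvd: "g k dvd Q (Suc k)" by (simp add: Q_Suc_g)
  have "\<not> Q (Suc k) dvd Suc t" using assms gdvd dvd_trans by blast
  then have "Suc t mod Q (Suc k) \<noteq> 0" by (metis mod_0_imp_dvd)
  then have j': "Suc t mod Q (Suc k) = Suc j" and l': "Suc t div Q (Suc k) = l"
    unfolding j_def l_def by (auto simp: mod_Suc div_Suc split: if_splits)
  have tj: "t mod Q k = j mod Q k" unfolding j_def by (simp add: Q_Suc mod_mod_cancel)
  have tj': "Suc t mod Q k = Suc j mod Q k"
    unfolding j'[symmetric] by (simp add: Q_Suc mod_mod_cancel)
  show ?thesis
  proof (cases "Suc j mod Q k = 0")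
    case False
    then have "Suc j mod Q k = Suc (j mod Q k)" "Suc j div Q k = j div Q k"
      by (auto simp: mod_Suc div_Suc split: if_splits)
    then show ?thesis
      unfolding proj_mod_eq tj tj' j' l' using j_def l_def by (simp add: mod_Suc_eq)
  next
    case True
    then have e: "Suc (j mod Q k) = Q k" "Suc j div Q k = Suc (j div Q k)"
      using Q_pos[of k] by (auto simp: mod_Suc div_Suc split: if_splits)
    have "\<not> g k dvd Suc j"
    proof
      assume "g k dvd Suc j"
      moreover have "g k dvd Q (Suc k) * l" using gdvd by simp
      ultimately have "g k dvd Suc j + Q (Suc k) * l" by (rule dvd_add)
      moreover have "Suc t = Suc j + Q (Suc k) * l" unfolding j_def l_def by simp
      ultimately show False using assms by simp
    qed
    moreover have "g k dvd Suc j" if "m k dvd Suc (j div Q k)"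
    proof -
      from that obtain w where "Suc (j div Q k) = m k * w" by auto
      moreover have "Suc j = Suc (j div Q k) * Q k"
        using e True by (metis mod_0_imp_dvd dvd_div_mult_self)
      ultimately show ?thesis unfolding g_def by (simp add: mult.commute mult.left_commute)
    qed
    ultimately have "\<not> m k dvd Suc (j div Q k)" by auto
    then have "Suc (j div Q k) div m k = j div Q k div m k"
      by (auto simp: div_Suc mod_eq_0_iff_dvd)
    then have sh: "shift k (Suc (j div Q k)) = Suc (shift k (j div Q k))"
      by (simp add: shift_def)
    have "Suc (j mod Q k + Q k * (l div 2 + shift k (j div Q k))) =
       Q k * (l div 2 + Suc (shift k (j div Q k)))"
      using e(1) by (simp add: algebra_simps)
    moreover have "proj k (Suc t) = (Q k * (l div 2 + Suc (shift k (j div Q k)))) mod q k"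
      unfolding proj_mod_eq tj' j' l' e(2) sh True by simp
    moreover have "proj k t = (j mod Q k + Q k * (l div 2 + shift k (j div Q k))) mod q k"
      unfolding proj_mod_eq tj by (simp only: j_def l_def)
    ultimately show ?thesis by (simp only: mod_Suc_eq)
  qed
qed

text \<open>Times at the same offset in two blocks have digits congruent modulo \<open>m k\<close>,
  hence modulo \<open>2^Suc k\<close> by \<open>m_dvd\<close>. The drifts agree modulo 1, and only
  the difference of the \<open>1/2\<close>-terms remains.\<close>

lemma proj_flip:
  assumes "t div Q (Suc k) = t' div Q (Suc k)" "t mod g k = t' mod g k"
    and "c k (t mod Q (Suc k) div g k) \<noteq> c k (t' mod Q (Suc k) div g k)"
  shows "proj k t' = (proj k t + 2 ^ k * Q k) mod q k"
proof -
  define d where "d = t mod Q (Suc k) div Q k"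
  define d' where "d' = t' mod Q (Suc k) div Q k"
  have gdvd: "g k dvd Q (Suc k)" by (simp add: Q_Suc_g)
  have blk: "d div m k = t mod Q (Suc k) div g k" "d' div m k = t' mod Q (Suc k) div g k"
    unfolding d_def d'_def g_def by (simp_all add: div_mult2_eq mult.commute[of "m k"])
  have md: "x mod Q (Suc k) div Q k mod m k = (x mod g k) div Q k" for x
  proof -
    have "x mod g k = x mod Q (Suc k) mod g k" using gdvd by (simp add: mod_mod_cancel)
    also have "\<dots> = x mod Q (Suc k) mod (Q k * m k)" by (simp add: g_def mult.commute)
    finally show ?thesis
      using Q_pos[of k] by (simp add: mod_mult2_eq)
  qed
  have dm: "d mod m k = d' mod m k" unfolding d_def d'_def md assms(2) ..
  then have dr: "d mod 2 ^ Suc k = d' mod 2 ^ Suc k"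
    using m_dvd[of k] by (metis mod_mod_cancel)
  have cc: "c k (d div m k) \<noteq> c k (d' div m k)" using assms(3) blk by simp
  have sh: "shift k d' mod 2 ^ Suc k = (shift k d + 2 ^ k) mod 2 ^ Suc k"
  proof (cases "c k (d div m k)")
    case True
    then have "shift k d' = d'" "shift k d + 2 ^ k = d + 2 ^ Suc k"
      using cc by (auto simp: shift_def)
    then show ?thesis using dr by (simp only: mod_add_self2)
  next
    case False
    then have "shift k d' = d' + 2 ^ k" "shift k d = d"
      using cc by (auto simp: shift_def)
    then show ?thesis using dr by (metis mod_add_left_eq)
  qed
  have "Q k dvd g k" by (simp add: g_def)
  then have tQ: "t mod Q k = t' mod Q k" using assms(2) by (metis mod_mod_cancel)
  define a where "a = t div Q (Suc k) div 2"
  have "(a + shift k d') mod 2 ^ Suc k = (a + shift k d + 2 ^ k) mod 2 ^ Suc k"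
    using sh by (metis add.assoc mod_add_right_eq)
  then have "Q k * (a + shift k d') mod q k = Q k * (a + shift k d + 2 ^ k) mod q k"
    unfolding q_def by (simp add: mult.commute[of _ "Q k"] flip: mult_mod_right)
  then have "(t mod Q k + Q k * (a + shift k d')) mod q k =
     (t mod Q k + Q k * (a + shift k d + 2 ^ k)) mod q k"
    by (metis mod_add_right_eq)
  also have "t mod Q k + Q k * (a + shift k d + 2 ^ k) =
     (t mod Q k + Q k * (a + shift k d)) + 2 ^ k * Q k" by (simp add: algebra_simps)
  finally show ?thesis
    unfolding proj_mod_eq d_def[symmetric] d'_def[symmetric] assms(1)[symmetric] a_def[symmetric] tQ[symmetric]
    by (simp add: mod_add_left_eq)
qed

lemma proj_add:
  assumes "t mod g k + i < g k"
  shows "proj k (t + i) = (proj k t + i) mod q k"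
  using assms
proof (induction i)
  case 0
  then show ?case using proj_less by simp
next
  case (Suc i)
  have "(t + i) mod g k = t mod g k + i"
    using Suc.prems by (metis Suc_lessD add_Suc_right mod_add_left_eq mod_less)
  then have "Suc (t + i) mod g k = Suc (t mod g k + i)"
    using Suc.prems by (simp add: mod_Suc)
  then have "\<not> g k dvd Suc (t + i)" by auto
  then show ?case using Suc proj_Suc by (simp add: mod_Suc_eq)
qed

text \<open>A delay \<open>w\<close> that is a multiple of the period \<open>q k\<close> is
  invisible while the delayed time stays in the same block, so mismatches occur only at the last
  \<open>w\<close> offsets of a block. A window of length \<open>n\<close> meets at most
  \<open>n div g k + 2\<close> blocks.\<close>

lemma card_proj_mismatch:
  assumes "q k dvd w" "w \<le> g k"
  shows "card {i. i < n \<and> proj k (t + w + i) \<noteq> proj k (t + i)} \<le> w * (n div g k + 2)"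
proof -
  define A where "A = {i. i < n \<and> proj k (t + w + i) \<noteq> proj k (t + i)}"
  define f where "f = (\<lambda>i. ((t + i) div g k, (t + i) mod g k))"
  define S where "S = {t div g k..t div g k + (n div g k + 1)} \<times> {g k - w..<g k}"
  have inj: "inj_on f A"
  proof (rule inj_onI)
    fix i i' assume "f i = f i'"
    then have "(t + i) div g k * g k + (t + i) mod g k = (t + i') div g k * g k + (t + i') mod g k"
      by (simp only: f_def prod.inject)
    then have "t + i = t + i'" by (simp only: div_mult_mod_eq)
    then show "i = i'" by simp
  qed
  have "f i \<in> S" if i: "i \<in> A" for i
  proof -
    have "\<not> (t + i) mod g k + w < g k"
    proof
      assume "(t + i) mod g k + w < g k"
      then have "proj k (t + i + w) = (proj k (t + i) + w) mod q k" by (rule proj_add)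
      also have "\<dots> = proj k (t + i)"
        using assms(1) proj_less[of k "t + i"] by (auto elim!: dvdE)
      finally show False using i by (simp add: A_def ac_simps)
    qed
    moreover have "(t + i) div g k \<le> t div g k + (n div g k + 1)"
    proof -
      have "(t + i) div g k \<le> (t + n) div g k"
        using i by (intro div_le_mono) (simp add: A_def)
      then show ?thesis using div_add_le[OF g_pos, of t n k] by linarith
    qed
    moreover have "t div g k \<le> (t + i) div g k" by (intro div_le_mono) simp
    moreover have "(t + i) mod g k < g k" by (simp add: g_pos)
    ultimately show "f i \<in> S"
      unfolding S_def f_def by simp
  qed
  then have "f ` A \<subseteq> S" by blast
  moreover have "finite S" by (simp add: S_def)
  ultimately have "card A \<le> card S"
    using inj by (rule card_inj_on_le[rotated])
  also have "card S = w * (n div g k + 2)"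
    using assms(2) by (simp add: card_cartesian_product S_def)
  finally show ?thesis unfolding A_def .
qed

text \<open>\<open>base k t\<close> is the half of the fibre containing the rectangle \<open>t\<close> of stage \<open>k\<close>.\<close>

fun base :: "nat \<Rightarrow> nat \<Rightarrow> nat" where
  "base 0 t = t"
| "base (Suc k) t = base k (proj k t)"

text \<open>\<open>proj_add_half\<close> pushes half a turn down one stage at a time; at stage 0
  there are two rectangles, and half a turn exchanges them.\<close>

lemma base_flip:
  "t < q k \<Longrightarrow> base k t < 2 \<and> base k ((t + 2 ^ k * Q k) mod q k) = 1 - base k t"
proof (induction k arbitrary: t)
  case 0
  then have "t = 0 \<or> t = 1" by (auto simp: q_def Q_0)
  then show ?case by (auto simp: q_def Q_0)
next
  case (Suc k)
  have "base (Suc k) ((t + 2 ^ Suc k * Q (Suc k)) mod q (Suc k)) =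
     base k ((proj k t + 2 ^ k * Q k) mod q k)"
    by (simp only: base.simps proj_mod proj_add_half)
  then show ?case using Suc.IH[OF proj_less, of t] by simp
qed

end

subsection \<open>Slow entropy of measure-preserving maps\<close>

text \<open>Turns the limit in the slow entropy into a supremum, so that upper bounds can be proved
  for each \<open>\<epsilon>\<close> separately and a lower bound at a single
  \<open>\<epsilon>\<close>.\<close>

lemma Lim_at_right_antimono:
  fixes f :: "real \<Rightarrow> ennreal"
  assumes "\<And>x y. 0 < x \<Longrightarrow> x \<le> y \<Longrightarrow> f y \<le> f x"
  shows "Lim (at_right 0) f = (SUP x\<in>{0<..}. f x)"
proof (rule tendsto_Lim)
  show "(f \<longlongrightarrow> (SUP x\<in>{0<..}. f x)) (at_right 0)"
  proof (rule order_tendstoI)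
    fix a assume "a < (SUP x\<in>{0<..}. f x)"
    then obtain x where x: "0 < x" "a < f x" by (auto simp: less_SUP_iff)
    then have "a < f y" if "y \<in> {0<..<x}" for y
      using assms[of y x] that by (auto intro: less_le_trans)
    then show "\<forall>\<^sub>F y in at_right 0. a < f y"
      using x(1) by (auto simp: eventually_at_right_field)
  next
    fix a assume a: "(SUP x\<in>{0<..}. f x) < a"
    have "f y < a" if "y > 0" for y
      using that by (intro le_less_trans[OF SUP_upper a]) auto
    then show "\<forall>\<^sub>F y in at_right 0. f y < a"
      by (auto simp: eventually_at_right_field intro!: exI[of _ 1])
  qed
qed simp

locale mpt_space = finite_measure M for M :: "'a measure" +
  fixes T :: "'a \<Rightarrow> 'a"
  assumes total: "measure M (space M) = 1"
    and mpt: "invertible_mpt M T"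
begin

lemma T_meas [measurable]: "T \<in> measurable M M"
  using mpt by (simp add: invertible_mpt_def)

lemma iter_meas [measurable]: "T ^^ i \<in> measurable M M"
  by (induction i) (auto intro: measurable_comp T_meas)

lemma iter_space: "x \<in> space M \<Longrightarrow> (T ^^ i) x \<in> space M"
  using measurable_space[OF iter_meas] .

lemma T_space: "x \<in> space M \<Longrightarrow> T x \<in> space M"
  using measurable_space[OF T_meas] .

lemma measure_T: "A \<in> sets M \<Longrightarrow> measure M {x \<in> space M. T x \<in> A} = measure M A"
  using mpt by (simp add: invertible_mpt_def measure_def vimage_def Int_def conj_commute)

lemma measure_iter: "A \<in> sets M \<Longrightarrow> measure M {x \<in> space M. (T ^^ i) x \<in> A} = measure M A"
proof (induction i)
  case 0
  then have "{x \<in> space M. x \<in> A} = A" using sets.sets_into_space by auto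
  then show ?case by simp
next
  case (Suc i)
  have "{x \<in> space M. (T ^^ i) x \<in> A} \<in> sets M"
    using Suc.prems by measurable
  then have "measure M {x \<in> space M. T x \<in> {x \<in> space M. (T ^^ i) x \<in> A}} = measure M A"
    using Suc by (subst measure_T) auto
  also have "{x \<in> space M. T x \<in> {x \<in> space M. (T ^^ i) x \<in> A}} =
      {x \<in> space M. (T ^^ Suc i) x \<in> A}"
    using T_space by (auto simp: funpow_swap1)
  finally show ?case .
qed

lemma T_image:
  assumes "A \<in> sets M"
  shows "T ` A \<in> sets M" "measure M (T ` A) = measure M A"
proof -
  have bij: "bij_betw T (space M) (space M)"
    and inv: "the_inv_into (space M) T \<in> measurable M M"
    using mpt by (auto simp: invertible_mpt_def)
  have sub: "A \<subseteq> space M" using assms sets.sets_into_space by auto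
  have inj: "inj_on T (space M)" using bij by (simp add: bij_betw_def)
  have "T ` A = the_inv_into (space M) T -` A \<inter> space M"
  proof (intro set_eqI iffI)
    fix y assume "y \<in> T ` A"
    then show "y \<in> the_inv_into (space M) T -` A \<inter> space M"
      using sub inj T_space by (auto simp: the_inv_into_f_f)
  next
    fix y assume y: "y \<in> the_inv_into (space M) T -` A \<inter> space M"
    then have "T (the_inv_into (space M) T y) = y"
      using bij by (auto intro!: f_the_inv_into_f simp: bij_betw_def)
    then show "y \<in> T ` A" using y by (metis IntD1 imageI vimageE)
  qed
  then show 1: "T ` A \<in> sets M" using inv assms by (simp add: measurable_sets)
  have "{x \<in> space M. T x \<in> T ` A} = A"
    using sub inj by (auto simp: inj_on_def)
  then show "measure M (T ` A) = measure M A" using measure_T[OF 1] by simp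
qed

section \<open>Names, Hamming balls and covering numbers of a partition\<close>

context
  fixes P :: "'a set set"
  assumes P: "finite_measurable_partition M P"
begin

lemma part_ex1: "x \<in> space M \<Longrightarrow> \<exists>!c. c \<in> P \<and> x \<in> c"
  using P unfolding finite_measurable_partition_def partition_on_def disjoint_def
  by (metis UnionE disjoint_iff)

lemma itinerary_eq: "x \<in> space M \<Longrightarrow> c \<in> P \<Longrightarrow> itinerary T P x i = c \<longleftrightarrow> (T ^^ i) x \<in> c"
  unfolding itinerary_def using part_ex1[OF iter_space, of x i]
  by (metis (mono_tags, lifting) theI')

lemma itinerary_in: "x \<in> space M \<Longrightarrow> itinerary T P x i \<in> P"
  unfolding itinerary_def using theI'[OF part_ex1[OF iter_space, of x i]] by simp

lemma itinerary_meas [measurable]: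
  "{x \<in> space M. itinerary T P x i = c} \<in> sets M"
proof (cases "c \<in> P")
  case True
  then have "c \<in> sets M" using P by (auto simp: finite_measurable_partition_def)
  then have "{x \<in> space M. (T ^^ i) x \<in> c} \<in> sets M" by measurable
  also have "{x \<in> space M. (T ^^ i) x \<in> c} = {x \<in> space M. itinerary T P x i = c}"
    using itinerary_eq[OF _ True] by (intro Collect_cong) blast
  finally show ?thesis .
next
  case False
  then have "{x \<in> space M. itinerary T P x i = c} = {}" using itinerary_in by auto
  then show ?thesis by (metis sets.empty_sets)
qed

lemma hamming_dist_sum:
  "hamming_dist n w w' = (\<Sum>i<n. if w i = w' i then 0 else 1) / real n"
  unfolding hamming_dist_def
  by (subst sum.If_cases) (auto simp: Int_def intro!: arg_cong[where f = card])

lemma hamming_ball_meas [measurable]: "hamming_ball M T P n \<epsilon> x \<in> sets M"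
proof -
  have [measurable]: "Measurable.pred M (\<lambda>y. itinerary T P x i = itinerary T P y i)" for i
    using itinerary_meas[of i "itinerary T P x i"] by (simp add: pred_def eq_commute)
  have "{y \<in> space M. (\<Sum>i<n. if itinerary T P x i = itinerary T P y i then 0 else 1) / real n < \<epsilon>} \<in> sets M"
    by measurable
  then show ?thesis unfolding hamming_ball_def hamming_dist_sum .
qed

lemma hamming_dist_commute: "hamming_dist n w w' = hamming_dist n w' w"
  unfolding hamming_dist_def by (simp add: eq_commute)

lemma hamming_dist_triangle: "hamming_dist n w w'' \<le> hamming_dist n w w' + hamming_dist n w' w''"
proof -
  have "card {k. k < n \<and> w k \<noteq> w'' k} \<le>
      card ({k. k < n \<and> w k \<noteq> w' k} \<union> {k. k < n \<and> w' k \<noteq> w'' k})"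
    by (rule card_mono) auto
  also have "\<dots> \<le> card {k. k < n \<and> w k \<noteq> w' k} + card {k. k < n \<and> w' k \<noteq> w'' k}"
    by (rule card_Un_le)
  finally show ?thesis
    unfolding hamming_dist_def by (simp add: divide_right_mono flip: add_divide_distrib of_nat_add)
qed

lemma covering_number_le_card:
  assumes "\<B> \<subseteq> hamming_ball M T P n \<epsilon> ` space M" "finite \<B>" "measure M (\<Union>\<B>) > 1 - \<epsilon>"
  shows "covering_number M T P n \<epsilon> \<le> card \<B>"
  unfolding covering_number_def using assms by (intro Least_le) blast

text \<open>A ball depends only on the first \<open>n\<close> letters of its centre, and the
  alphabet \<open>P\<close> is finite.\<close>

lemma hamming_balls_finite: "finite (hamming_ball M T P n \<epsilon> ` space M)"
proof -
  have fin: "finite P" using P by (simp add: finite_measurable_partition_def)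
  define W where "W = {..<n} \<rightarrow>\<^sub>E P"
  define h where "h w = {y \<in> space M. hamming_dist n w (itinerary T P y) < \<epsilon>}" for w
  have "hamming_ball M T P n \<epsilon> x \<in> h ` W" if "x \<in> space M" for x
  proof (rule image_eqI)
    show "restrict (itinerary T P x) {..<n} \<in> W"
      using itinerary_in[OF that] by (auto simp: W_def)
    have "{k. k < n \<and> restrict (itinerary T P x) {..<n} k \<noteq> w k} =
        {k. k < n \<and> itinerary T P x k \<noteq> w k}" for w
      by auto
    then show "hamming_ball M T P n \<epsilon> x = h (restrict (itinerary T P x) {..<n})"
      by (simp add: hamming_ball_def h_def hamming_dist_def)
  qed
  then have "hamming_ball M T P n \<epsilon> ` space M \<subseteq> h ` W" by blast
  moreover have "finite W" unfolding W_def using fin by (intro finite_PiE) auto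
  ultimately show ?thesis by (meson finite_imageI finite_subset)
qed

text \<open>All balls together cover the space, so the minimum in \<open>covering_number\<close> is
  taken over a nonempty set and is attained.\<close>

lemma covering_number_witness:
  assumes "0 < \<epsilon>"
  obtains \<B> where "\<B> \<subseteq> hamming_ball M T P n \<epsilon> ` space M" "finite \<B>"
    "card \<B> = covering_number M T P n \<epsilon>" "measure M (\<Union>\<B>) > 1 - \<epsilon>"
proof -
  let ?B = "hamming_ball M T P n \<epsilon> ` space M"
  have "\<Union>?B = space M"
    using assms by (auto simp: hamming_ball_def hamming_dist_def)
  then have "measure M (\<Union>?B) > 1 - \<epsilon>" using total assms by simp
  then have "\<exists>k \<B>. \<B> \<subseteq> ?B \<and> finite \<B> \<and> card \<B> = k \<and> measure M (\<Union>\<B>) > 1 - \<epsilon>"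
    using hamming_balls_finite by blast
  from LeastI_ex[OF this] show ?thesis
    using that unfolding covering_number_def by blast
qed

text \<open>The centres of a minimal family for \<open>\<epsilon>\<close> also serve for
  \<open>\<epsilon>'\<close>, where both the radius and the part that may stay uncovered are
  larger.\<close>

lemma covering_number_antimono:
  assumes "0 < \<epsilon>" "\<epsilon> \<le> \<epsilon>'"
  shows "covering_number M T P n \<epsilon>' \<le> covering_number M T P n \<epsilon>"
proof -
  obtain \<B> where B: "\<B> \<subseteq> hamming_ball M T P n \<epsilon> ` space M" "finite \<B>"
    "card \<B> = covering_number M T P n \<epsilon>" "measure M (\<Union>\<B>) > 1 - \<epsilon>"
    using covering_number_witness[OF assms(1)] .
  from B(1,2) obtain Y where Y: "Y \<subseteq> space M" "finite Y" "inj_on (hamming_ball M T P n \<epsilon>) Y"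
    "\<B> = hamming_ball M T P n \<epsilon> ` Y"
    by (metis subset_image_inj finite_imageD)
  let ?B' = "hamming_ball M T P n \<epsilon>' ` Y"
  have "1 - \<epsilon>' < measure M (\<Union>\<B>)" using B(4) assms by linarith
  also have "\<dots> \<le> measure M (\<Union>?B')"
  proof (rule finite_measure_mono)
    show "\<Union>\<B> \<subseteq> \<Union>?B'"
      unfolding Y(4) using assms by (force simp: hamming_ball_def)
    show "\<Union>?B' \<in> sets M" using Y(2) by (intro sets.finite_Union) auto
  qed
  finally have "covering_number M T P n \<epsilon>' \<le> card ?B'"
    using Y by (intro covering_number_le_card) auto
  also have "\<dots> \<le> card Y" using Y(2) by (rule card_image_le)
  also have "card Y = card \<B>" unfolding Y(4) by (rule card_image[OF Y(3), symmetric])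
  finally show ?thesis using B(3) by simp
qed

text \<open>One centre is taken from each class met by \<open>G\<close>. The class need not
  determine the name, only fix it up to Hamming distance \<open>\<epsilon>\<close>.\<close>

lemma covering_number_le_classes:
  fixes cls :: "'a \<Rightarrow> 'b"
  assumes "G \<in> sets M" "measure M G > 1 - \<epsilon>"
    and "finite J" "cls ` G \<subseteq> J"
    and close: "\<And>x y. x \<in> G \<Longrightarrow> y \<in> G \<Longrightarrow> cls x = cls y \<Longrightarrow>
      hamming_dist n (itinerary T P x) (itinerary T P y) < \<epsilon>"
  shows "covering_number M T P n \<epsilon> \<le> card J"
proof -
  define rep where "rep j = (SOME x. x \<in> G \<and> cls x = j)" for j
  have rep: "rep (cls x) \<in> G" "cls (rep (cls x)) = cls x" if "x \<in> G" for x
    using someI_ex[of "\<lambda>y. y \<in> G \<and> cls y = cls x"] that unfolding rep_def by blast+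
  have sub: "G \<subseteq> space M" using assms(1) sets.sets_into_space by auto
  let ?B = "(\<lambda>j. hamming_ball M T P n \<epsilon> (rep j)) ` cls ` G"
  have fin: "finite (cls ` G)" using assms(3,4) finite_subset by blast
  have "1 - \<epsilon> < measure M G" by fact
  also have "\<dots> \<le> measure M (\<Union>?B)"
  proof (rule finite_measure_mono)
    show "G \<subseteq> \<Union>?B"
    proof
      fix y assume y: "y \<in> G"
      then have "y \<in> hamming_ball M T P n \<epsilon> (rep (cls y))"
        using close[OF rep(1)[OF y] y rep(2)[OF y]] sub by (auto simp: hamming_ball_def)
      then show "y \<in> \<Union>?B" using y by blast
    qed
    show "\<Union>?B \<in> sets M" using fin by (intro sets.finite_Union) auto
  qed
  finally have "covering_number M T P n \<epsilon> \<le> card ?B"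
    using fin rep sub by (intro covering_number_le_card) auto
  also have "\<dots> \<le> card (cls ` G)" using fin by (rule card_image_le)
  also have "\<dots> \<le> card J" using assms(3,4) by (rule card_mono)
  finally show ?thesis .
qed

lemma Lim_growth_exponent:
  assumes "\<And>n t. 0 \<le> a n t"
  shows "Lim (at_right 0) (\<lambda>\<epsilon>. growth_exponent a M T \<epsilon> P) = (SUP \<epsilon>\<in>{0<..}. growth_exponent a M T \<epsilon> P)"
proof (rule Lim_at_right_antimono)
  fix x y :: real assume xy: "0 < x" "x \<le> y"
  have "growth_params a M T y P \<subseteq> growth_params a M T x P"
  proof (clarsimp simp: growth_params_def)
    fix t assume "0 < limsup (\<lambda>n. ereal (real (covering_number M T P n y) / a n t))"
    also have "\<dots> \<le> limsup (\<lambda>n. ereal (real (covering_number M T P n x) / a n t))"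
      using covering_number_antimono[OF xy] assms
      by (intro Limsup_mono always_eventually) (auto intro!: divide_right_mono)
    finally show "0 < limsup (\<lambda>n. ereal (real (covering_number M T P n x) / a n t))" .
  qed
  then show "growth_exponent a M T y P \<le> growth_exponent a M T x P"
    unfolding growth_exponent_def by (auto intro: SUP_subset_mono)
qed

end

end

subsection \<open>Cyclic approximation\<close>

lemma sets_Collect_count_space2:
  fixes f g :: "'a \<Rightarrow> nat"
  assumes "f \<in> measurable M (count_space UNIV)" "g \<in> measurable M (count_space UNIV)"
  shows "{x \<in> space M. P (f x) (g x)} \<in> sets M"
proof -
  have "{x \<in> space M. P (f x) (g x)} =
      (\<Union>i. (f -` {i} \<inter> space M) \<inter> (g -` {j. P i j} \<inter> space M))"
    by auto
  also have "\<dots> \<in> sets M"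
    by (intro sets.countable_UN image_subsetI sets.Int measurable_sets[OF assms(1)]
        measurable_sets[OF assms(2)]) simp_all
  finally show ?thesis .
qed

text \<open>Here \<open>p k\<close> assigns to a point its rectangle of stage \<open>k\<close>.
  Approximation and entropy follow from these axioms alone, and the axioms survive an embedding with
  image of full measure, so the computation is done once for all surfaces. The bound in
  \<open>p_step\<close> is the proportion of rectangles of stage \<open>k + 1\<close> that end a
  block.\<close>

locale tower_realization = tower_data Q m b c + mpt_space M T
  for Q m b :: "nat \<Rightarrow> nat" and c :: "nat \<Rightarrow> nat \<Rightarrow> bool"
    and M :: "'a measure" and T :: "'a \<Rightarrow> 'a" +
  fixes p :: "nat \<Rightarrow> 'a \<Rightarrow> nat"
  assumes p_meas [measurable]: "p k \<in> measurable M (count_space UNIV)"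
    and p_less: "x \<in> space M \<Longrightarrow> p k x < q k"
    and p_measure: "i < q k \<Longrightarrow> measure M {x \<in> space M. p k x = i} = 1 / q k"
    and p_proj: "x \<in> space M \<Longrightarrow> p k x = proj k (p (Suc k) x)"
    and p_step: "measure M {x \<in> space M. p k (T x) \<noteq> Suc (p k x) mod q k} \<le> 1 / g k"
    and p_exhaustive: "exhaustive M (\<lambda>k. (\<lambda>i. {x \<in> space M. p k x = i}) ` {..<q k})"
begin

abbreviation level :: "nat \<Rightarrow> nat \<Rightarrow> 'a set" where
  "level k i \<equiv> {x \<in> space M. p k x = i}"

abbreviation levels :: "nat \<Rightarrow> 'a set set" where
  "levels k \<equiv> level k ` {..<q k}"

lemma level_nonempty: "i < q k \<Longrightarrow> level k i \<noteq> {}"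
proof
  assume "i < q k" "level k i = {}"
  then have "1 / real (q k) = 0" using p_measure[of i k] by (simp only: measure_empty)
  then show False using q_pos[of k] by simp
qed

lemma level_inj: "inj_on (level k) {..<q k}"
proof (rule inj_onI)
  fix i j assume "i \<in> {..<q k}" and eq: "level k i = level k j"
  then obtain x where "x \<in> level k i" using level_nonempty by blast
  moreover from this have "x \<in> level k j" using eq by (simp only:)
  ultimately show "i = j" by simp
qed

lemma card_levels: "card (levels k) = q k"
  unfolding card_image[OF level_inj] by simp

lemma levels_partition: "finite_measurable_partition M (levels k)"
  unfolding finite_measurable_partition_def partition_on_def
proof (intro conjI)
  show "\<Union>(levels k) = space M" using p_less by auto
  show "disjoint (levels k)" by (auto simp: disjoint_def)
  show "{} \<notin> levels k" using level_nonempty by force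
qed auto

lemma measure_levels:
  assumes "A \<subseteq> {..<q k}"
  shows "measure M {x \<in> space M. p k x \<in> A} = card A / q k"
proof -
  have fin: "finite A" using assms finite_subset by blast
  have "{x \<in> space M. p k x \<in> A} = (\<Union>i\<in>A. level k i)" by auto
  then have "measure M {x \<in> space M. p k x \<in> A} = (\<Sum>i\<in>A. measure M (level k i))"
    using fin by (simp only:) (intro finite_measure_finite_Union, auto simp: disjoint_family_on_def)
  also have "\<dots> = (\<Sum>i\<in>A. 1 / q k)" using assms by (intro sum.cong refl p_measure) auto
  finally show ?thesis by simp
qed

lemma step_meas [measurable]:
  "{x \<in> space M. p k (T x) \<noteq> Suc (p k x) mod q k} \<in> sets M"
  by (rule sets_Collect_count_space2[OF measurable_compose[OF T_meas p_meas] p_meas,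
        where P = "\<lambda>i j. i \<noteq> Suc j mod q k"])

lemma iter_sets: "A \<in> sets M \<Longrightarrow> {x \<in> space M. (T ^^ i) x \<in> A} \<in> sets M"
  using measurable_sets[OF iter_meas, of A i] by (simp add: vimage_def Int_def conj_commute)

definition escape :: "nat \<Rightarrow> nat \<Rightarrow> 'a set" where
  "escape k n = {x \<in> space M. \<exists>i<n. p k (T ((T ^^ i) x)) \<noteq> Suc (p k ((T ^^ i) x)) mod q k}"

lemma escape_eq: "escape k n =
    (\<Union>i<n. {x \<in> space M. (T ^^ i) x \<in> {x \<in> space M. p k (T x) \<noteq> Suc (p k x) mod q k}})"
proof (intro set_eqI iffI)
  fix x assume "x \<in> escape k n"
  then obtain i where "x \<in> space M" "i < n" "p k (T ((T ^^ i) x)) \<noteq> Suc (p k ((T ^^ i) x)) mod q k"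
    by (auto simp: escape_def)
  then show "x \<in> (\<Union>i<n. {x \<in> space M. (T ^^ i) x \<in> {x \<in> space M. p k (T x) \<noteq> Suc (p k x) mod q k}})"
    using iter_space by blast
qed (auto simp: escape_def)

lemma escape_meas [measurable]: "escape k n \<in> sets M"
  unfolding escape_eq by (intro sets.finite_UN finite_lessThan iter_sets step_meas)

lemma measure_escape: "measure M (escape k n) \<le> n / g k"
proof -
  define B where "B = {x \<in> space M. p k (T x) \<noteq> Suc (p k x) mod q k}"
  have B [measurable]: "B \<in> sets M" unfolding B_def by (rule step_meas)
  have "escape k n = (\<Union>i<n. {x \<in> space M. (T ^^ i) x \<in> B})"
    unfolding escape_eq B_def ..
  also have "measure M \<dots> \<le> (\<Sum>i<n. measure M {x \<in> space M. (T ^^ i) x \<in> B})"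
    by (intro finite_measure_subadditive_finite image_subsetI iter_sets B) simp
  also have "\<dots> = n * measure M B" by (simp add: measure_iter B)
  also have "\<dots> \<le> n * (1 / g k)"
    unfolding B_def by (intro mult_left_mono p_step) auto
  finally show ?thesis by simp
qed

lemma p_iter:
  assumes "x \<in> space M" "x \<notin> escape k n" "i \<le> n"
  shows "p k ((T ^^ i) x) = (p k x + i) mod q k"
  using assms(3)
proof (induction i)
  case 0
  then show ?case using p_less[OF assms(1)] by simp
next
  case (Suc i)
  then have "p k (T ((T ^^ i) x)) = Suc (p k ((T ^^ i) x)) mod q k"
    using assms(1,2) by (auto simp: escape_def)
  then show ?case using Suc by (simp add: mod_Suc_eq)
qed

text \<open>The decisive reduction. At stage \<open>k + 1\<close> the cycle is followed by most
  points for times small against \<open>g (k + 1)\<close>; through \<open>proj\<close> this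
  describes the position at stage \<open>k\<close> far beyond \<open>g k\<close>, where the cycle of
  stage \<open>k\<close> itself is no longer followed.\<close>

lemma p_iter_proj:
  assumes "x \<in> space M" "x \<notin> escape (Suc k) n" "i \<le> n"
  shows "p k ((T ^^ i) x) = proj k (p (Suc k) x + i)"
  by (simp only: p_proj[OF iter_space[OF assms(1)], of k i] p_iter[OF assms] proj_mod)

lemma p_base: "x \<in> space M \<Longrightarrow> p 0 x = base k (p k x)"
proof (induction k)
  case (Suc k)
  then show ?case using p_proj[of x k] by (simp only: base.simps)
qed simp

text \<open>The permutation has to be a function on sets, so the index of a level is read off from
  an arbitrary point of it.\<close>

definition level_shift :: "nat \<Rightarrow> 'a set \<Rightarrow> 'a set" where
  "level_shift k L = level k (Suc (p k (SOME x. x \<in> L)) mod q k)"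

lemma level_shift_level:
  assumes "i < q k"
  shows "level_shift k (level k i) = level k (Suc i mod q k)"
proof -
  have "(SOME x. x \<in> level k i) \<in> level k i"
    using level_nonempty[OF assms] by (simp add: some_in_eq del: mem_Collect_eq)
  then show ?thesis by (simp add: level_shift_def)
qed

lemma cyclic_process_levels: "cyclic_process M (levels k) (level_shift k)"
  unfolding cyclic_process_def
proof (intro conjI levels_partition exI[of _ "level k"])
  show "\<forall>C\<in>levels k. \<forall>D\<in>levels k. measure M C = measure M D" using p_measure by auto
  show "bij_betw (level k) {..<card (levels k)} (levels k)"
    unfolding card_levels using level_inj by (simp add: bij_betw_def)
  show "\<forall>i<card (levels k). level_shift k (level k i) = level k (Suc i mod card (levels k))"
    unfolding card_levels using level_shift_level by auto
qed

text \<open>The image of a level and the next level have equal measure, so their symmetric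
  difference has twice the measure of the part of the image outside the next level, which comes from
  the points violating the step. Hence twice the bound of \<open>p_step\<close>.\<close>

lemma approx_error_levels: "approx_error M T (levels k) (level_shift k) \<le> 2 / g k"
proof -
  define B where "B = {x \<in> space M. p k (T x) \<noteq> Suc (p k x) mod q k}"
  have B [measurable]: "B \<in> sets M" unfolding B_def by (rule step_meas)
  have eq: "measure M (sym_diff (T ` level k i) (level k (Suc i mod q k))) = 2 * measure M (level k i \<inter> B)"
    if i: "i < q k" for i
  proof -
    define E where "E = T ` level k i"
    define F where "F = level k (Suc i mod q k)"
    have E: "E \<in> sets M" "measure M E = 1 / q k"
      unfolding E_def using T_image[of "level k i"] p_measure[OF i] by auto
    have F: "F \<in> sets M" "measure M F = 1 / q k"
      unfolding F_def using q_pos by (auto intro: p_measure)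
    have "E - F = T ` (level k i \<inter> B)"
      unfolding E_def F_def B_def using T_space by auto
    then have 1: "measure M (E - F) = measure M (level k i \<inter> B)"
      using T_image[of "level k i \<inter> B"] by auto
    have 2: "measure M (E - F) = measure M E - measure M (E \<inter> F)"
      "measure M (F - E) = measure M F - measure M (E \<inter> F)"
      using E F by (auto simp: finite_measure_Diff' Int_commute)
    have "measure M (sym_diff E F) = measure M (E - F) + measure M (F - E)"
      using E F by (intro finite_measure_Union) auto
    then show ?thesis using 1 2 E F unfolding E_def F_def by simp
  qed
  have "approx_error M T (levels k) (level_shift k) = (\<Sum>i<q k. 2 * measure M (level k i \<inter> B))"
    unfolding approx_error_def sum.reindex[OF level_inj]
    by (intro sum.cong) (auto simp: level_shift_level eq)
  also have "\<dots> = 2 * measure M (\<Union>i<q k. level k i \<inter> B)"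
    unfolding sum_distrib_left[symmetric]
    by (subst finite_measure_finite_Union) (auto simp: disjoint_family_on_def)
  also have "(\<Union>i<q k. level k i \<inter> B) = B"
    using p_less by (auto simp: B_def)
  finally show ?thesis using p_step[of k] by (simp add: B_def)
qed

lemma good_cyclic_approximation:
  assumes lim: "(\<lambda>k. q k / g k) \<longlonglongrightarrow> 0"
  shows "good_cyclic_approximation M T"
proof -
  have q1: "1 \<le> real (q k)" for k using q_pos[of k] by linarith
  have lim2: "(\<lambda>k. 2 * (q k / g k)) \<longlonglongrightarrow> 0" using tendsto_mult_left[OF lim, of 2] by simp
  have "cyclic_approximation M T levels level_shift"
    unfolding cyclic_approximation_def
  proof (intro conjI allI cyclic_process_levels p_exhaustive)
    show "(\<lambda>n. approx_error M T (levels n) (level_shift n)) \<longlonglongrightarrow> 0"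
    proof (rule tendsto_sandwich[OF _ _ tendsto_const lim2])
      show "\<forall>\<^sub>F n in sequentially. 0 \<le> approx_error M T (levels n) (level_shift n)"
        unfolding approx_error_def by (intro always_eventually allI sum_nonneg) simp
      have "2 / g n \<le> 2 * (q n / g n)" for n
        using q1[of n] g_pos[of n] by (simp add: divide_simps)
      then show "\<forall>\<^sub>F n in sequentially. approx_error M T (levels n) (level_shift n) \<le> 2 * (q n / g n)"
        using approx_error_levels by (intro always_eventually allI) (rule order_trans)
    qed
  qed
  \<comment> \<open>\<open>3\<close> instead of \<open>2\<close> gives the strict inequality in
    \<open>has_speed\<close>. That this speed is \<open>o(1 / q k)\<close> is exactly the assumption
    \<open>lim\<close>.\<close>
  moreover have "has_speed M T levels level_shift (\<lambda>k. 3 / g k)"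
    unfolding has_speed_def
  proof (intro exI[of _ id] conjI allI)
    fix k
    have "2 / g k < 3 / real (g k)" using g_pos[of k] by (simp add: divide_strict_right_mono)
    then show "approx_error M T (levels (id k)) (level_shift (id k)) < 3 / g (id k)"
      using approx_error_levels[of k] by simp
  qed (simp add: strict_mono_def)
  moreover have "(\<lambda>k. 3 / real (g k)) \<in> o(\<lambda>k. 1 / card (levels k))"
  proof (rule smalloI_tendsto)
    show "(\<lambda>k. 3 / g k / (1 / card (levels k))) \<longlonglongrightarrow> 0"
      using tendsto_mult_left[OF lim, of 3] by (simp add: card_levels)
    show "\<forall>\<^sub>F k in sequentially. 1 / real (card (levels k)) \<noteq> 0"
      using q_pos by (intro always_eventually) (auto simp: card_levels)
  qed
  ultimately show ?thesis unfolding good_cyclic_approximation_def by blast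
qed

subsection \<open>Upper bound for the covering numbers\<close>

text \<open>Every atom of \<open>P\<close> is close to a union of levels; off the union
  \<open>D\<close> of the errors, the level of a point determines its atom.\<close>

lemma partition_approximation:
  assumes P: "finite_measurable_partition M P" and "0 < \<eta>"
  shows "\<forall>\<^sub>F k in sequentially. \<exists>D\<in>sets M. measure M D \<le> \<eta> \<and>
    (\<forall>x\<in>space M - D. \<forall>y\<in>space M - D. p k x = p k y \<longrightarrow> (\<forall>c\<in>P. x \<in> c \<longrightarrow> y \<in> c))"
proof -
  have fin: "finite P" and sub: "P \<subseteq> sets M"
    using P by (auto simp: finite_measurable_partition_def)
  have "\<forall>C\<in>P. \<exists>\<A>. (\<forall>k. \<A> k \<subseteq> levels k) \<and>
      (\<lambda>k. measure M (sym_diff C (\<Union>(\<A> k)))) \<longlonglongrightarrow> 0"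
    using p_exhaustive sub unfolding exhaustive_def by blast
  from bchoice[OF this] obtain \<A> where "\<forall>C\<in>P. (\<forall>k. \<A> C k \<subseteq> levels k) \<and>
      (\<lambda>k. measure M (sym_diff C (\<Union>(\<A> C k)))) \<longlonglongrightarrow> 0" ..
  then have \<A>: "\<And>C k. C \<in> P \<Longrightarrow> \<A> C k \<subseteq> levels k"
    "\<And>C. C \<in> P \<Longrightarrow> (\<lambda>k. measure M (sym_diff C (\<Union>(\<A> C k)))) \<longlonglongrightarrow> 0"
    by simp_all
  have "(\<lambda>k. \<Sum>C\<in>P. measure M (sym_diff C (\<Union>(\<A> C k)))) \<longlonglongrightarrow> (\<Sum>C\<in>P. 0)"
    by (intro tendsto_sum \<A>)
  then have "\<forall>\<^sub>F k in sequentially. (\<Sum>C\<in>P. measure M (sym_diff C (\<Union>(\<A> C k)))) < \<eta>"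
    using \<open>0 < \<eta>\<close> by (simp add: order_tendstoD)
  then show ?thesis
  proof (rule eventually_mono)
    fix k assume less: "(\<Sum>C\<in>P. measure M (sym_diff C (\<Union>(\<A> C k)))) < \<eta>"
    define D where "D = (\<Union>C\<in>P. sym_diff C (\<Union>(\<A> C k)))"
    have meas: "sym_diff C (\<Union>(\<A> C k)) \<in> sets M" if "C \<in> P" for C
    proof -
      have "finite (\<A> C k)" "\<A> C k \<subseteq> sets M"
        using \<A>(1)[OF that, of k] finite_subset[of "\<A> C k" "levels k"] by auto
      then show ?thesis using that sub by (intro sets.Un sets.Diff sets.finite_Union) auto
    qed
    show "\<exists>D\<in>sets M. measure M D \<le> \<eta> \<and>
      (\<forall>x\<in>space M - D. \<forall>y\<in>space M - D. p k x = p k y \<longrightarrow> (\<forall>c\<in>P. x \<in> c \<longrightarrow> y \<in> c))"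
    proof (intro bexI[of _ D] conjI ballI impI)
      show "D \<in> sets M" unfolding D_def using fin meas by (intro sets.finite_UN) auto
      have "measure M D \<le> (\<Sum>C\<in>P. measure M (sym_diff C (\<Union>(\<A> C k))))"
        unfolding D_def using fin meas by (intro finite_measure_subadditive_finite) auto
      then show "measure M D \<le> \<eta>" using less by simp
    next
      fix x y C
      assume x: "x \<in> space M - D" and y: "y \<in> space M - D" and eq: "p k x = p k y"
        and C: "C \<in> P" "x \<in> C"
      then have "x \<in> \<Union>(\<A> C k)" by (auto simp: D_def)
      then obtain i where "level k i \<in> \<A> C k" "p k x = i"
        using \<A>(1)[OF C(1), of k] by blast
      moreover from this have "y \<in> level k i" using eq y by simp
      ultimately have "y \<in> \<Union>(\<A> C k)" by blast
      then show "y \<in> C" using y C(1) by (auto simp: D_def)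
    qed
  qed
qed

text \<open>Markov's inequality for the number of visits to \<open>D\<close>, whose mean is
  \<open>n * measure M D\<close> by invariance.\<close>

lemma measure_frequent_visits:
  fixes n :: nat and a :: real
  assumes D: "D \<in> sets M" and a: "0 < a"
  shows "{x \<in> space M. a \<le> card {i. i < n \<and> (T ^^ i) x \<in> D}} \<in> sets M" (is ?meas)
    "measure M {x \<in> space M. a \<le> card {i. i < n \<and> (T ^^ i) x \<in> D}} \<le> n * measure M D / a" (is ?le)
proof -
  define f where "f x = (\<Sum>i<n. indicator {x \<in> space M. (T ^^ i) x \<in> D} x :: real)" for x
  have f: "f x = card {i. i < n \<and> (T ^^ i) x \<in> D}" if "x \<in> space M" for x
    using that unfolding f_def indicator_def
    by (simp add: sum_of_bool_eq lessThan_def Int_def)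
  have fi [measurable]: "integrable M (indicator {x \<in> space M. (T ^^ i) x \<in> D} :: _ \<Rightarrow> real)" for i
    using iter_sets[OF D] by (intro integrable_real_indicator) (auto simp: emeasure_eq_measure)
  then have int: "integrable M f" unfolding f_def by (intro Bochner_Integration.integrable_sum)
  have eq: "{x \<in> space M. a \<le> card {i. i < n \<and> (T ^^ i) x \<in> D}} = {x \<in> space M. a \<le> f x}"
    using f by auto
  show ?meas unfolding eq using int by measurable
  have "measure M {x \<in> space M. a \<le> f x} \<le> (\<integral>x. f x \<partial>M) / a"
    by (intro integral_Markov_inequality_measure[where A = "space M"] int a)
      (auto simp: f_def intro!: sum_nonneg)
  also have "(\<integral>x. f x \<partial>M) = (\<Sum>i<n. measure M {x \<in> space M. (T ^^ i) x \<in> D})"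
    unfolding f_def using fi by (subst Bochner_Integration.integral_sum) (auto intro!: sum.cong arg_cong[where f = "measure M"])
  also have "\<dots> = n * measure M D" by (simp add: measure_iter[OF D])
  finally show ?le unfolding eq .
qed

text \<open>Equal residues modulo \<open>q k\<close> make the delay between the orbits a multiple of
  the period, equal quotients bound it by \<open>w\<close>, and \<open>card_proj_mismatch\<close>
  applies to this delay.\<close>

lemma card_level_mismatch:
  assumes x: "x \<in> space M" "x \<notin> escape (Suc k) n" and y: "y \<in> space M" "y \<notin> escape (Suc k) n"
    and w: "0 < w" "w \<le> g k"
    and cls: "p (Suc k) x mod q k = p (Suc k) y mod q k" "p (Suc k) x div w = p (Suc k) y div w"
  shows "card {i. i < n \<and> p k ((T ^^ i) x) \<noteq> p k ((T ^^ i) y)} \<le> w * (n div g k + 2)"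
proof -
  have le: "card {i. i < n \<and> p k ((T ^^ i) x) \<noteq> p k ((T ^^ i) y)} \<le> w * (n div g k + 2)"
    if x: "x \<in> space M" "x \<notin> escape (Suc k) n" and y: "y \<in> space M" "y \<notin> escape (Suc k) n"
      and cls: "p (Suc k) x mod q k = p (Suc k) y mod q k" "p (Suc k) x div w = p (Suc k) y div w"
      and le: "p (Suc k) x \<le> p (Suc k) y" for x y
  proof -
    define t where "t = p (Suc k) x"
    define v where "v = p (Suc k) y - p (Suc k) x"
    have ty: "p (Suc k) y = t + v" using le by (simp add: t_def v_def)
    have "q k dvd v" unfolding v_def using cls(1) le by (metis mod_eq_dvd_iff_nat)
    have "v \<le> w"
    proof -
      have "t mod w < w" "(t + v) mod w < w" using w by simp_all
      moreover have eq: "(t + v) div w = t div w" using cls(2) unfolding ty t_def[symmetric] by simp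
      moreover have "t div w * w + t mod w = t" by (rule div_mult_mod_eq)
      moreover have "t div w * w + (t + v) mod w = t + v"
        using div_mult_mod_eq[of "t + v" w] by (simp only: eq)
      ultimately show ?thesis by linarith
    qed
    have "{i. i < n \<and> p k ((T ^^ i) x) \<noteq> p k ((T ^^ i) y)} =
        {i. i < n \<and> proj k (t + v + i) \<noteq> proj k (t + i)}"
      using x y by (auto simp: p_iter_proj[where n = n] ty t_def[symmetric])
    then have "card {i. i < n \<and> p k ((T ^^ i) x) \<noteq> p k ((T ^^ i) y)} \<le> v * (n div g k + 2)"
      using \<open>q k dvd v\<close> \<open>v \<le> w\<close> w by (simp only:) (intro card_proj_mismatch, auto)
    then show ?thesis using mult_le_mono1[OF \<open>v \<le> w\<close>] by (rule order_trans)
  qed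
  show ?thesis
  proof (cases "p (Suc k) x \<le> p (Suc k) y")
    case True
    then show ?thesis by (rule le[OF x y cls])
  next
    case False
    then have "card {i. i < n \<and> p k ((T ^^ i) y) \<noteq> p k ((T ^^ i) x)} \<le> w * (n div g k + 2)"
      by (intro le[OF y x cls[symmetric]]) simp
    then show ?thesis by (simp only: eq_commute[of "p k ((T ^^ _) y)"])
  qed
qed

lemma g_le_q_Suc: "g k \<le> q (Suc k)"
  using b_ge[of k] by (simp add: q_Suc_g)

text \<open>The classes are given by \<open>q k\<close> residues and about
  \<open>q (Suc k) / w\<close> intervals of length \<open>w\<close>, where \<open>w\<close> is a
  small fixed fraction of \<open>g k\<close>. The range of \<open>n\<close> is limited below by the
  mismatches at block ends, which must be few against \<open>n\<close>, and above by the escape from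
  the cycle of stage \<open>k + 1\<close>.\<close>

lemma covering_number_upper:
  assumes lim: "(\<lambda>k. q k / g k) \<longlonglongrightarrow> 0"
    and P: "finite_measurable_partition M P" and \<epsilon>: "0 < \<epsilon>"
  shows "\<exists>(\<kappa>::real) (C::real). 0 < \<kappa> \<and> 0 < C \<and> (\<forall>\<^sub>F k in sequentially. \<forall>n.
    \<kappa> * g k \<le> real n \<longrightarrow> real n \<le> \<kappa> * g (Suc k) \<longrightarrow>
    real (covering_number M T P n \<epsilon>) \<le> C * (real (q k) * real (q (Suc k)) / g k))"
proof -
  \<comment> \<open>\<open>\<kappa>\<close> keeps the measure of the escape set of stage
    \<open>k + 1\<close> at most \<open>\<epsilon> / 4\<close>. There are at most
    \<open>\<delta> * (n + 2 * g k)\<close> mismatches, and \<open>\<delta>\<close> makes this at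
    most \<open>\<epsilon> / 4 * n\<close> as soon as \<open>\<kappa> * g k \<le> n\<close>.\<close>
  define \<kappa> where "\<kappa> = \<epsilon> / 4"
  define \<delta> where "\<delta> = min 1 (\<epsilon> / (4 * (1 + 2 / \<kappa>)))"
  have \<kappa>: "0 < \<kappa>" using \<epsilon> by (simp add: \<kappa>_def)
  have \<delta>: "0 < \<delta>" "\<delta> \<le> 1" "\<delta> * (1 + 2 / \<kappa>) \<le> \<epsilon> / 4"
  proof -
    have pos: "0 < 1 + 2 / \<kappa>" using \<kappa> by (simp add: add_pos_pos)
    then show "0 < \<delta>" using \<epsilon> by (simp add: \<delta>_def)
    show "\<delta> \<le> 1" by (simp add: \<delta>_def)
    have "\<delta> \<le> \<epsilon> / (4 * (1 + 2 / \<kappa>))" by (simp add: \<delta>_def)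
    then have "\<delta> * (1 + 2 / \<kappa>) \<le> \<epsilon> / (4 * (1 + 2 / \<kappa>)) * (1 + 2 / \<kappa>)"
      using pos by (intro mult_right_mono) auto
    also have "\<dots> = \<epsilon> / 4"
    proof -
      have "\<epsilon> / (4 * s) * s = \<epsilon> / 4" if "0 < s" for s :: real using that by simp
      then show ?thesis using pos by blast
    qed
    finally show "\<delta> * (1 + 2 / \<kappa>) \<le> \<epsilon> / 4" .
  qed
  define C where "C = 2 / \<delta> + 1"
  have C: "0 < C" using \<delta> by (simp add: C_def add_pos_pos)
  have ev1: "\<forall>\<^sub>F k in sequentially. q k / g k < \<delta>"
    using lim \<delta>(1) by (rule order_tendstoD)
  \<comment> \<open>Visits count as frequent from \<open>\<epsilon> / 4 * n\<close> on, so Markov's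
    inequality turns \<open>\<epsilon>\<^sup>2 / 64\<close> into
    \<open>\<epsilon> / 16\<close>.\<close>
  have "0 < \<epsilon>\<^sup>2 / 64" using \<epsilon> by simp
  note ev2 = partition_approximation[OF P this]
  have "\<forall>\<^sub>F k in sequentially. \<forall>n. \<kappa> * g k \<le> real n \<longrightarrow> real n \<le> \<kappa> * g (Suc k) \<longrightarrow>
    real (covering_number M T P n \<epsilon>) \<le> C * (real (q k) * real (q (Suc k)) / g k)"
    using ev1 ev2
  proof eventually_elim
    case (elim k)
    from elim(2) obtain D where D: "D \<in> sets M" "measure M D \<le> \<epsilon>\<^sup>2 / 64"
      and D': "\<forall>x\<in>space M - D. \<forall>y\<in>space M - D. p k x = p k y \<longrightarrow> (\<forall>c\<in>P. x \<in> c \<longrightarrow> y \<in> c)"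
      by (elim bexE conjE) (rule that)
    have gq: "0 < real (g k)" "0 < real (q k)" "0 < real (q (Suc k))"
      using g_pos q_pos by simp_all
    \<comment> \<open>The length \<open>w = e * q k\<close> is \<open>\<delta> * g k\<close> rounded
      down to whole periods. Since \<open>q k / g k < \<delta>\<close>, at least one period remains
      and at most half is lost.\<close>
    define e where "e = nat \<lfloor>\<delta> * g k / q k\<rfloor>"
    have ge1: "1 \<le> \<delta> * g k / q k" using elim(1) gq by (simp add: field_simps)
    then have e: "1 \<le> e" "real e \<le> \<delta> * g k / q k" "\<delta> * g k / q k \<le> 2 * e"
    proof -
      define z where "z = \<delta> * g k / q k"
      have "1 \<le> z" using ge1 by (simp add: z_def)
      then have fl: "1 \<le> \<lfloor>z\<rfloor>" by simp
      then have r: "real e = of_int \<lfloor>z\<rfloor>" by (simp add: e_def z_def)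
      have "(1::real) \<le> of_int \<lfloor>z\<rfloor>" using fl by linarith
      then have "1 \<le> real e" "real e \<le> z" "z \<le> 2 * real e"
        unfolding r using floor_correct[of z] by linarith+
      then show "1 \<le> e" "real e \<le> \<delta> * g k / q k" "\<delta> * g k / q k \<le> 2 * e"
        by (simp_all add: z_def)
    qed
    define w where "w = e * q k"
    have w0: "0 < w" using e(1) q_pos by (simp add: w_def)
    have wg: "real w \<le> \<delta> * g k" using e(2) gq by (simp add: w_def field_simps)
    also have "\<dots> \<le> 1 * real (g k)" using \<delta> by (intro mult_right_mono) auto
    finally have w_le: "w \<le> g k" by simp
    have w_ge: "\<delta> * g k \<le> 2 * w" using e(3) gq by (simp add: w_def field_simps)
    show ?case
    proof (intro allI impI)
      fix n :: nat assume n: "\<kappa> * g k \<le> real n" "real n \<le> \<kappa> * g (Suc k)"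
      have n0: "0 < real n" using n(1) \<kappa> gq by (meson less_le_trans mult_pos_pos)
      define Z where "Z = {x \<in> space M. \<epsilon> / 4 * n \<le> card {i. i < n \<and> (T ^^ i) x \<in> D}}"
      have pos: "0 < \<epsilon> / 4 * n" using \<epsilon> n0 by simp
      have Z: "Z \<in> sets M" unfolding Z_def by (rule measure_frequent_visits[OF D(1) pos])
      have "measure M Z \<le> n * measure M D / (\<epsilon> / 4 * n)"
        unfolding Z_def by (rule measure_frequent_visits[OF D(1) pos])
      also have "\<dots> \<le> n * (\<epsilon>\<^sup>2 / 64) / (\<epsilon> / 4 * n)"
        using D(2) pos by (intro divide_right_mono mult_left_mono) auto
      also have "\<dots> = \<epsilon> / 16" using \<epsilon> n0 by (simp add: field_simps power2_eq_square)
      finally have mZ: "measure M Z \<le> \<epsilon> / 16" .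
      have "measure M (escape (Suc k) n) \<le> n / g (Suc k)" by (rule measure_escape)
      also have "\<dots> \<le> \<epsilon> / 4" using n(2) g_pos[of "Suc k"] by (simp add: \<kappa>_def field_simps)
      finally have mE: "measure M (escape (Suc k) n) \<le> \<epsilon> / 4" .
      define G where "G = space M - (Z \<union> escape (Suc k) n)"
      have G: "G \<in> sets M" unfolding G_def using Z by auto
      have "measure M (Z \<union> escape (Suc k) n) \<le> measure M Z + measure M (escape (Suc k) n)"
        using Z by (intro measure_Un_le) auto
      then have "measure M (Z \<union> escape (Suc k) n) \<le> \<epsilon> / 16 + \<epsilon> / 4" using mZ mE by linarith
      moreover have "measure M G = 1 - measure M (Z \<union> escape (Suc k) n)"
        unfolding G_def using Z total by (subst finite_measure_compl) auto
      ultimately have mG: "measure M G > 1 - \<epsilon>" using \<epsilon> by simp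
      \<comment> \<open>points in the same class follow the same periodic sequence, shifted by at most \<open>w\<close>;
        the shift is visible only near the block boundaries\<close>
      define cls where "cls x = (p (Suc k) x mod q k, p (Suc k) x div w)" for x
      define J where "J = {..<q k} \<times> {..q (Suc k) div w}"
      have "covering_number M T P n \<epsilon> \<le> card J"
      proof (rule covering_number_le_classes[OF P G mG])
        show "finite J" by (simp add: J_def)
        show "cls ` G \<subseteq> J"
        proof (rule image_subsetI)
          fix x assume "x \<in> G"
          then have "p (Suc k) x < q (Suc k)" using p_less by (simp add: G_def)
          then have "p (Suc k) x div w \<le> q (Suc k) div w" by (intro div_le_mono) simp
          then show "cls x \<in> J" using q_pos by (simp add: cls_def J_def)
        qed
        fix x y assume x: "x \<in> G" and y: "y \<in> G" and eq: "cls x = cls y"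
        define A where "A = {i. i < n \<and> p k ((T ^^ i) x) \<noteq> p k ((T ^^ i) y)}"
        define V where "V x = {i. i < n \<and> (T ^^ i) x \<in> D}" for x
        have sp: "x \<in> space M" "y \<in> space M" using x y by (auto simp: G_def)
        have "card A \<le> w * (n div g k + 2)"
          unfolding A_def
          by (rule card_level_mismatch[OF _ _ _ _ w0 w_le])
            (use x y eq in \<open>auto simp: G_def cls_def\<close>)
        then have "real (card A) \<le> real (w * (n div g k + 2))" by (rule of_nat_mono)
        also have "\<dots> = w * (real (n div g k) + 2)" by (simp add: algebra_simps)
        also have "\<dots> \<le> (\<delta> * g k) * (n / g k + 2)"
          using wg \<delta> by (intro mult_mono add_mono) (auto simp: of_nat_div_le_of_nat)
        also have "\<dots> = \<delta> * (n + 2 * g k)" using gq by (simp add: field_simps)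
        also have "\<dots> \<le> \<delta> * (n + 2 * (n / \<kappa>))"
          using n(1) \<kappa> \<delta> by (intro mult_left_mono add_left_mono) (auto simp: field_simps)
        also have "\<dots> = \<delta> * (1 + 2 / \<kappa>) * n" by (simp add: field_simps)
        also have "\<dots> \<le> \<epsilon> / 4 * n" using \<delta>(3) by (intro mult_right_mono) auto
        finally have cA: "card A \<le> \<epsilon> / 4 * n" .
        have cV: "real (card (V x)) < \<epsilon> / 4 * n" "real (card (V y)) < \<epsilon> / 4 * n"
          using x y by (auto simp: G_def Z_def V_def)
        \<comment> \<open>Letters differ only where the levels differ or one of the points is in
          \<open>D\<close>; each of the three sets takes up at most \<open>\<epsilon> / 4\<close> of
          the time.\<close>
        have "{i. i < n \<and> itinerary T P x i \<noteq> itinerary T P y i} \<subseteq> A \<union> (V x \<union> V y)"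
        proof (clarify, rule ccontr)
          fix i assume i: "i < n" "itinerary T P x i \<noteq> itinerary T P y i"
            and notin: "i \<notin> A" "i \<notin> V y" "i \<notin> V x"
          define L where "L = itinerary T P x i"
          have L: "L \<in> P" "(T ^^ i) x \<in> L"
            using itinerary_in[OF P sp(1)] itinerary_eq[OF P sp(1)] unfolding L_def by auto
          have "(T ^^ i) y \<in> L"
            using D'[rule_format, OF _ _ _ L] notin i(1) iter_space[OF sp(1), of i] iter_space[OF sp(2), of i]
            by (auto simp: A_def V_def)
          then have "itinerary T P y i = L" using itinerary_eq[OF P sp(2) L(1)] by simp
          then show False using i(2) by (simp add: L_def)
        qed
        then have "card {i. i < n \<and> itinerary T P x i \<noteq> itinerary T P y i} \<le> card (A \<union> (V x \<union> V y))"
          by (intro card_mono) (auto simp: A_def V_def)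
        also have "\<dots> \<le> card A + (card (V x) + card (V y))"
          by (meson add_left_mono card_Un_le order_trans)
        finally have "real (card {i. i < n \<and> itinerary T P x i \<noteq> itinerary T P y i}) \<le>
            card A + (card (V x) + card (V y))" by linarith
        also have "\<dots> < \<epsilon> * n" using cA cV pos by (simp add: field_simps)
        finally show "hamming_dist n (itinerary T P x) (itinerary T P y) < \<epsilon>"
          unfolding hamming_dist_def using n0 by (simp add: pos_divide_less_eq)
      qed
      then have "real (covering_number M T P n \<epsilon>) \<le> real (card J)" by simp
      also have "\<dots> = q k * (real (q (Suc k) div w) + 1)" by (simp add: J_def card_cartesian_product algebra_simps)
      also have "\<dots> \<le> q k * (q (Suc k) / w + q (Suc k) / g k)"
        using g_le_q_Suc[of k] gq
        by (intro mult_left_mono add_mono) (auto simp: of_nat_div_le_of_nat)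
      also have "\<dots> \<le> q k * (2 / \<delta> * (q (Suc k) / g k) + q (Suc k) / g k)"
      proof (intro mult_left_mono add_right_mono)
        have "q (Suc k) * (\<delta> * g k) \<le> q (Suc k) * (2 * real w)"
          using w_ge by (intro mult_left_mono) auto
        then show "q (Suc k) / real w \<le> 2 / \<delta> * (q (Suc k) / g k)"
          using w0 \<delta>(1) gq by (simp add: field_simps)
      qed simp
      also have "\<dots> = C * (real (q k) * real (q (Suc k)) / g k)"
      proof -
        have "a * (d * (z / h) + z / h) = (d + 1) * (a * z / h)" for a d z h :: real
          by (simp add: algebra_simps add_divide_distrib)
        then show ?thesis unfolding C_def .
      qed
      finally show "real (covering_number M T P n \<epsilon>) \<le> C * (real (q k) * real (q (Suc k)) / g k)" .
    qed
  qed
  with \<kappa> C show ?thesis by (intro exI[of _ \<kappa>] exI[of _ C] conjI)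
qed

subsection \<open>Lower bound for the covering numbers\<close>

lemma itinerary_levels:
  assumes "x \<in> space M"
  shows "itinerary T (levels 0) x i = level 0 (p 0 ((T ^^ i) x))"
  using iter_space[OF assms, of i] p_less[of "(T ^^ i) x" 0]
  by (subst itinerary_eq[OF levels_partition assms]) auto

lemma itinerary_levels_eq_iff:
  assumes "x \<in> space M" "y \<in> space M"
  shows "itinerary T (levels 0) x i = itinerary T (levels 0) y i \<longleftrightarrow>
    p 0 ((T ^^ i) x) = p 0 ((T ^^ i) y)"
  unfolding itinerary_levels[OF assms(1)] itinerary_levels[OF assms(2)]
  using iter_space[OF assms(1), of i] iter_space[OF assms(2), of i] p_less
  by (intro inj_on_eq_iff[OF level_inj]) auto

lemma p_0_flip:
  assumes "x \<in> space M" "x \<notin> escape (Suc k) n" "y \<in> space M" "y \<notin> escape (Suc k) n" "i \<le> n"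
    and "proj k (p (Suc k) y + i) = (proj k (p (Suc k) x + i) + 2 ^ k * Q k) mod q k"
  shows "p 0 ((T ^^ i) x) \<noteq> p 0 ((T ^^ i) y)"
proof -
  have x: "p 0 ((T ^^ i) x) = base k (proj k (p (Suc k) x + i))"
    by (simp only: p_base[OF iter_space[OF assms(1)], of i k] p_iter_proj[OF assms(1,2,5)])
  have y: "p 0 ((T ^^ i) y) = base k (proj k (p (Suc k) y + i))"
    by (simp only: p_base[OF iter_space[OF assms(3)], of i k] p_iter_proj[OF assms(3,4,5)])
  show ?thesis
    unfolding x y assms(6) using base_flip[OF proj_less, of k "p (Suc k) x + i"] by presburger
qed

lemma measure_le_card_p:
  assumes "S \<subseteq> space M"
  shows "measure M S \<le> card (p k ` S) / q k"
proof -
  have sub: "p k ` S \<subseteq> {..<q k}" using p_less assms by auto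
  have "{x \<in> space M. p k x \<in> p k ` S} \<in> sets M"
    using measurable_sets[OF p_meas, of "p k ` S" k] by (simp add: vimage_def Int_def conj_commute)
  then have "measure M S \<le> measure M {x \<in> space M. p k x \<in> p k ` S}"
    using assms by (intro finite_measure_mono) auto
  then show ?thesis using measure_levels[OF sub] by simp
qed

lemma measure_window_end:
  assumes "n \<le> Q k"
  shows "{x \<in> space M. Q k \<le> p k x mod Q k + n} \<in> sets M"
    "measure M {x \<in> space M. Q k \<le> p k x mod Q k + n} \<le> n / Q k"
proof -
  let ?S = "{x \<in> space M. Q k \<le> p k x mod Q k + n}"
  show "?S \<in> sets M"
    using measurable_sets[OF p_meas, of "{t. Q k \<le> t mod Q k + n}" k]
    by (simp add: vimage_def Int_def conj_commute)
  have inj: "inj_on (\<lambda>t. (t div Q k, t mod Q k)) A" for A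
  proof (rule inj_onI)
    fix s t assume "(s div Q k, s mod Q k) = (t div Q k, t mod Q k)"
    then have "s div Q k * Q k + s mod Q k = t div Q k * Q k + t mod Q k" by simp
    then show "s = t" by (simp only: div_mult_mod_eq)
  qed
  have "card (p k ` ?S) \<le> card ({..<2 ^ Suc k} \<times> {Q k - n..<Q k} :: (nat \<times> nat) set)"
  proof (rule card_inj_on_le[OF inj])
    show "(\<lambda>t. (t div Q k, t mod Q k)) ` p k ` ?S \<subseteq> {..<2 ^ Suc k} \<times> {Q k - n..<Q k}"
    proof (rule image_subsetI)
      fix t assume "t \<in> p k ` ?S"
      then obtain x where x: "x \<in> space M" "Q k \<le> t mod Q k + n" "t = p k x" by auto
      have "t div Q k < 2 ^ Suc k"
        using p_less[OF x(1), of k] Q_pos[of k] x(3) by (simp add: div_less_iff_less_mult q_def)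
      then show "(t div Q k, t mod Q k) \<in> {..<2 ^ Suc k} \<times> {Q k - n..<Q k}"
        using x(2) Q_pos[of k] by simp
    qed
  qed auto
  also have "\<dots> = 2 ^ Suc k * n" using assms by (simp add: card_cartesian_product)
  finally have "real (card (p k ` ?S)) \<le> real (2 ^ Suc k * n)" by (rule of_nat_mono)
  then have "card (p k ` ?S) / q k \<le> real (2 ^ Suc k * n) / q k" by (intro divide_right_mono) auto
  also have "\<dots> = n / Q k" by (simp add: q_def)
  finally show "measure M ?S \<le> n / Q k"
    using measure_le_card_p[of ?S k] by auto
qed

text \<open>A window of length \<open>2 * R * g k\<close> contains a complete codeword wherever it
  starts. Good points with equal \<open>code\<close> and different addresses read different
  codewords and have names at distance at least \<open>1/16\<close>, so a ball of radius at most
  \<open>1/32\<close> holds at most one address per value of \<open>code\<close>. Its good part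
  therefore has measure at most \<open>1 / N\<close>.\<close>

lemma covering_number_lower:
  fixes C :: "nat \<Rightarrow> nat set" and \<epsilon> :: real
  assumes b: "b k = N * R" "0 < N" "0 < R"
    and c: "\<And>\<beta>. \<beta> < b k \<Longrightarrow> c k \<beta> \<longleftrightarrow> \<beta> mod R \<in> C (\<beta> div R)"
    and C: "\<And>i. i < N \<Longrightarrow> C i \<subseteq> {..<R}"
      "\<And>i j. i < N \<Longrightarrow> j < N \<Longrightarrow> i \<noteq> j \<Longrightarrow> R \<le> 8 * card (sym_diff (C i) (C j))"
    and \<epsilon>: "0 < \<epsilon>" "\<epsilon> \<le> 1 / 32"
    and small: "2 * R * g k / g (Suc k) \<le> \<epsilon> / 2" "2 / N \<le> \<epsilon> / 2"
  shows "N * (1 - 2 * \<epsilon>) \<le> covering_number M T (levels 0) (2 * R * g k) \<epsilon>"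
proof -
  define n where "n = 2 * R * g k"
  have gk: "0 < g k" by (rule g_pos)
  have n0: "0 < n" using b gk by (simp add: n_def)
  have Q: "Q (Suc k) = N * R * g k" by (simp add: Q_Suc_g b)
  have N2: "2 \<le> N"
  proof (rule ccontr)
    assume "\<not> 2 \<le> N"
    then have "N = 1" using b by simp
    then show False using small(2) \<epsilon>(2) by simp
  qed
  then have nQ: "n \<le> Q (Suc k)" unfolding n_def Q by simp
  \<comment> \<open>Points whose window runs past the last codeword, where the vertical position
    \<open>t div Q (Suc k)\<close> changes.\<close>
  define B where "B = {x \<in> space M. Q (Suc k) \<le> p (Suc k) x mod Q (Suc k) + n}"
  have B: "B \<in> sets M" unfolding B_def by (rule measure_window_end[OF nQ])
  have "measure M B \<le> n / Q (Suc k)" unfolding B_def by (rule measure_window_end[OF nQ])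
  also have "\<dots> = 2 / N" using b gk by (simp add: n_def Q field_simps)
  finally have mB: "measure M B \<le> \<epsilon> / 2" using small by simp
  have "measure M (escape (Suc k) n) \<le> n / g (Suc k)" by (rule measure_escape)
  then have mE: "measure M (escape (Suc k) n) \<le> \<epsilon> / 2" using small(1) by (simp add: n_def)
  have bad: "measure M (B \<union> escape (Suc k) n) \<le> \<epsilon>"
    using measure_Un_le[OF B escape_meas, of "Suc k" n] mB mE by simp
  define G where "G = space M - (B \<union> escape (Suc k) n)"
  have G: "G \<in> sets M" unfolding G_def using B by auto
  define a where "a t = t mod Q (Suc k) div g k" for t
  \<comment> \<open>All of the address except the index of the codeword: the offset in the block,
    the block within the codeword and the vertical position.\<close>
  define code where "code t = (t mod g k, a t mod R, t div Q (Suc k))" for t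
  have gdvd: "g k dvd Q (Suc k)" by (simp add: Q)
  have decomp: "t mod Q (Suc k) = (a t div R * R + a t mod R) * g k + t mod g k" for t
  proof -
    have "t mod g k = t mod Q (Suc k) mod g k" using gdvd by (simp add: mod_mod_cancel)
    then show ?thesis unfolding a_def by (simp only: div_mult_mod_eq)
  qed
  \<comment> \<open>the aligned windows of \<open>x\<close> and \<open>y\<close> contain the whole codewords \<open>i + 1\<close> and \<open>j + 1\<close> at the same times\<close>
  have far: "hamming_dist n (itinerary T (levels 0) x) (itinerary T (levels 0) y) \<ge> 1 / 16"
    if x: "x \<in> G" and y: "y \<in> G" and eq: "code (p (Suc k) x) = code (p (Suc k) y)"
      and ne: "p (Suc k) x \<noteq> p (Suc k) y" for x y
  proof -
    have sp: "x \<in> space M" "y \<in> space M" "x \<notin> escape (Suc k) n" "y \<notin> escape (Suc k) n"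
      using x y by (auto simp: G_def)
    define s where "s = p (Suc k) x"
    define t where "t = p (Suc k) y"
    define i where "i = a s div R"
    define j where "j = a t div R"
    define r where "r = a s mod R"
    define z where "z = s mod g k"
    have eqs: "a t mod R = r" "t mod g k = z"
      using eq by (simp_all add: code_def r_def z_def s_def t_def)
    have st: "s mod Q (Suc k) = (i * R + r) * g k + z" "t mod Q (Suc k) = (j * R + r) * g k + z"
      using decomp[of s] decomp[of t] unfolding eqs i_def j_def r_def z_def .
    have dv: "s div Q (Suc k) = t div Q (Suc k)" using eq by (simp add: code_def s_def t_def)
    have ends: "s mod Q (Suc k) + n < Q (Suc k)" "t mod Q (Suc k) + n < Q (Suc k)"
      using x y by (auto simp: G_def B_def s_def t_def)
    have r: "r < R" using b by (simp add: r_def)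
    have z: "z < g k" using gk by (simp add: z_def)
    have ij: "i \<noteq> j"
    proof
      assume "i = j"
      then have "s mod Q (Suc k) = t mod Q (Suc k)" using st by simp
      then have "s div Q (Suc k) * Q (Suc k) + s mod Q (Suc k) = t div Q (Suc k) * Q (Suc k) + t mod Q (Suc k)"
        using dv by simp
      then have "s = t" by (simp only: div_mult_mod_eq)
      then show False using ne by (simp add: s_def t_def)
    qed
    \<comment> \<open>The time until offset \<open>v\<close> of block \<open>u\<close> in the next
      codeword; it is common to both orbits because \<open>r\<close> and \<open>z\<close> are. The
      subtraction of \<open>z\<close> is not truncated, since \<open>z < g k\<close> and
      \<open>r < R\<close>.\<close>
    define f where "f = (\<lambda>(u, v). (R - r + u) * g k + v - z)"
    have f_z: "f (u, v) + z = (R - r + u) * g k + v" for u v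
    proof -
      have "z \<le> 1 * g k" using z by simp
      also have "\<dots> \<le> (R - r + u) * g k" using r by (intro mult_right_mono) auto
      finally show ?thesis by (simp add: f_def)
    qed
    have lt: "f (u, v) < n" if "u < R" "v < g k" for u v
    proof -
      have "(R - r + u) * g k + v < (R - r + u) * g k + g k" using that by simp
      also have "\<dots> = (R - r + u + 1) * g k" by (simp add: algebra_simps)
      also have "\<dots> \<le> (2 * R) * g k" using that r by (intro mult_right_mono) auto
      finally show ?thesis using f_z[of u v] by (simp add: n_def)
    qed
    have pos: "s' mod Q (Suc k) + f (u, v) = ((Suc i') * R + u) * g k + v"
      if "s' mod Q (Suc k) = (i' * R + r) * g k + z" for s' i' u v
    proof -
      have "s' mod Q (Suc k) + f (u, v) = (i' * R + r) * g k + (R - r + u) * g k + v"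
        using that f_z[of u v] by simp
      also have "\<dots> = (i' * R + r + (R - r + u)) * g k + v" by (simp add: algebra_simps)
      also have "i' * R + r + (R - r + u) = Suc i' * R + u" using r by simp
      finally show ?thesis .
    qed
    have block: "(s' + f (u, v)) div Q (Suc k) = s' div Q (Suc k)"
      "(s' + f (u, v)) mod g k = v"
      "Suc i' < N"
      "c k ((s' + f (u, v)) mod Q (Suc k) div g k) \<longleftrightarrow> u \<in> C (Suc i')"
      if s': "s' mod Q (Suc k) = (i' * R + r) * g k + z" "s' mod Q (Suc k) + n < Q (Suc k)"
        and uv: "u < R" "v < g k" for s' i' u v
    proof -
      have less: "s' mod Q (Suc k) + f (u, v) < Q (Suc k)" using s'(2) lt[OF uv] by simp
      have e: "s' + f (u, v) = s' div Q (Suc k) * Q (Suc k) + (s' mod Q (Suc k) + f (u, v))"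
        by (metis add.assoc div_mult_mod_eq)
      have gen: "(A * D + X) div D = A" "(A * D + X) mod D = X" if "X < D" for A D X :: nat
        using that by simp_all
      show "(s' + f (u, v)) div Q (Suc k) = s' div Q (Suc k)"
        using gen(1)[OF less, of "s' div Q (Suc k)"] by (simp only: e[symmetric])
      have md: "(s' + f (u, v)) mod Q (Suc k) = (Suc i' * R + u) * g k + v"
        using gen(2)[OF less, of "s' div Q (Suc k)"] unfolding e[symmetric]
        by (rule trans) (rule pos[OF s'(1)])
      have "(s' + f (u, v)) mod g k = (s' + f (u, v)) mod Q (Suc k) mod g k"
        using gdvd by (simp add: mod_mod_cancel)
      also have "\<dots> = v" unfolding md using uv by simp
      finally show "(s' + f (u, v)) mod g k = v" .
      have "(Suc i' * R + u) * g k + v < (N * R) * g k"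
        using less pos[OF s'(1), of u v] Q by linarith
      then have "(Suc i' * R + u) * g k < (N * R) * g k" by linarith
      then have lN: "Suc i' * R + u < N * R" using gk by (simp only: mult_less_cancel2)
      then have "Suc i' * R < N * R" by linarith
      then show "Suc i' < N" by (simp only: mult_less_cancel2)
      have dd: "(s' + f (u, v)) mod Q (Suc k) div g k = Suc i' * R + u"
        unfolding md using uv by simp
      show "c k ((s' + f (u, v)) mod Q (Suc k) div g k) \<longleftrightarrow> u \<in> C (Suc i')"
        unfolding dd by (simp only: c[of "Suc i' * R + u"] b(1) lN gen[OF uv(1), of "Suc i'"])
    qed
    have SN: "Suc i < N" "Suc j < N"
      using block(3)[OF st(1) ends(1) b(3) gk] block(3)[OF st(2) ends(2) b(3) gk] by auto
    define E where "E = sym_diff (C (Suc i)) (C (Suc j))"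
    have ER: "E \<subseteq> {..<R}" using C(1) SN by (auto simp: E_def)
    have "inj_on f (E \<times> {..<g k})"
    proof (rule inj_onI)
      fix w w' assume w: "w \<in> E \<times> {..<g k}" "w' \<in> E \<times> {..<g k}" and fe: "f w = f w'"
      obtain u v where uv: "w = (u, v)" by (cases w)
      obtain u' v' where uv': "w' = (u', v')" by (cases w')
      have "v < g k" "v' < g k" using w uv uv' by auto
      moreover have e: "(R - r + u) * g k + v = (R - r + u') * g k + v'"
        using f_z[of u v] f_z[of u' v'] fe uv uv' by simp
      ultimately have "v = v'" by (metis mod_mult_self3 mod_less)
      then have "(R - r + u) * g k = (R - r + u') * g k" using e by simp
      then show "w = w'" using gk \<open>v = v'\<close> uv uv' by simp
    qed
    moreover have "f ` (E \<times> {..<g k}) \<subseteq>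
        {i. i < n \<and> itinerary T (levels 0) x i \<noteq> itinerary T (levels 0) y i}"
    proof (rule image_subsetI)
      fix w assume "w \<in> E \<times> {..<g k}"
      then obtain u v where w: "w = (u, v)" and u: "u \<in> E" and v: "v \<in> {..<g k}" by blast
      then have uv: "u < R" "v < g k" using ER by auto
      note bs = block[OF st(1) ends(1) uv] and bt = block[OF st(2) ends(2) uv]
      have "c k ((s + f (u, v)) mod Q (Suc k) div g k) \<noteq> c k ((t + f (u, v)) mod Q (Suc k) div g k)"
        using u unfolding bs(4) bt(4) E_def by auto
      then have "proj k (t + f (u, v)) = (proj k (s + f (u, v)) + 2 ^ k * Q k) mod q k"
        using bs bt dv by (intro proj_flip) auto
      then have "p 0 ((T ^^ f (u, v)) x) \<noteq> p 0 ((T ^^ f (u, v)) y)"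
        using lt[OF uv] sp by (intro p_0_flip[of x k n y]) (auto simp: s_def t_def)
      then show "f w \<in> {i. i < n \<and> itinerary T (levels 0) x i \<noteq> itinerary T (levels 0) y i}"
        using lt[OF uv] itinerary_levels_eq_iff[OF sp(1,2)] w by simp
    qed
    ultimately have "card (E \<times> {..<g k}) \<le>
        card {i. i < n \<and> itinerary T (levels 0) x i \<noteq> itinerary T (levels 0) y i}"
      by (rule card_inj_on_le) simp
    then have "real (card E * g k) \<le> card {i. i < n \<and> itinerary T (levels 0) x i \<noteq> itinerary T (levels 0) y i}"
      by (simp add: card_cartesian_product del: of_nat_mult)
    \<comment> \<open>A factor 8 comes from the distance of the code, a factor 2 from the window
      being two codewords long.\<close>
    moreover have "real n \<le> 16 * real (card E * g k)"
    proof -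
      have "R \<le> 8 * card E" unfolding E_def using C(2)[of "Suc i" "Suc j"] SN ij by simp
      then have "R * g k \<le> 8 * card E * g k" by (rule mult_le_mono1)
      then have "n \<le> 16 * (card E * g k)" by (simp add: n_def)
      then show ?thesis by (metis of_nat_le_iff of_nat_mult of_nat_numeral)
    qed
    ultimately show ?thesis
      unfolding hamming_dist_def using n0 by (simp add: pos_le_divide_eq)
  qed
  have ball: "measure M (hamming_ball M T (levels 0) n \<epsilon> x0 \<inter> G) \<le> 1 / N" for x0
  proof -
    define V where "V = hamming_ball M T (levels 0) n \<epsilon> x0 \<inter> G"
    have "inj_on code (p (Suc k) ` V)"
    proof (rule inj_onI, clarify, rule ccontr)
      fix x y assume x: "x \<in> V" and y: "y \<in> V" and "code (p (Suc k) x) = code (p (Suc k) y)"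
        and "p (Suc k) x \<noteq> p (Suc k) y"
      then have "1 / 16 \<le> hamming_dist n (itinerary T (levels 0) x) (itinerary T (levels 0) y)"
        by (intro far) (auto simp: V_def)
      also have "\<dots> \<le> hamming_dist n (itinerary T (levels 0) x) (itinerary T (levels 0) x0) +
          hamming_dist n (itinerary T (levels 0) x0) (itinerary T (levels 0) y)"
        by (rule hamming_dist_triangle[OF levels_partition])
      also have "\<dots> < \<epsilon> + \<epsilon>"
        using x y by (intro add_strict_mono)
          (auto simp: V_def hamming_ball_def hamming_dist_commute[OF levels_partition, of n _ "itinerary T (levels 0) x0"])
      finally show False using \<epsilon> by simp
    qed
    moreover have "code ` p (Suc k) ` V \<subseteq> {..<g k} \<times> {..<R} \<times> {..<2 ^ Suc (Suc k)}"
    proof (rule image_subsetI)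
      fix t assume "t \<in> p (Suc k) ` V"
      then obtain x where t: "t = p (Suc k) x" and "x \<in> V" by blast
      then have "x \<in> space M" by (simp add: V_def hamming_ball_def)
      then have "p (Suc k) x div Q (Suc k) < 2 ^ Suc (Suc k)"
        using p_less[of x "Suc k"] Q_pos[of "Suc k"] by (simp add: div_less_iff_less_mult q_def)
      then show "code t \<in> {..<g k} \<times> {..<R} \<times> {..<2 ^ Suc (Suc k)}"
        using b gk by (simp add: code_def t)
    qed
    ultimately have "card (p (Suc k) ` V) \<le> card ({..<g k} \<times> {..<R} \<times> {..<2 ^ Suc (Suc k) :: nat})"
      by (rule card_inj_on_le) simp
    also have "\<dots> = g k * (R * 2 ^ Suc (Suc k))" by (simp add: card_cartesian_product)
    finally have "real (card (p (Suc k) ` V)) \<le> real (g k * (R * 2 ^ Suc (Suc k)))"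
      by (rule of_nat_mono)
    then have "card (p (Suc k) ` V) / q (Suc k) \<le> real (g k * (R * 2 ^ Suc (Suc k))) / q (Suc k)"
      by (intro divide_right_mono) auto
    also have "\<dots> = 1 / N"
      using b gk by (simp add: q_def Q divide_simps)
    finally show ?thesis
      using measure_le_card_p[of V "Suc k"] by (fastforce simp: V_def hamming_ball_def)
  qed
  obtain \<B> where \<B>: "\<B> \<subseteq> hamming_ball M T (levels 0) n \<epsilon> ` space M" "finite \<B>"
    "card \<B> = covering_number M T (levels 0) n \<epsilon>" "measure M (\<Union>\<B>) > 1 - \<epsilon>"
    using covering_number_witness[OF levels_partition \<epsilon>(1)] .
  have \<B>_sets: "V \<in> sets M" if "V \<in> \<B>" for V
    using that \<B>(1) hamming_ball_meas[OF levels_partition] by auto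
  have U: "(\<Union>V\<in>\<B>. V \<inter> G) \<in> sets M" using \<B>_sets \<B>(2) G by (intro sets.finite_UN) auto
  have "1 - \<epsilon> < measure M (\<Union>\<B>)" by fact
  also have "\<dots> \<le> measure M ((\<Union>V\<in>\<B>. V \<inter> G) \<union> (B \<union> escape (Suc k) n))"
  proof (rule finite_measure_mono)
    show "\<Union>\<B> \<subseteq> (\<Union>V\<in>\<B>. V \<inter> G) \<union> (B \<union> escape (Suc k) n)"
      using \<B>_sets sets.sets_into_space unfolding G_def by fast
    show "(\<Union>V\<in>\<B>. V \<inter> G) \<union> (B \<union> escape (Suc k) n) \<in> sets M" using U B by auto
  qed
  also have "\<dots> \<le> measure M (\<Union>V\<in>\<B>. V \<inter> G) + measure M (B \<union> escape (Suc k) n)"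
    using U B by (intro measure_Un_le) auto
  also have "measure M (\<Union>V\<in>\<B>. V \<inter> G) \<le> (\<Sum>V\<in>\<B>. measure M (V \<inter> G))"
    using \<B>(2) \<B>_sets G by (intro finite_measure_subadditive_finite) auto
  also have "\<dots> \<le> (\<Sum>V\<in>\<B>. 1 / N)"
    using \<B>(1) ball by (intro sum_mono) auto
  finally have "1 - \<epsilon> < card \<B> / N + \<epsilon>" using bad by simp
  then have "(1 - 2 * \<epsilon>) * N < card \<B>" using b by (simp add: field_simps)
  then show ?thesis using \<B>(3) by (simp add: n_def mult.commute)
qed

end

subsection \<open>Computation of the slow entropy\<close>

text \<open>With \<open>N = 2 ^ \<rho> k\<close>, \<open>g k\<close> is \<open>q k\<close> times
  about \<open>N powr (1 / v k)\<close>. Condition \<open>\<rho>_dominates\<close> bounds the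
  auxiliary factors of both entropy estimates by \<open>N powr (1 / Suc k)\<close>, and
  \<open>\<rho>_ge\<close> makes \<open>q k / g k\<close> and \<open>2 / N\<close> tend to
  0.\<close>

locale scaled_tower = tower_realization Q m b c M T p
  for Q m b :: "nat \<Rightarrow> nat" and c :: "nat \<Rightarrow> nat \<Rightarrow> bool"
    and M :: "'a measure" and T :: "'a \<Rightarrow> 'a" and p :: "nat \<Rightarrow> 'a \<Rightarrow> nat" +
  fixes \<rho> :: "nat \<Rightarrow> nat" and v :: "nat \<Rightarrow> real" and C :: "nat \<Rightarrow> nat \<Rightarrow> nat set"
  assumes v_pos: "0 < v k"
    and b_eq: "b k = 2 ^ \<rho> k * (8 * \<rho> k)"
    and m_eq: "m k = 2 ^ Suc k * nat \<lceil>2 powr (\<rho> k / v k)\<rceil>"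
    and c_iff: "c k \<beta> \<longleftrightarrow> \<beta> mod (8 * \<rho> k) \<in> C k (\<beta> div (8 * \<rho> k))"
    and C_sub: "i < 2 ^ \<rho> k \<Longrightarrow> C k i \<subseteq> {..<8 * \<rho> k}"
    and C_dist: "i < 2 ^ \<rho> k \<Longrightarrow> j < 2 ^ \<rho> k \<Longrightarrow> i \<noteq> j \<Longrightarrow> \<rho> k \<le> card (sym_diff (C k i) (C k j))"
    and \<rho>_dominates: "32 * real (\<rho> k) * q k * 2 ^ Suc k \<le> 2 powr (\<rho> k / Suc k)"
    and \<rho>_ge: "Suc k * v k \<le> \<rho> k" "Suc k \<le> \<rho> k"
begin

lemma ceiling_powr:
  "2 powr (\<rho> k / v k) \<le> nat \<lceil>2 powr (\<rho> k / v k)\<rceil>"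
  "nat \<lceil>2 powr (\<rho> k / v k)\<rceil> \<le> 2 * 2 powr (\<rho> k / v k)"
proof -
  have "1 \<le> 2 powr (\<rho> k / v k)"
    using v_pos[of k] by (intro ge_one_powr_ge_zero) auto
  then show "2 powr (\<rho> k / v k) \<le> nat \<lceil>2 powr (\<rho> k / v k)\<rceil>"
    "nat \<lceil>2 powr (\<rho> k / v k)\<rceil> \<le> 2 * 2 powr (\<rho> k / v k)"
    by linarith+
qed

lemma g_eq: "g k = q k * nat \<lceil>2 powr (\<rho> k / v k)\<rceil>"
  by (simp add: g_def q_def m_eq)

lemma q_over_g: "(\<lambda>k. q k / g k) \<longlonglongrightarrow> 0"
proof (rule tendsto_sandwich[OF _ _ tendsto_const])
  show "\<forall>\<^sub>F k in sequentially. 0 \<le> q k / g k" by simp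
  show "\<forall>\<^sub>F k in sequentially. q k / g k \<le> (1 / 2) ^ k"
  proof (intro always_eventually allI)
    fix k
    have "real k \<le> Suc k" by simp
    also have "\<dots> \<le> \<rho> k / v k" using \<rho>_ge(1)[of k] v_pos[of k] by (simp add: pos_le_divide_eq)
    finally have "2 powr real k \<le> 2 powr (\<rho> k / v k)" by simp
    then have le: "2 ^ k \<le> real (nat \<lceil>2 powr (\<rho> k / v k)\<rceil>)"
      using ceiling_powr(1)[of k] powr_realpow[of 2 k] by linarith
    have "q k / g k = 1 / nat \<lceil>2 powr (\<rho> k / v k)\<rceil>"
      using q_pos[of k] by (simp add: g_eq)
    also have "\<dots> \<le> 1 / 2 ^ k" using le by (intro divide_left_mono) auto
    finally show "q k / g k \<le> (1 / 2) ^ k" by (simp add: power_one_over)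
  qed
  show "(\<lambda>k. (1 / 2 :: real) ^ k) \<longlonglongrightarrow> 0" by (simp add: LIMSEQ_realpow_zero)
qed

lemma g_ge: "2 ^ k \<le> g k" "2 powr (\<rho> k / v k) \<le> g k"
proof -
  have q1: "2 ^ k \<le> q k" using Q_pos[of k] 
  proof -
    have "2 ^ k * 1 \<le> 2 ^ Suc k * Q k" using Q_pos[of k] by (intro mult_le_mono) auto
    then show ?thesis by (simp add: q_def)
  qed
  have "1 \<le> nat \<lceil>2 powr (\<rho> k / v k)\<rceil>"
    using powr_gt_zero[of 2 "\<rho> k / v k"] by linarith
  then have "q k * 1 \<le> g k" unfolding g_eq by (intro mult_le_mono2)
  then show "2 ^ k \<le> g k" using q1 by linarith
  have "1 * real (nat \<lceil>2 powr (\<rho> k / v k)\<rceil>) \<le> q k * real (nat \<lceil>2 powr (\<rho> k / v k)\<rceil>)"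
    using q_pos[of k] by (intro mult_right_mono of_nat_0_le_iff) simp
  then show "2 powr (\<rho> k / v k) \<le> g k"
    using ceiling_powr(1)[of k] unfolding g_eq of_nat_mult by linarith
qed

lemma g_tendsto: "filterlim g at_top sequentially"
proof (rule filterlim_at_top_mono)
  show "filterlim (\<lambda>k::nat. k) at_top sequentially" by (simp add: filterlim_ident)
  show "\<forall>\<^sub>F k in sequentially. k \<le> g k"
    using g_ge(1) less_exp by (intro always_eventually allI) (metis less_imp_le order_trans)
qed

text \<open>Lets the bounds on separate ranges cover all large \<open>n\<close>: the first
  \<open>l\<close> from \<open>k0\<close> on with \<open>x \<le> \<kappa> * g l\<close> has a
  suitable predecessor, unless \<open>l = k0\<close>, and then \<open>x\<close> is exactly
  \<open>\<kappa> * g k0\<close>.\<close>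

lemma g_bracket:
  fixes \<kappa> x :: real
  assumes "0 < \<kappa>" "\<kappa> * g k0 \<le> x"
  obtains k where "k0 \<le> k" "\<kappa> * g k \<le> x" "x \<le> \<kappa> * g (Suc k)"
proof -
  have "\<forall>\<^sub>F k in sequentially. nat \<lceil>x / \<kappa>\<rceil> \<le> g k"
    using g_tendsto unfolding filterlim_at_top by blast
  then obtain j where "\<forall>k\<ge>j. nat \<lceil>x / \<kappa>\<rceil> \<le> g k" unfolding eventually_sequentially ..
  then have "nat \<lceil>x / \<kappa>\<rceil> \<le> g (max j k0)" by simp
  then have "x / \<kappa> \<le> g (max j k0)" by linarith
  then have ex: "k0 \<le> max j k0 \<and> x \<le> \<kappa> * g (max j k0)"
    using assms by (simp add: field_simps)
  define l where "l = (LEAST l. k0 \<le> l \<and> x \<le> \<kappa> * g l)"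
  have l: "k0 \<le> l" "x \<le> \<kappa> * g l" using LeastI[of "\<lambda>l. k0 \<le> l \<and> x \<le> \<kappa> * g l", OF ex] by (auto simp: l_def)
  show ?thesis
  proof (cases "l = k0")
    case True
    have "g k0 \<le> g (Suc k0)"
      using g_le_q_Suc[of k0] g_eq[of "Suc k0"] ceiling_powr(1)[of "Suc k0"]
      by (metis One_nat_def Suc_leI g_pos le_trans mult.right_neutral mult_le_mono2 mult_0_right neq0_conv not_less0)
    then have "\<kappa> * g k0 \<le> \<kappa> * g (Suc k0)" using assms by simp
    then show ?thesis using assms l True by (intro that[of k0]) auto
  next
    case False
    then obtain k where k: "l = Suc k" "k0 \<le> k" using l(1) by (cases l) auto
    then have "\<not> (k0 \<le> k \<and> x \<le> \<kappa> * g k)" unfolding l_def[symmetric] using not_less_Least[of k "\<lambda>l. k0 \<le> l \<and> x \<le> \<kappa> * g l"] l_def by simp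
    then show ?thesis using that[of k] k l by simp
  qed
qed

text \<open>With \<open>N = 2 ^ \<rho> k\<close>, the upper bound is of order
  \<open>N powr (1 + 1 / Suc k)\<close>. By the assumption on \<open>t\<close> this is at most
  \<open>(N powr (1 / v k)) powr t\<close>, and
  \<open>N powr (1 / v k) \<le> g k \<le> n / \<kappa>\<close>. Only the lower end of the range of
  \<open>n\<close> enters, so the gap between \<open>g k\<close> and \<open>g (Suc k)\<close> does
  no harm.\<close>

lemma covering_number_poly:
  assumes t: "\<forall>\<^sub>F k in sequentially. (1 + 1 / Suc k) * v k \<le> t" and t0: "0 < t"
    and P: "finite_measurable_partition M P" and \<epsilon>: "0 < \<epsilon>"
  shows "\<exists>K. \<forall>\<^sub>F n in sequentially. real (covering_number M T P n \<epsilon>) \<le> K * n powr t"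
proof -
  obtain \<kappa> D :: real where \<kappa>: "0 < \<kappa>" and D: "0 < D" and
    ev: "\<forall>\<^sub>F k in sequentially. \<forall>n. \<kappa> * g k \<le> real n \<longrightarrow> real n \<le> \<kappa> * g (Suc k) \<longrightarrow>
      real (covering_number M T P n \<epsilon>) \<le> D * (real (q k) * real (q (Suc k)) / g k)"
    using covering_number_upper[OF q_over_g P \<epsilon>] by (elim exE conjE) (rule that)
  have "\<forall>\<^sub>F k in sequentially. \<forall>n. \<kappa> * g k \<le> real n \<longrightarrow> real n \<le> \<kappa> * g (Suc k) \<longrightarrow>
      real (covering_number M T P n \<epsilon>) \<le> D * (1 / \<kappa>) powr t * n powr t"
    using ev t
  proof eventually_elim
    case (elim k)
    show ?case
    proof (intro allI impI)
      fix n :: nat assume n: "\<kappa> * g k \<le> real n" "real n \<le> \<kappa> * g (Suc k)"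
      have "real (q k) * real (q (Suc k)) / g k = (32 * real (\<rho> k) * q k * 2 ^ Suc k) / 2 * 2 ^ \<rho> k"
        using g_pos[of k] by (simp add: q_Suc_g b_eq)
      also have "\<dots> \<le> (32 * real (\<rho> k) * q k * 2 ^ Suc k) * 2 ^ \<rho> k"
        by (intro mult_right_mono) auto
      also have "\<dots> \<le> 2 powr (\<rho> k / Suc k) * 2 ^ \<rho> k"
        by (intro mult_right_mono \<rho>_dominates) auto
      also have "\<dots> = 2 powr (\<rho> k * (1 + 1 / Suc k))"
        by (simp add: powr_add[symmetric] powr_realpow[symmetric] distrib_left add.commute)
      also have "\<dots> \<le> 2 powr (\<rho> k / v k * t)"
      proof -
        have "1 + 1 / Suc k \<le> t / v k" using elim(2) v_pos[of k] by (simp only: pos_le_divide_eq)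
        then have "\<rho> k * (1 + 1 / Suc k) \<le> \<rho> k * (t / v k)" by (intro mult_left_mono) auto
        then show ?thesis by simp
      qed
      also have "\<dots> = (2 powr (\<rho> k / v k)) powr t" by (simp add: powr_powr)
      also have "\<dots> \<le> (n / \<kappa>) powr t"
      proof (rule powr_mono2)
        have "real (g k) \<le> n / \<kappa>" using n(1) \<kappa> by (simp add: field_simps)
        then show "2 powr (\<rho> k / v k) \<le> n / \<kappa>" using g_ge(2)[of k] by linarith
      qed (use t0 in auto)
      also have "\<dots> = (1 / \<kappa>) powr t * n powr t"
        using \<kappa> by (simp add: powr_mult[symmetric])
      finally have "D * (real (q k) * real (q (Suc k)) / g k) \<le> D * ((1 / \<kappa>) powr t * n powr t)"
        using D by (intro mult_left_mono) auto
      then show "real (covering_number M T P n \<epsilon>) \<le> D * (1 / \<kappa>) powr t * n powr t"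
        using elim(1) n by (fastforce simp: mult.assoc)
    qed
  qed
  then obtain k0 where "\<forall>k\<ge>k0. \<forall>n. \<kappa> * g k \<le> real n \<longrightarrow> real n \<le> \<kappa> * g (Suc k) \<longrightarrow>
      real (covering_number M T P n \<epsilon>) \<le> D * (1 / \<kappa>) powr t * n powr t"
    unfolding eventually_sequentially by (rule exE)
  then have k0: "\<And>k n. k0 \<le> k \<Longrightarrow> \<kappa> * g k \<le> real n \<Longrightarrow> real n \<le> \<kappa> * g (Suc k) \<Longrightarrow>
      real (covering_number M T P n \<epsilon>) \<le> D * (1 / \<kappa>) powr t * n powr t"
    by simp
  have "\<forall>\<^sub>F n in sequentially. \<kappa> * g k0 \<le> real n"
    using filterlim_real_sequentially by (simp add: filterlim_at_top)
  then have "\<forall>\<^sub>F n in sequentially. real (covering_number M T P n \<epsilon>) \<le> D * (1 / \<kappa>) powr t * n powr t"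
  proof (rule eventually_mono)
    fix n :: nat assume "\<kappa> * g k0 \<le> real n"
    then obtain k where "k0 \<le> k" "\<kappa> * g k \<le> real n" "real n \<le> \<kappa> * g (Suc k)"
      using g_bracket[OF \<kappa>] by blast
    then show "real (covering_number M T P n \<epsilon>) \<le> D * (1 / \<kappa>) powr t * n powr t" by (rule k0)
  qed
  then show ?thesis by (rule exI)
qed

lemma growth_params_upper:
  assumes t: "\<forall>\<^sub>F k in sequentially. (1 + 1 / Suc k) * v k \<le> t" and t0: "0 < t" "t < s"
    and P: "finite_measurable_partition M P" and \<epsilon>: "0 < \<epsilon>"
  shows "s \<notin> growth_params (\<lambda>n t. real n powr t) M T \<epsilon> P"
proof -
  let ?f = "\<lambda>n. real (covering_number M T P n \<epsilon>) / real n powr s"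
  obtain K where K: "\<forall>\<^sub>F n in sequentially. real (covering_number M T P n \<epsilon>) \<le> K * n powr t"
    using covering_number_poly[OF t t0(1) P \<epsilon>] by (rule exE)
  have lim: "(\<lambda>n. K * real n powr (t - s)) \<longlonglongrightarrow> 0"
    using t0 by (intro tendsto_mult_right_zero tendsto_neg_powr filterlim_real_sequentially) simp
  have "?f \<longlonglongrightarrow> 0"
  proof (rule tendsto_sandwich[OF _ _ tendsto_const lim])
    show "\<forall>\<^sub>F n in sequentially. 0 \<le> ?f n" by simp
    show "\<forall>\<^sub>F n in sequentially. ?f n \<le> K * real n powr (t - s)"
      using K eventually_gt_at_top[of 0]
    proof eventually_elim
      case (elim n)
      then have "?f n \<le> K * n powr t / n powr s" by (intro divide_right_mono) auto
      then show ?case by (simp add: powr_diff)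
    qed
  qed
  then have "(\<lambda>n. ereal (?f n)) \<longlonglongrightarrow> ereal 0" by (intro tendsto_intros)
  then have "limsup (\<lambda>n. ereal (?f n)) = ereal 0"
    by (rule lim_imp_Limsup[OF trivial_limit_sequentially])
  then show ?thesis by (simp add: growth_params_def)
qed

text \<open>The upper limit only needs the times \<open>n k\<close>. There at least
  \<open>2 ^ \<rho> k / 2\<close> balls are required, while \<open>n k\<close> is at most
  \<open>2 ^ \<rho> k\<close> to the power \<open>1 / v k + 1 / Suc k\<close>.\<close>

lemma growth_params_lower:
  assumes t: "\<forall>\<^sub>F k in sequentially. t * (1 / v k + 1 / Suc k) \<le> 1" and t0: "0 < t"
  shows "t \<in> growth_params (\<lambda>n t. real n powr t) M T (1 / 32) (levels 0)"
proof -
  let ?f = "\<lambda>n. real (covering_number M T (levels 0) n (1 / 32)) / real n powr t"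
  define n where "n k = 2 * (8 * \<rho> k) * g k" for k
  have n_tendsto: "filterlim n at_top sequentially"
  proof (rule filterlim_at_top_mono[OF g_tendsto])
    have "g k \<le> n k" for k using \<rho>_ge(2)[of k] by (simp add: n_def)
    then show "\<forall>\<^sub>F k in sequentially. g k \<le> n k" by simp
  qed
  have lim: "(\<lambda>k. 2 * (1 / 2 :: real) ^ k) \<longlonglongrightarrow> 0"
    by (intro tendsto_mult_right_zero LIMSEQ_realpow_zero) auto
  \<comment> \<open>\<open>1 / 64\<close> is \<open>\<epsilon> / 2\<close> for
    \<open>\<epsilon> = 1 / 32\<close>; both smallness conditions of
    \<open>covering_number_lower\<close> follow from
    \<open>2 / 2 ^ \<rho> k \<le> 1 / 64\<close>.\<close>
  have "\<forall>\<^sub>F k in sequentially. 2 * (1 / 2 :: real) ^ k < 1 / 64"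
    using lim by (rule order_tendstoD) simp
  then have "\<forall>\<^sub>F k in sequentially. ereal (1 / 2) \<le> ereal (?f (n k))"
    using t
  proof eventually_elim
    case (elim k)
    have \<rho>: "0 < \<rho> k" using \<rho>_ge(2)[of k] by linarith
    have "(2::real) ^ k \<le> 2 ^ \<rho> k" using \<rho>_ge(2)[of k] by (intro power_increasing) auto
    then have "2 / (2 ^ \<rho> k) \<le> 2 / (2 ^ k :: real)" by (intro divide_left_mono) auto
    also have "2 / (2 ^ k :: real) = 2 * (1 / 2) ^ k" by (simp add: power_one_over)
    finally have small: "2 / (2 ^ \<rho> k) \<le> (1 / 64 :: real)" using elim(1) by linarith
    have "real (2 ^ \<rho> k * (8 * \<rho> k) * g k) \<le> g (Suc k)"
    proof -
      have "1 * (b k * g k) \<le> m (Suc k) * (b k * g k)" using m_pos[of "Suc k"] by (intro mult_right_mono) auto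
      then have "b k * g k \<le> g (Suc k)" by (simp add: g_def[of "Suc k"] Q_Suc_g)
      then show ?thesis unfolding b_eq by (rule of_nat_mono)
    qed
    then have "2 * (8 * \<rho> k) * g k / g (Suc k) \<le> 2 * (8 * \<rho> k) * g k / real (2 ^ \<rho> k * (8 * \<rho> k) * g k)"
      using \<rho> g_pos[of k] g_pos[of "Suc k"] by (intro divide_left_mono) auto
    also have "\<dots> = 2 / 2 ^ \<rho> k" using \<rho> g_pos[of k] by (simp add: field_simps)
    finally have small': "2 * (8 * \<rho> k) * g k / g (Suc k) \<le> 2 / (2 ^ \<rho> k :: real)" .
    have "real (2 ^ \<rho> k) * (1 - 2 * (1 / 32)) \<le> covering_number M T (levels 0) (2 * (8 * \<rho> k) * g k) (1 / 32)"
    proof (rule covering_number_lower[where C = "C k"])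
      show "c k \<beta> \<longleftrightarrow> \<beta> mod (8 * \<rho> k) \<in> C k (\<beta> div (8 * \<rho> k))" for \<beta> by (rule c_iff)
      show "8 * \<rho> k \<le> 8 * card (sym_diff (C k i) (C k j))" if "i < 2 ^ \<rho> k" "j < 2 ^ \<rho> k" "i \<noteq> j" for i j
        using C_dist[OF that] by simp
      show "2 * (8 * \<rho> k) * g k / g (Suc k) \<le> 1 / 32 / 2"
        by (rule order_trans[OF small']) (use small in simp)
    qed (use \<rho> small b_eq C_sub in auto)
    then have S: "2 ^ \<rho> k / 2 \<le> real (covering_number M T (levels 0) (n k) (1 / 32))"
      by (simp add: n_def)
    have "real (n k) = 16 * \<rho> k * q k * nat \<lceil>2 powr (\<rho> k / v k)\<rceil>" by (simp add: n_def g_eq)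
    also have "\<dots> \<le> 16 * \<rho> k * q k * (2 * 2 powr (\<rho> k / v k))"
      using ceiling_powr(2)[of k] by (simp only: of_nat_mult of_nat_numeral) (intro mult_left_mono, auto)
    also have "\<dots> = 32 * real (\<rho> k) * q k * 1 * 2 powr (\<rho> k / v k)" by simp
    also have "\<dots> \<le> 32 * real (\<rho> k) * q k * 2 ^ Suc k * 2 powr (\<rho> k / v k)"
      using one_le_power[of "2::real" "Suc k"] by (intro mult_right_mono mult_left_mono) auto
    also have "\<dots> \<le> 2 powr (\<rho> k / Suc k) * 2 powr (\<rho> k / v k)"
      by (intro mult_right_mono \<rho>_dominates) auto
    also have "\<dots> = 2 powr (\<rho> k * (1 / v k + 1 / Suc k))"
      by (simp add: powr_add[symmetric] distrib_left add.commute)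
    finally have "n k powr t \<le> (2 powr (\<rho> k * (1 / v k + 1 / Suc k))) powr t"
      using t0 by (intro powr_mono2) auto
    also have "\<dots> = 2 powr (\<rho> k * (t * (1 / v k + 1 / Suc k)))" by (simp add: powr_powr ac_simps)
    also have "\<dots> \<le> 2 powr (\<rho> k * 1)"
      using mult_left_mono[OF elim(2), of "real (\<rho> k)"] by (intro powr_mono) simp_all
    finally have np: "n k powr t \<le> 2 ^ \<rho> k" by (simp add: powr_realpow)
    have n0: "0 < real (n k) powr t" using \<rho> g_pos[of k] by (simp add: n_def)
    have "1 / 2 * n k powr t \<le> real (covering_number M T (levels 0) (n k) (1 / 32))"
      using S np by simp
    then show ?case using n0 by (simp add: pos_le_divide_eq)
  qed
  then have ev: "\<forall>\<^sub>F k in sequentially. \<not> ereal (?f (n k)) < ereal (1 / 2)"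
    by (simp only: not_less)
  have "0 < limsup (\<lambda>n. ereal (?f n))"
  proof (rule ccontr)
    assume "\<not> 0 < limsup (\<lambda>n. ereal (?f n))"
    then have "limsup (\<lambda>n. ereal (?f n)) \<le> 0" by (simp only: not_less)
    also have "(0::ereal) < ereal (1 / 2)" by simp
    finally have "\<forall>\<^sub>F n in sequentially. ereal (?f n) < ereal (1 / 2)" by (rule Limsup_lessD)
    then have "\<forall>\<^sub>F k in sequentially. ereal (?f (n k)) < ereal (1 / 2)"
      using n_tendsto by (rule eventually_compose_filterlim)
    with ev have "\<forall>\<^sub>F k in sequentially. False" by eventually_elim (rule notE)
    then show False by simp
  qed
  then show ?thesis using t0 by (simp add: growth_params_def)
qed

text \<open>The two hypotheses express \<open>v k \<rightarrow> u\<close> with room for the errors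
  \<open>1 / Suc k\<close> in the exponents, in a form that also makes sense for
  \<open>u = 0\<close> and \<open>u = \<infinity>\<close>. The upper bound concerns every partition;
  for the lower one the two halves of the fibre suffice.\<close>

lemma upper_slow_entropy_eq:
  assumes upper: "\<And>t. 0 < t \<Longrightarrow> u < ennreal t \<Longrightarrow> \<forall>\<^sub>F k in sequentially. (1 + 1 / Suc k) * v k \<le> t"
    and lower: "\<And>t. 0 < t \<Longrightarrow> ennreal t < u \<Longrightarrow> \<forall>\<^sub>F k in sequentially. t * (1 / v k + 1 / Suc k) \<le> 1"
  shows "upper_slow_entropy (\<lambda>n t. real n powr t) M T = u"
proof (rule antisym)
  let ?a = "\<lambda>n t. real n powr t"
  have lim: "Lim (at_right 0) (\<lambda>\<epsilon>. growth_exponent ?a M T \<epsilon> P) = (SUP \<epsilon>\<in>{0<..}. growth_exponent ?a M T \<epsilon> P)"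
    if "finite_measurable_partition M P" for P
    by (rule Lim_growth_exponent[OF that]) simp
  show "upper_slow_entropy ?a M T \<le> u"
    unfolding upper_slow_entropy_def
  proof (rule SUP_least)
    fix P assume "P \<in> {P. finite_measurable_partition M P}"
    then have P: "finite_measurable_partition M P" by simp
    show "Lim (at_right 0) (\<lambda>\<epsilon>. growth_exponent ?a M T \<epsilon> P) \<le> u"
      unfolding lim[OF P]
    proof (rule SUP_least)
      fix \<epsilon> :: real assume "\<epsilon> \<in> {0<..}"
      then have \<epsilon>: "0 < \<epsilon>" by simp
      have "ennreal s \<le> u" if s: "s \<in> growth_params ?a M T \<epsilon> P" for s
      proof (rule ccontr)
        assume "\<not> ennreal s \<le> u"
        then have "u < ennreal s" by simp
        then obtain w where w: "u < w" "w < ennreal s" using dense by blast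
        then obtain t where t: "w = ennreal t" "0 \<le> t" by (cases w) auto
        have "0 < t" using w(1) t by (metis ennreal_0 less_le not_less_zero)
        moreover have "t < s" using w(2) t by (simp add: ennreal_less_iff)
        ultimately show False
          using growth_params_upper[OF upper[OF \<open>0 < t\<close>] _ _ P \<epsilon>, of s] w(1) t s by simp
      qed
      then show "growth_exponent ?a M T \<epsilon> P \<le> u"
        by (auto simp: growth_exponent_def intro: SUP_least)
    qed
  qed
  show "u \<le> upper_slow_entropy ?a M T"
  proof (rule dense_le)
    fix w assume w: "w < u"
    then obtain t where t: "w = ennreal t" "0 \<le> t" by (cases w) auto
    show "w \<le> upper_slow_entropy ?a M T"
    proof (cases "t = 0")
      case False
      then have t0: "0 < t" using t by simp
      have mem: "t \<in> growth_params ?a M T (1 / 32) (levels 0)"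
        using growth_params_lower[OF lower[OF t0]] w t t0 by simp
      have "w \<le> growth_exponent ?a M T (1 / 32) (levels 0)"
        unfolding t growth_exponent_def using mem by (auto intro: SUP_upper)
      also have "\<dots> \<le> (SUP \<epsilon>\<in>{0<..}. growth_exponent ?a M T \<epsilon> (levels 0))"
        by (rule SUP_upper) simp
      also have "\<dots> = Lim (at_right 0) (\<lambda>\<epsilon>. growth_exponent ?a M T \<epsilon> (levels 0))"
        by (rule lim[OF levels_partition, symmetric])
      also have "\<dots> \<le> upper_slow_entropy ?a M T"
        unfolding upper_slow_entropy_def by (rule SUP_upper) (simp add: levels_partition)
      finally show ?thesis .
    qed (simp add: t)
  qed
qed

end

subsection \<open>Piecewise translations and transport\<close>

lemma invertible_mptI:
  assumes bij: "bij_betw T (space M) (space M)"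
    and image: "\<And>A. A \<in> sets M \<Longrightarrow> T ` A \<in> sets M"
    and emeasure: "\<And>A. A \<in> sets M \<Longrightarrow> emeasure M (T ` A) = emeasure M A"
    and vimage: "\<And>A. A \<in> sets M \<Longrightarrow> T -` A \<inter> space M \<in> sets M"
  shows "invertible_mpt M T"
  unfolding invertible_mpt_def
proof (intro conjI ballI bij)
  have inj: "inj_on T (space M)" and im: "T ` space M = space M"
    using bij by (auto simp: bij_betw_def)
  show "T \<in> measurable M M"
    using im vimage by (intro measurableI) auto
  show "the_inv_into (space M) T \<in> measurable M M"
  proof (rule measurableI)
    fix x assume "x \<in> space M"
    then show "the_inv_into (space M) T x \<in> space M"
      using the_inv_into_into[OF inj, of x "space M"] im by simp
  next
    fix A assume A: "A \<in> sets M"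
    have sub: "A \<subseteq> space M" using A sets.sets_into_space by auto
    have "the_inv_into (space M) T -` A \<inter> space M = T ` A"
    proof (intro set_eqI iffI)
      fix y assume y: "y \<in> the_inv_into (space M) T -` A \<inter> space M"
      then have "T (the_inv_into (space M) T y) = y"
        using f_the_inv_into_f[OF inj, of y] im by simp
      then show "y \<in> T ` A" using y by (metis IntD1 imageI vimageE)
    next
      fix y assume "y \<in> T ` A"
      then obtain x where x: "y = T x" "x \<in> A" by auto
      then have "x \<in> space M" using sub by auto
      then show "y \<in> the_inv_into (space M) T -` A \<inter> space M"
        using x im the_inv_into_f_f[OF inj, of x] by auto
    qed
    then show "the_inv_into (space M) T -` A \<inter> space M \<in> sets M" using image[OF A] by simp
  qed
  fix A assume A: "A \<in> sets M"
  have sub: "A \<subseteq> T ` space M" using A sets.sets_into_space im by auto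
  have "T ` (T -` A \<inter> space M) = A" using sub by auto
  then show "emeasure M (T -` A \<inter> space M) = emeasure M A"
    using emeasure[OF vimage[OF A]] by simp
qed

lemma lebesgue_translation_image:
  fixes A :: "'a::euclidean_space set"
  assumes "A \<in> sets lebesgue"
  shows "(\<lambda>x. x + a) ` A \<in> sets lebesgue" "emeasure lebesgue ((\<lambda>x. x + a) ` A) = emeasure lebesgue A"
proof -
  have eq: "(\<lambda>x. x + a) ` A = (+) a ` A" by (auto simp: add.commute)
  show "(\<lambda>x. x + a) ` A \<in> sets lebesgue" unfolding eq using assms by (rule lebesgue_sets_translation)
  show "emeasure lebesgue ((\<lambda>x. x + a) ` A) = emeasure lebesgue A"
    using emeasure_lebesgue_affine[of 1 a A] by simp
qed

text \<open>Countable additivity over the pieces reduces the claim to translation invariance of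
  Lebesgue measure. Infinitely many pieces have to be allowed, because the odometer has one branch
  for each number of carried digits.\<close>

lemma invertible_mpt_piecewise_translation:
  fixes X :: "'a::euclidean_space set" and \<iota> :: "'a \<Rightarrow> 'i::countable"
  assumes X: "X \<in> sets lebesgue" and bij: "bij_betw T X X"
    and piece: "\<And>i. {x \<in> X. \<iota> x = i} \<in> sets lebesgue"
    and T: "\<And>x. x \<in> X \<Longrightarrow> T x = x + a (\<iota> x)"
  shows "invertible_mpt (lebesgue_on X) T"
proof -
  have inj: "inj_on T X" using bij by (simp add: bij_betw_def)
  have sets_X: "A \<in> sets (lebesgue_on X) \<longleftrightarrow> A \<in> sets lebesgue \<and> A \<subseteq> X" for A
    using X by (auto simp: sets_restrict_space_iff)
  define P where "P A i = A \<inter> {x \<in> X. \<iota> x = i}" for A i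
  have P: "P A i \<in> sets lebesgue" if "A \<in> sets lebesgue" for A i
    unfolding P_def using that piece by auto
  have TP: "T ` P A i = (\<lambda>x. x + a i) ` P A i" for A i
    using T by (intro image_cong) (auto simp: P_def)
  have A_eq: "A = (\<Union>i. P A i)" if "A \<subseteq> X" for A using that by (auto simp: P_def)
  have TA_eq: "T ` A = (\<Union>i. T ` P A i)" if "A \<subseteq> X" for A
    using that by (auto simp: P_def)
  have TP_sets: "T ` P A i \<in> sets lebesgue" if "A \<in> sets lebesgue" for A i
    unfolding TP by (rule lebesgue_translation_image[OF P[OF that]])
  have countable_UN: "(\<Union>i. B i) \<in> sets lebesgue" if "\<And>i. B i \<in> sets lebesgue" for B :: "'i \<Rightarrow> 'a set"
    using that by (intro sets.countable_UN'') auto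
  show ?thesis
  proof (rule invertible_mptI)
    show "bij_betw T (space (lebesgue_on X)) (space (lebesgue_on X))" using bij by simp
  next
    fix A assume "A \<in> sets (lebesgue_on X)"
    then have A: "A \<in> sets lebesgue" "A \<subseteq> X" by (simp_all add: sets_X)
    have TA: "T ` A \<in> sets lebesgue"
      unfolding TA_eq[OF A(2)] by (intro countable_UN TP_sets A(1))
    moreover have sub: "T ` A \<subseteq> X" using A(2) bij by (auto simp: bij_betw_def)
    ultimately show "T ` A \<in> sets (lebesgue_on X)" by (simp add: sets_X)
    have "emeasure lebesgue (T ` A) = (\<integral>\<^sup>+ i. emeasure lebesgue (T ` P A i) \<partial>count_space UNIV)"
      unfolding TA_eq[OF A(2)]
    proof (rule emeasure_UN_countable)
      show "disjoint_family (\<lambda>i. T ` P A i)"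
        using inj by (auto simp: disjoint_family_on_def P_def inj_on_def)
    qed (auto intro: TP_sets A(1))
    also have "\<dots> = (\<integral>\<^sup>+ i. emeasure lebesgue (P A i) \<partial>count_space UNIV)"
      unfolding TP using lebesgue_translation_image(2)[OF P[OF A(1)]] by (intro nn_integral_cong) auto
    also have "\<dots> = emeasure lebesgue (\<Union>i. P A i)"
    proof (rule emeasure_UN_countable[symmetric])
      show "disjoint_family (P A)" by (auto simp: disjoint_family_on_def P_def)
    qed (auto intro: P A(1))
    also have "\<dots> = emeasure lebesgue A" using A_eq[OF A(2)] by simp
    finally show "emeasure (lebesgue_on X) (T ` A) = emeasure (lebesgue_on X) A"
      using X A sub by (simp add: emeasure_restrict_space)
  next
    fix A assume "A \<in> sets (lebesgue_on X)"
    then have A: "A \<in> sets lebesgue" "A \<subseteq> X" by (simp_all add: sets_X)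
    have "T -` A \<inter> X = (\<Union>i. (\<lambda>x. x + - a i) ` A \<inter> {x \<in> X. \<iota> x = i})"
    proof (intro set_eqI iffI)
      fix x assume x: "x \<in> T -` A \<inter> X"
      then have "x + a (\<iota> x) \<in> A" using T[of x] by auto
      then have "x \<in> (\<lambda>y. y + - a (\<iota> x)) ` A" by (intro image_eqI[of _ _ "x + a (\<iota> x)"]) simp_all
      then show "x \<in> (\<Union>i. (\<lambda>x. x + - a i) ` A \<inter> {x \<in> X. \<iota> x = i})" using x by auto
    next
      fix x assume "x \<in> (\<Union>i. (\<lambda>x. x + - a i) ` A \<inter> {x \<in> X. \<iota> x = i})"
      then obtain y where y: "x = y - a (\<iota> x)" "y \<in> A" "x \<in> X" by auto
      have "x + a (\<iota> x) = y" using y(1) by (simp only: eq_diff_eq)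
      then show "x \<in> T -` A \<inter> X" using y T[of x] by simp
    qed
    moreover have "\<dots> \<in> sets lebesgue"
      by (intro countable_UN sets.Int lebesgue_translation_image(1)[OF A(1)] piece)
    ultimately have "T -` A \<inter> X \<in> sets lebesgue" by (simp only:)
    then show "T -` A \<inter> space (lebesgue_on X) \<in> sets (lebesgue_on X)" by (simp add: sets_X)
  qed
qed

text \<open>\<open>\<psi>\<close> is an isomorphism onto a set \<open>E\<close> of full measure. Off
  \<open>E\<close> the new map is the identity and the address is that of one fixed point, so the
  axioms demanded at every point hold there too.\<close>

lemma (in tower_realization) transport:
  fixes N :: "'b measure" and \<psi> :: "'a \<Rightarrow> 'b"
  assumes fin: "finite_measure N" and totalN: "measure N (space N) = 1"
    and inj: "inj_on \<psi> (space M)" and meas: "\<psi> \<in> measurable M N"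
    and image: "\<And>A. A \<in> sets M \<Longrightarrow> \<psi> ` A \<in> sets N"
    and emeasure_image: "\<And>A. A \<in> sets M \<Longrightarrow> emeasure N (\<psi> ` A) = emeasure M A"
  shows "\<exists>S p'. tower_realization Q m b c N S p'"
proof -
  interpret N: finite_measure N by fact
  define E where "E = \<psi> ` space M"
  define \<phi> where "\<phi> = the_inv_into (space M) \<psi>"
  have \<phi>: "\<phi> (\<psi> x) = x" if "x \<in> space M" for x
    unfolding \<phi>_def using inj that by (rule the_inv_into_f_f)
  have psi_space: "\<psi> x \<in> space N" if "x \<in> space M" for x using measurable_space[OF meas that] .
  have E: "E \<in> sets N" "E \<subseteq> space N" using image[OF sets.top] psi_space by (auto simp: E_def)
  have mimage: "measure N (\<psi> ` A) = measure M A" if "A \<in> sets M" for A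
    using emeasure_image[OF that] by (simp add: measure_def)
  have pre: "{x \<in> space M. \<psi> x \<in> D} \<in> sets M" if "D \<in> sets N" for D
    using measurable_sets[OF meas that] by (simp add: vimage_def Int_def conj_commute)
  have null: "measure N (space N - E) = 0"
    using mimage[OF sets.top] total totalN E by (simp add: N.finite_measure_compl E_def)
  have mN: "measure N D = measure M {x \<in> space M. \<psi> x \<in> D}" if D: "D \<in> sets N" for D
  proof -
    have "D \<subseteq> space N" using D sets.sets_into_space by auto
    then have "measure N (D - E) \<le> measure N (space N - E)"
      using E D by (intro N.finite_measure_mono) auto
    then have "measure N (D - E) = 0" using null measure_nonneg[of N "D - E"] by linarith
    moreover have "measure N D = measure N (D - E) + measure N (D \<inter> E)"
      using D E by (subst N.finite_measure_Union[symmetric]) (auto intro!: arg_cong[where f = "measure N"])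
    moreover have "D \<inter> E = \<psi> ` {x \<in> space M. \<psi> x \<in> D}" by (auto simp: E_def)
    ultimately show ?thesis using mimage[OF pre[OF D]] by simp
  qed
  obtain x0 where x0: "x0 \<in> space M" using total by (metis all_not_in_conv measure_empty zero_neq_one)
  define S where "S z = (if z \<in> E then \<psi> (T (\<phi> z)) else z)" for z
  define p' where "p' k z = (if z \<in> E then p k (\<phi> z) else p k x0)" for k z
  have S_psi: "S (\<psi> x) = \<psi> (T x)" if "x \<in> space M" for x
    using that \<phi> by (simp add: S_def E_def)
  have p_psi: "p' k (\<psi> x) = p k x" if "x \<in> space M" for x k
    using that \<phi> by (simp add: p'_def E_def)
  have bijT: "bij_betw T (space M) (space M)" using mpt by (simp add: invertible_mpt_def)
  have mptN: "invertible_mpt N S"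
  proof (rule invertible_mptI)
    have "bij_betw S E E"
    proof (rule bij_betw_imageI)
      show "inj_on S E"
      proof (rule inj_onI)
        fix z w assume "z \<in> E" "w \<in> E" "S z = S w"
        then obtain x y where xy: "z = \<psi> x" "x \<in> space M" "w = \<psi> y" "y \<in> space M" "\<psi> (T x) = \<psi> (T y)"
          using S_psi unfolding E_def by auto
        then have "T x = T y" using inj T_space by (simp add: inj_on_eq_iff)
        then have "x = y" using bijT xy by (auto simp: bij_betw_def dest: inj_onD)
        then show "z = w" using xy by simp
      qed
      have "S ` E = \<psi> ` T ` space M" unfolding E_def image_image using S_psi by (rule image_cong[OF refl])
      then show "S ` E = E" using bijT by (simp add: bij_betw_def E_def)
    qed
    moreover have "bij_betw S (space N - E) (space N - E)"
      by (rule bij_betwI[where g = "\<lambda>z. z"]) (auto simp: S_def)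
    ultimately have "bij_betw S (E \<union> (space N - E)) (E \<union> (space N - E))"
      by (rule bij_betw_combine) auto
    moreover have "E \<union> (space N - E) = space N" using E by auto
    ultimately show "bij_betw S (space N) (space N)" by simp
  next
    fix A assume A: "A \<in> sets N"
    define B where "B = {x \<in> space M. \<psi> x \<in> A}"
    have B: "B \<in> sets M" unfolding B_def by (rule pre[OF A])
    have SA: "S ` A = \<psi> ` T ` B \<union> (A - E)"
    proof -
      have "A = \<psi> ` B \<union> (A - E)" by (auto simp: B_def E_def)
      then have "S ` A = S ` \<psi> ` B \<union> S ` (A - E)" by (metis image_Un)
      moreover have "S ` \<psi> ` B = \<psi> ` T ` B" unfolding image_image
        using S_psi by (intro image_cong) (auto simp: B_def)
      moreover have "S ` (A - E) = A - E" by (force simp: S_def)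
      ultimately show ?thesis by simp
    qed
    show SA_sets: "S ` A \<in> sets N"
      unfolding SA using image[OF T_image(1)[OF B]] A E by auto
    have "{x \<in> space M. \<psi> x \<in> S ` A} = T ` B"
    proof -
      have "\<psi> x \<in> S ` A \<longleftrightarrow> x \<in> T ` B" if "x \<in> space M" for x
      proof -
        have "\<psi> x \<in> S ` A \<longleftrightarrow> \<psi> x \<in> \<psi> ` T ` B" unfolding SA using that by (auto simp: E_def)
        also have "\<dots> \<longleftrightarrow> x \<in> T ` B"
          using inj that T_space by (intro inj_on_image_mem_iff) (auto simp: B_def)
        finally show ?thesis .
      qed
      moreover have "T ` B \<subseteq> space M" using T_space by (auto simp: B_def)
      ultimately show ?thesis by blast
    qed
    then have "measure N (S ` A) = measure N A"
      using mN[OF SA_sets] mN[OF A] T_image(2)[OF B] by (simp add: B_def)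
    then show "emeasure N (S ` A) = emeasure N A" by (simp add: N.emeasure_eq_measure)
    have "S -` A \<inter> space N = \<psi> ` {x \<in> space M. T x \<in> B} \<union> (A - E)"
    proof (intro set_eqI iffI)
      fix z assume z: "z \<in> S -` A \<inter> space N"
      show "z \<in> \<psi> ` {x \<in> space M. T x \<in> B} \<union> (A - E)"
      proof (cases "z \<in> E")
        case True
        then obtain x where "x \<in> space M" "z = \<psi> x" by (auto simp: E_def)
        then show ?thesis using z S_psi T_space by (auto simp: B_def)
      next
        case False
        then show ?thesis using z by (auto simp: S_def)
      qed
    next
      fix z assume "z \<in> \<psi> ` {x \<in> space M. T x \<in> B} \<union> (A - E)"
      then show "z \<in> S -` A \<inter> space N"
      proof
        assume "z \<in> \<psi> ` {x \<in> space M. T x \<in> B}"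
        then show ?thesis using S_psi psi_space by (auto simp: B_def)
      next
        assume "z \<in> A - E"
        then show ?thesis using sets.sets_into_space[OF A] by (auto simp: S_def)
      qed
    qed
    moreover have "{x \<in> space M. T x \<in> B} \<in> sets M"
      using iter_sets[OF B, of 1] by simp
    ultimately show "S -` A \<inter> space N \<in> sets N"
      using image A E by auto
  qed
  have p'_vimage: "{z \<in> space N. p' k z \<in> I} \<in> sets N" for k I
  proof -
    have "{z \<in> space N. p' k z \<in> I} =
        \<psi> ` {x \<in> space M. p k x \<in> I} \<union> (if p k x0 \<in> I then space N - E else {})"
    proof (intro set_eqI iffI)
      fix z assume z: "z \<in> {z \<in> space N. p' k z \<in> I}"
      show "z \<in> \<psi> ` {x \<in> space M. p k x \<in> I} \<union> (if p k x0 \<in> I then space N - E else {})"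
      proof (cases "z \<in> E")
        case True
        then obtain x where "x \<in> space M" "z = \<psi> x" by (auto simp: E_def)
        then show ?thesis using z p_psi by auto
      next
        case False
        then show ?thesis using z by (simp add: p'_def)
      qed
    next
      fix z assume "z \<in> \<psi> ` {x \<in> space M. p k x \<in> I} \<union> (if p k x0 \<in> I then space N - E else {})"
      then show "z \<in> {z \<in> space N. p' k z \<in> I}"
      proof
        assume "z \<in> \<psi> ` {x \<in> space M. p k x \<in> I}"
        then show ?thesis using p_psi psi_space by auto
      qed (auto simp: p'_def split: if_splits)
    qed
    moreover have "{x \<in> space M. p k x \<in> I} \<in> sets M"
      using measurable_sets[OF p_meas, of I k] by (simp add: vimage_def Int_def conj_commute)
    ultimately show ?thesis using image E by auto
  qed
  have p'_meas: "p' k \<in> measurable N (count_space UNIV)" for k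
    using p'_vimage[of k] by (intro measurableI) (auto simp: vimage_def Int_def conj_commute)
  have S_meas: "S \<in> measurable N N" using mptN by (simp add: invertible_mpt_def)
  have lev: "{x \<in> space M. \<psi> x \<in> {z \<in> space N. p' k z \<in> I}} = {x \<in> space M. p k x \<in> I}" for k I
    using p_psi psi_space by auto
  have "tower_realization Q m b c N S p'"
  proof (intro tower_realization.intro mpt_space.intro fin tower_data_axioms
      mpt_space_axioms.intro tower_realization_axioms.intro totalN mptN)
    fix k show "p' k \<in> measurable N (count_space UNIV)" by (rule p'_meas)
  next
    fix z k assume "z \<in> space N"
    obtain x where x: "x \<in> space M" "\<And>k. p' k z = p k x"
    proof (cases "z \<in> E")
      case True
      then show ?thesis using that p_psi by (auto simp: E_def)
    next
      case False
      then show ?thesis using that[OF x0] by (simp add: p'_def)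
    qed
    show "p' k z < q k" unfolding x(2) by (rule p_less[OF x(1)])
    show "p' k z = proj k (p' (Suc k) z)" unfolding x(2) by (rule p_proj[OF x(1)])
  next
    fix i k assume "i < q k"
    then show "measure N {z \<in> space N. p' k z = i} = 1 / q k"
      using mN[OF p'_vimage[of k "{i}"]] lev[of k "{i}"] p_measure by simp
  next
    fix k
    define D where "D = {z \<in> space N. p' k (S z) \<noteq> Suc (p' k z) mod q k}"
    have "D \<in> sets N" unfolding D_def
      by (rule sets_Collect_count_space2[OF measurable_compose[OF S_meas p'_meas] p'_meas,
        where P = "\<lambda>i j. i \<noteq> Suc j mod q k"])
    moreover have "{x \<in> space M. \<psi> x \<in> D} = {x \<in> space M. p k (T x) \<noteq> Suc (p k x) mod q k}"
      using psi_space S_psi p_psi T_space by (auto simp: D_def)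
    ultimately show "measure N {z \<in> space N. p' k (S z) \<noteq> Suc (p' k z) mod q k} \<le> 1 / g k"
      using mN[of D] p_step[of k] unfolding D_def by simp
  next
    show "exhaustive N (\<lambda>k. (\<lambda>i. {z \<in> space N. p' k z = i}) ` {..<q k})"
      unfolding exhaustive_def
    proof
      fix A assume A: "A \<in> sets N"
      obtain \<A> where \<A>: "\<And>k. \<A> k \<subseteq> levels k"
        "(\<lambda>k. measure M (sym_diff {x \<in> space M. \<psi> x \<in> A} (\<Union>(\<A> k)))) \<longlonglongrightarrow> 0"
        using p_exhaustive[unfolded exhaustive_def] pre[OF A] by blast
      define I where "I k = {i. i < q k \<and> level k i \<in> \<A> k}" for k
      define \<A>' where "\<A>' k = (\<lambda>i. {z \<in> space N. p' k z = i}) ` I k" for k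
      have U: "\<Union>(\<A> k) = {x \<in> space M. p k x \<in> I k}" for k
      proof (intro set_eqI iffI)
        fix x assume "x \<in> \<Union>(\<A> k)"
        then obtain L where L: "L \<in> \<A> k" "x \<in> L" by blast
        then obtain i where "L = level k i" "i < q k" using \<A>(1) by blast
        then show "x \<in> {x \<in> space M. p k x \<in> I k}" using L by (auto simp: I_def)
      next
        fix x assume "x \<in> {x \<in> space M. p k x \<in> I k}"
        then have "level k (p k x) \<in> \<A> k" "x \<in> level k (p k x)" by (simp_all add: I_def)
        then show "x \<in> \<Union>(\<A> k)" by (rule UnionI)
      qed
      have U': "\<Union>(\<A>' k) = {z \<in> space N. p' k z \<in> I k}" for k by (auto simp: \<A>'_def)
      have "measure N (sym_diff A (\<Union>(\<A>' k))) = measure M (sym_diff {x \<in> space M. \<psi> x \<in> A} (\<Union>(\<A> k)))" for k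
      proof -
        have "sym_diff A (\<Union>(\<A>' k)) \<in> sets N" unfolding U' using A p'_vimage by auto
        moreover have "{x \<in> space M. \<psi> x \<in> sym_diff A (\<Union>(\<A>' k))} = sym_diff {x \<in> space M. \<psi> x \<in> A} (\<Union>(\<A> k))"
          unfolding U U' using psi_space p_psi by auto
        ultimately show ?thesis using mN by simp
      qed
      then have "(\<lambda>k. measure N (sym_diff A (\<Union>(\<A>' k)))) \<longlonglongrightarrow> 0" using \<A>(2) by simp
      then show "\<exists>\<A>. (\<forall>n. \<A> n \<subseteq> (\<lambda>i. {z \<in> space N. p' n z = i}) ` {..<q n}) \<and>
          (\<lambda>n. measure N (sym_diff A (\<Union>(\<A> n)))) \<longlonglongrightarrow> 0"
        by (intro exI[of _ \<A>']) (auto simp: \<A>'_def I_def)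
    qed
  qed
  then show ?thesis by blast
qed

subsection \<open>The skew product over the odometer\<close>

context tower_data
begin

abbreviation s :: "nat \<Rightarrow> nat" where "s k \<equiv> b k * m k"

lemma s_ge: "2 \<le> s k"
proof -
  have "2 * 1 \<le> b k * m k" using b_ge m_pos by (intro mult_le_mono) (auto simp: Suc_le_eq)
  then show ?thesis by simp
qed

lemma Q_dvd: "i \<le> j \<Longrightarrow> Q i dvd Q j"
  by (induction j rule: dec_induct) (auto simp: Q_Suc)

lemma Q_ge: "2 ^ k \<le> Q k"
proof (induction k)
  case (Suc k)
  then have "2 * 2 ^ k \<le> s k * Q k" using s_ge by (intro mult_le_mono)
  then show ?case by (simp add: Q_Suc)
qed (simp add: Q_0)

text \<open>
  The column with left end \<open>a / Q k\<close> has the odometer position \<open>xcode k a\<close>, and there \<open>h\<close> equals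
  \<open>ycode k a / 2^(k+1)\<close> up to the digits beyond \<open>k\<close>.
\<close>

fun xcode :: "nat \<Rightarrow> nat \<Rightarrow> nat" where
  "xcode 0 a = 0"
| "xcode (Suc k) a = xcode k (a div s k) + Q k * (a mod s k)"

fun ycode :: "nat \<Rightarrow> nat \<Rightarrow> nat" where
  "ycode 0 a = 0"
| "ycode (Suc k) a = 2 * ycode k (a div s k) + 2 * shift k (a mod s k)"

lemma xcode_less: "xcode k a < Q k"
proof (induction k arbitrary: a)
  case (Suc k)
  have "a mod s k \<le> s k - 1" using s_ge[of k] mod_less_divisor[of "s k" a] by linarith
  then have "xcode (Suc k) a < Q k + Q k * (s k - 1)"
    unfolding xcode.simps by (intro add_less_le_mono Suc.IH mult_le_mono2)
  also have "\<dots> = Q (Suc k)"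
  proof -
    obtain j where "s k = Suc j" using s_ge[of k] by (cases "s k") auto
    then show ?thesis by (simp add: Q_Suc)
  qed
  finally show ?case .
qed (simp add: Q_0)

lemma xcode_Suc_div: "xcode (Suc k) a div Q k = a mod s k" "xcode (Suc k) a mod Q k = xcode k (a div s k)"
  using xcode_less[of k "a div s k"] by simp_all

lemma xcode_inj: "a < Q k \<Longrightarrow> a' < Q k \<Longrightarrow> xcode k a = xcode k a' \<Longrightarrow> a = a'"
proof (induction k arbitrary: a a')
  case (Suc k)
  have "xcode k (a div s k) = xcode k (a' div s k)" "a mod s k = a' mod s k"
    using xcode_Suc_div[of k a] xcode_Suc_div[of k a'] Suc.prems(3) by metis+
  moreover have "a div s k < Q k" "a' div s k < Q k"
    using Suc.prems(1,2) by (simp_all add: less_mult_imp_div_less Q_Suc mult.commute)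
  ultimately have "a div s k = a' div s k" "a mod s k = a' mod s k" using Suc.IH by blast+
  then have "a div s k * s k + a mod s k = a' div s k * s k + a' mod s k" by simp
  then show ?case by (simp only: div_mult_mod_eq)
qed (simp add: Q_0)

lemma xcode_surj:
  assumes "i < Q k"
  obtains a where "a < Q k" "xcode k a = i"
proof -
  have "inj_on (xcode k) {..<Q k}" using xcode_inj by (auto simp: inj_on_def)
  moreover have "xcode k ` {..<Q k} \<subseteq> {..<Q k}" using xcode_less by auto
  ultimately have "xcode k ` {..<Q k} = {..<Q k}" by (intro endo_inj_surj) auto
  then show ?thesis using that assms by (metis imageE lessThan_iff)
qed

lemma xcode_0: "xcode k 0 = 0"
  by (induction k) simp_all

text \<open>\<open>xcode\<close> reverses the order of the digits, and if all digits are maximal in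
  one order they are in the other. On this last interval the odometer carries beyond the first
  \<open>k\<close> digits.\<close>

lemma xcode_max: "xcode k (Q k - 1) = Q k - 1"
proof (induction k)
  case (Suc k)
  have e: "Q (Suc k) - 1 = (Q k - 1) * s k + (s k - 1)"
  proof -
    obtain j where "Q k = Suc j" using Q_pos[of k] by (cases "Q k") auto
    then show ?thesis using s_ge[of k] by (simp add: Q_Suc algebra_simps)
  qed
  have gen: "(A * S + (S - 1)) div S = A" "(A * S + (S - 1)) mod S = S - 1" if "2 \<le> S" for A S :: nat
  proof -
    have "(A * S + (S - 1)) div S = A + (S - 1) div S" using that by (intro div_mult_self3) simp
    moreover have "(S - 1) div S = 0" "(S - 1) mod S = S - 1" using that by simp_all
    ultimately show "(A * S + (S - 1)) div S = A" "(A * S + (S - 1)) mod S = S - 1"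
      by (simp_all only: mod_mult_self3 add_0_right)
  qed
  have "(Q (Suc k) - 1) div s k = Q k - 1" "(Q (Suc k) - 1) mod s k = s k - 1"
    unfolding e by (rule gen[OF s_ge])+
  then have "xcode (Suc k) (Q (Suc k) - 1) = (Q k - 1) + Q k * (s k - 1)"
    using Suc by simp
  also have "\<dots> = Q (Suc k) - 1"
  proof -
    obtain j where "s k = Suc j" using s_ge[of k] by (cases "s k") auto
    then show ?thesis using Q_pos[of k] by (simp add: Q_Suc algebra_simps)
  qed
  finally show ?case .
qed (simp add: Q_0)

section \<open>Grid cells and addresses of points\<close>

definition cell :: "nat \<Rightarrow> real \<Rightarrow> nat" where
  "cell k x = nat \<lfloor>real (Q k) * x\<rfloor>"

lemma int_cell: "0 \<le> x \<Longrightarrow> int (cell k x) = \<lfloor>real (Q k) * x\<rfloor>"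
  by (simp add: cell_def)

lemma cell_eq_iff: "0 \<le> x \<Longrightarrow> cell k x = a \<longleftrightarrow> a \<le> real (Q k) * x \<and> real (Q k) * x < a + 1"
  using int_cell[of x k] by (simp add: floor_eq_iff flip: of_nat_eq_iff[where 'a = int])

lemma cell_less: "0 \<le> x \<Longrightarrow> x < 1 \<Longrightarrow> cell k x < Q k"
proof -
  assume x: "0 \<le> x" "x < 1"
  have "real (Q k) * x < real (Q k) * 1" using x Q_pos[of k] by (intro mult_strict_left_mono) auto
  then show "cell k x < Q k" using x Q_pos[of k] by (simp add: cell_def nat_less_iff floor_less_iff)
qed

lemma cell_div: "0 \<le> x \<Longrightarrow> cell (Suc k) x div s k = cell k x"
proof -
  assume x: "0 \<le> x"
  have "int (cell (Suc k) x div s k) = \<lfloor>real (Q (Suc k)) * x\<rfloor> div int (s k)"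
    using int_cell[OF x, of "Suc k"] by (simp add: zdiv_int)
  also have "\<dots> = \<lfloor>(real (Q (Suc k)) * x) / real_of_int (int (s k))\<rfloor>"
    by (rule floor_divide_real_eq_div[symmetric]) simp
  also have "(real (Q (Suc k)) * x) / real_of_int (int (s k)) = real (Q k) * x"
    using s_ge[of k] b_ge[of k] m_pos[of k] by (simp add: Q_Suc)
  finally show ?thesis using int_cell[OF x, of k] by simp
qed

text \<open>The counterpart of \<open>t div Q k\<close> for actual points: the height of
  \<open>y\<close> above \<open>h\<close>, in units of \<open>1 / 2 ^ Suc k\<close> and modulo a
  full turn of the fibre.\<close>

definition slice :: "nat \<Rightarrow> real \<Rightarrow> nat \<Rightarrow> nat" where
  "slice k y a = nat ((\<lfloor>2 ^ Suc k * y\<rfloor> - int (ycode k a)) mod 2 ^ Suc k)"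

definition address :: "nat \<Rightarrow> real \<times> real \<Rightarrow> nat" where
  "address k z = xcode k (cell k (fst z)) + Q k * slice k (snd z) (cell k (fst z))"

lemma int_slice: "int (slice k y a) = (\<lfloor>2 ^ Suc k * y\<rfloor> - int (ycode k a)) mod 2 ^ Suc k"
  unfolding slice_def by (simp del: power_Suc)

lemma slice_less: "slice k y a < 2 ^ Suc k"
proof -
  have "int (slice k y a) < 2 ^ Suc k" unfolding int_slice by (simp del: power_Suc)
  then show ?thesis by (metis of_nat_less_iff of_nat_numeral of_nat_power)
qed

lemma address_less: "address k z < q k"
proof -
  have "slice k (snd z) (cell k (fst z)) \<le> 2 ^ Suc k - 1"
    using slice_less[of k "snd z" "cell k (fst z)"] by linarith
  then have "address k z < Q k + Q k * (2 ^ Suc k - 1)"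
    unfolding address_def by (intro add_less_le_mono xcode_less mult_le_mono2)
  also have "\<dots> = q k" by (simp add: q_def algebra_simps)
  finally show ?thesis .
qed

lemma address_div: "address k z mod Q k = xcode k (cell k (fst z))"
  "address k z div Q k = slice k (snd z) (cell k (fst z))"
  unfolding address_def using xcode_less[of k "cell k (fst z)"] by simp_all

text \<open>\<open>ycode (Suc k) a\<close> is even, so halving commutes with subtracting it, and
  half of the floor at the finer scale is the floor at the coarser one. This is the origin of the
  formula for \<open>proj\<close>.\<close>

lemma slice_Suc:
  "slice k y (a div s k) = (slice (Suc k) y a div 2 + shift k (a mod s k)) mod 2 ^ Suc k"
proof -
  define w where "w = int (ycode k (a div s k)) + int (shift k (a mod s k))"
  define u where "u = \<lfloor>2 ^ Suc (Suc k) * y\<rfloor>"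
  have u2: "u div 2 = \<lfloor>2 ^ Suc k * y\<rfloor>"
  proof -
    have "u div 2 = \<lfloor>(2 ^ Suc (Suc k) * y) / real_of_int 2\<rfloor>"
      unfolding u_def by (rule floor_divide_real_eq_div[symmetric]) simp
    also have "(2 ^ Suc (Suc k) * y) / real_of_int 2 = 2 ^ Suc k * y" by simp
    finally show ?thesis .
  qed
  have "int (slice (Suc k) y a) = (u - 2 * w) mod (2 * 2 ^ Suc k)"
    unfolding int_slice u_def w_def by simp
  also have "\<dots> = 2 * ((u - 2 * w) div 2 mod 2 ^ Suc k) + (u - 2 * w) mod 2"
    by (rule zmod_zmult2_eq) simp
  finally have "int (slice (Suc k) y a) div 2 = (u - 2 * w) div 2 mod 2 ^ Suc k" by simp
  also have "(u - 2 * w) div 2 = u div 2 - w" by simp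
  finally have "int ((slice (Suc k) y a div 2 + shift k (a mod s k)) mod 2 ^ Suc k)
      = ((u div 2 - w) mod 2 ^ Suc k + int (shift k (a mod s k))) mod 2 ^ Suc k"
    by (simp add: zdiv_int zmod_int del: power_Suc)
  also have "\<dots> = (u div 2 - w + int (shift k (a mod s k))) mod 2 ^ Suc k"
    by (rule mod_add_left_eq)
  also have "u div 2 - w + int (shift k (a mod s k)) = \<lfloor>2 ^ Suc k * y\<rfloor> - int (ycode k (a div s k))"
    by (simp add: u2 w_def)
  also have "\<dots> mod 2 ^ Suc k = int (slice k y (a div s k))" by (simp only: int_slice)
  finally show ?thesis by (simp only: of_nat_eq_iff)
qed

lemma address_proj:
  assumes "0 \<le> fst z"
  shows "address k z = proj k (address (Suc k) z)"
proof -
  define a where "a = cell (Suc k) (fst z)"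
  have a: "cell k (fst z) = a div s k" using cell_div[OF assms] by (simp add: a_def)
  have 1: "address (Suc k) z mod Q (Suc k) = xcode (Suc k) a" "address (Suc k) z div Q (Suc k) = slice (Suc k) (snd z) a"
    by (simp_all only: address_div a_def)
  have "address (Suc k) z mod Q k = address (Suc k) z mod Q (Suc k) mod Q k"
    by (simp add: mod_mod_cancel Q_Suc)
  then have 2: "address (Suc k) z mod Q k = xcode k (a div s k)"
    by (simp only: 1 xcode_Suc_div)
  have "address k z = xcode k (a div s k) +
      Q k * ((slice (Suc k) (snd z) a div 2 + shift k (a mod s k)) mod 2 ^ Suc k)"
    unfolding address_def a slice_Suc ..
  also have "\<dots> = proj k (address (Suc k) z)"
    unfolding proj_def 1 2 xcode_Suc_div ..
  finally show ?thesis .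
qed

text \<open>A fixed address describes one rectangle of the product grid: \<open>xcode\<close>
  permutes the columns, and \<open>ycode\<close> only rotates the labels within a column.\<close>

lemma address_eq_iff:
  assumes i: "i < q k"
  obtains a e where "a < Q k" "e < 2 ^ Suc k"
    "\<And>x y. x \<in> {0..<1} \<Longrightarrow> y \<in> {0..<1} \<Longrightarrow>
      address k (x, y) = i \<longleftrightarrow> cell k x = a \<and> \<lfloor>2 ^ Suc k * y\<rfloor> = int e"
proof -
  define L where "L = i div Q k"
  have L: "L < 2 ^ Suc k" using i Q_pos[of k] by (simp add: L_def q_def div_less_iff_less_mult)
  have "i mod Q k < Q k" using Q_pos by simp
  then obtain a where a: "a < Q k" "xcode k a = i mod Q k" by (rule xcode_surj)
  define e where "e = (L + ycode k a) mod 2 ^ Suc k"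
  have e: "e < 2 ^ Suc k" by (simp add: e_def)
  show ?thesis
  proof (rule that[OF a(1) e])
    fix x y :: real assume x: "x \<in> {0..<1}" and y: "y \<in> {0..<1}"
    define Y where "Y = \<lfloor>2 ^ Suc k * y\<rfloor>"
    have "0 \<le> 2 ^ Suc k * y" "2 ^ Suc k * y < 2 ^ Suc k * 1"
      using y by (auto intro!: mult_strict_left_mono simp del: power_Suc)
    then have Y: "0 \<le> Y" "Y < 2 ^ Suc k"
      unfolding Y_def by (simp_all add: floor_less_iff del: power_Suc)
    have sl: "slice k y a = L \<longleftrightarrow> Y = int e"
    proof
      assume "slice k y a = L"
      then have "int L = (Y - int (ycode k a)) mod 2 ^ Suc k"
        unfolding Y_def int_slice[symmetric] by simp
      then have "int e = ((Y - int (ycode k a)) mod 2 ^ Suc k + int (ycode k a)) mod 2 ^ Suc k"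
        by (simp add: e_def zmod_int del: power_Suc)
      also have "\<dots> = (Y - int (ycode k a) + int (ycode k a)) mod 2 ^ Suc k" by (rule mod_add_left_eq)
      also have "\<dots> = Y" using Y by (simp del: power_Suc)
      finally show "Y = int e" ..
    next
      assume "Y = int e"
      then have "int (slice k y a) = ((int L + int (ycode k a)) mod 2 ^ Suc k - int (ycode k a)) mod 2 ^ Suc k"
        by (simp add: int_slice Y_def e_def zmod_int del: power_Suc)
      also have "\<dots> = (int L + int (ycode k a) - int (ycode k a)) mod 2 ^ Suc k" by (rule mod_diff_left_eq)
      also have "\<dots> = int (L mod 2 ^ Suc k)" by (simp add: zmod_int del: power_Suc)
      also have "L mod 2 ^ Suc k = L" using L by (rule mod_less)
      finally show "slice k y a = L" by simp
    qed
    show "address k (x, y) = i \<longleftrightarrow> cell k x = a \<and> \<lfloor>2 ^ Suc k * y\<rfloor> = int e"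
    proof
      assume "address k (x, y) = i"
      then have "xcode k (cell k x) = xcode k a" "slice k y (cell k x) = L"
        using address_div[of k "(x, y)"] a(2) by (simp_all add: L_def)
      then show "cell k x = a \<and> \<lfloor>2 ^ Suc k * y\<rfloor> = int e"
        using xcode_inj[of "cell k x" k a] cell_less[of x k] x a(1) sl by (auto simp: Y_def)
    next
      assume "cell k x = a \<and> \<lfloor>2 ^ Suc k * y\<rfloor> = int e"
      then have "address k (x, y) = i mod Q k + Q k * L"
        using sl a(2) by (simp add: address_def Y_def)
      then show "address k (x, y) = i" by (simp add: L_def)
    qed
  qed
qed

section \<open>The odometer as a piecewise translation of the interval\<close>

definition stage :: "real \<Rightarrow> nat" where
  "stage x = (LEAST k. x < 1 - 1 / Q (Suc k))"

text \<open>At stage \<open>k\<close> the first \<open>k\<close> digits are maximal and become 0,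
  which subtracts \<open>1 - 1 / Q k\<close>; the next digit grows by one, which adds
  \<open>1 / Q (Suc k)\<close>.\<close>

definition jump :: "nat \<Rightarrow> real" where
  "jump k = 1 / Q k + 1 / Q (Suc k) - 1"

definition odo :: "real \<Rightarrow> real" where
  "odo x = x + jump (stage x)"

lemma Q_tendsto: "(\<lambda>k. 1 / real (Q k)) \<longlonglongrightarrow> 0"
proof (rule tendsto_sandwich[OF _ _ tendsto_const])
  show "\<forall>\<^sub>F k in sequentially. 0 \<le> 1 / real (Q k)" by simp
  show "(\<lambda>k. (1 / 2 :: real) ^ k) \<longlonglongrightarrow> 0" by (intro LIMSEQ_realpow_zero) auto
  show "\<forall>\<^sub>F k in sequentially. 1 / real (Q k) \<le> (1 / 2) ^ k"
  proof (intro always_eventually allI)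
    fix k
    have "real (2 ^ k) \<le> real (Q k)" using Q_ge[of k] by (rule of_nat_mono)
    then have "1 / real (Q k) \<le> 1 / 2 ^ k" by (intro divide_left_mono) (auto simp: Q_pos)
    then show "1 / real (Q k) \<le> (1 / 2) ^ k" by (simp add: power_one_over)
  qed
qed

lemma inverse_Q_antimono: "i \<le> j \<Longrightarrow> 1 / real (Q j) \<le> 1 / real (Q i)"
  using dvd_imp_le[OF Q_dvd[of i j] Q_pos[of j]] Q_pos[of i] Q_pos[of j]
  by (intro divide_left_mono) auto

lemma stage:
  assumes "0 \<le> x" "x < 1"
  shows "1 - 1 / Q (stage x) \<le> x" "x < 1 - 1 / Q (Suc (stage x))"
proof -
  have "\<forall>\<^sub>F k in sequentially. 1 / real (Q k) < 1 - x"
    using Q_tendsto assms by (intro order_tendstoD) auto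
  then obtain j where "\<forall>k\<ge>j. 1 / real (Q k) < 1 - x" unfolding eventually_sequentially ..
  then have "1 / real (Q (Suc j)) < 1 - x" by simp
  then have "x < 1 - 1 / Q (Suc j)" by simp
  then show "x < 1 - 1 / Q (Suc (stage x))" unfolding stage_def by (rule LeastI)
  show "1 - 1 / Q (stage x) \<le> x"
  proof (cases "stage x")
    case 0
    then show ?thesis using assms by (simp add: Q_0)
  next
    case (Suc l)
    then have "\<not> x < 1 - 1 / Q (Suc l)" unfolding stage_def by (intro not_less_Least) simp
    then show ?thesis using Suc by simp
  qed
qed

lemma stage_eqI:
  assumes "1 - 1 / Q k \<le> x" "x < 1 - 1 / Q (Suc k)"
  shows "stage x = k"
  unfolding stage_def
proof (rule Least_equality)
  fix j assume j: "x < 1 - 1 / Q (Suc j)"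
  show "k \<le> j"
  proof (rule ccontr)
    assume "\<not> k \<le> j"
    then have "1 / real (Q k) \<le> 1 / real (Q (Suc j))" by (intro inverse_Q_antimono) simp
    then show False using j assms(1) by linarith
  qed
qed (rule assms)

lemma odo_bounds:
  assumes "0 \<le> x" "x < 1"
  shows "1 / Q (Suc (stage x)) \<le> odo x" "odo x < 1 / Q (stage x)"
  using stage[OF assms] by (simp_all add: odo_def jump_def)

lemma odo_range:
  assumes "0 \<le> x" "x < 1"
  shows "0 \<le> odo x" "odo x < 1"
proof -
  have "0 \<le> 1 / real (Q (Suc (stage x)))" by simp
  then show "0 \<le> odo x" using odo_bounds[OF assms] by linarith
  have "1 / real (Q (stage x)) \<le> 1" using Q_pos[of "stage x"] by simp
  then show "odo x < 1" using odo_bounds[OF assms] by linarith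
qed

text \<open>The increment of \<open>h\<close> in units of \<open>1 / 2 ^ Suc (Suc k)\<close>. The
  first \<open>ycode\<close> is taken at the cell after the jump, since
  \<open>Q (Suc k) * jump k = s k + 1 - Q (Suc k)\<close>. Cells of stage \<open>k\<close> are among
  the last \<open>s k\<close>, so the subtraction is not truncated there.\<close>

definition twist :: "nat \<Rightarrow> nat \<Rightarrow> int" where
  "twist k a = int (ycode (Suc k) (a + s k + 1 - Q (Suc k))) - int (ycode (Suc k) a)"

context
  fixes x :: real and k :: nat
  assumes x: "0 \<le> x" "x < 1" and k: "k = stage x"
begin

lemma odo_eq: "odo x = x + jump k"
  by (simp add: odo_def k)

lemma cell_stage: "i \<le> k \<Longrightarrow> cell i x = Q i - 1"
proof -
  assume "i \<le> k"
  then have "1 - 1 / real (Q i) \<le> x"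
    using inverse_Q_antimono[of i k] stage(1)[OF x] k by simp
  then have "real (Q i) - 1 \<le> Q i * x" using Q_pos[of i] by (simp add: field_simps)
  moreover have "real (Q i) * x < Q i" using x Q_pos[of i] by simp
  ultimately have "\<lfloor>real (Q i) * x\<rfloor> = int (Q i) - 1" by (simp add: floor_eq_iff)
  then show ?thesis by (simp add: cell_def nat_diff_distrib)
qed

lemma cell_odo_stage: "cell k (odo x) = 0"
proof -
  have "real (Q k) * odo x < 1"
    using odo_bounds(2)[OF x] Q_pos[of k] by (simp add: k field_simps)
  then show ?thesis using odo_range(1)[OF x] by (simp add: cell_def floor_eq_iff)
qed

lemma int_cell_odo:
  assumes "Suc k \<le> i"
  shows "int (cell i (odo x)) = int (cell i x) + int (Q i div Q k) + int (Q i div Q (Suc k)) - int (Q i)"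
proof -
  have dvd: "Q k dvd Q i" "Q (Suc k) dvd Q i" using assms by (auto intro!: Q_dvd)
  have "real (Q i) * odo x = real (Q i) * x + real_of_int (int (Q i div Q k) + int (Q i div Q (Suc k)) - int (Q i))"
    using dvd by (simp add: odo_eq jump_def real_of_nat_div distrib_left right_diff_distrib)
  then have "\<lfloor>real (Q i) * odo x\<rfloor> = \<lfloor>real (Q i) * x\<rfloor> + (int (Q i div Q k) + int (Q i div Q (Suc k)) - int (Q i))"
    by (simp only: floor_add_int)
  then show ?thesis
    using int_cell[OF x(1), of i] int_cell[OF odo_range(1)[OF x], of i] by simp
qed

lemma cell_odo_Suc: "cell (Suc k) (odo x) = cell (Suc k) x + s k + 1 - Q (Suc k)"
proof -
  have "Q (Suc k) div Q k = s k" using Q_pos[of k] by (simp add: Q_Suc)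
  moreover have "Q (Suc k) div Q (Suc k) = 1" using Q_pos[of "Suc k"] by simp
  ultimately have "int (cell (Suc k) (odo x)) = int (cell (Suc k) x) + int (s k) + 1 - int (Q (Suc k))"
    using int_cell_odo[of "Suc k"] by simp
  then show ?thesis by linarith
qed

lemma cell_odo_Suc_mod: "cell (Suc k) (odo x) mod s k = Suc (cell (Suc k) x mod s k)"
proof -
  define a where "a = cell (Suc k) x"
  define a' where "a' = cell (Suc k) (odo x)"
  have "a div s k = Q k - 1" using cell_div[OF x(1), of k] cell_stage[of k] by (simp add: a_def)
  then have a: "a = (Q k - 1) * s k + a mod s k" by (metis div_mult_mod_eq)
  have "a' div s k = 0" using cell_div[OF odo_range(1)[OF x], of k] cell_odo_stage by (simp add: a'_def)
  then have a': "a' mod s k = a'" by (metis div_mult_mod_eq mult_0 add_0)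
  have "(Q k - 1) * s k + s k = Q (Suc k)"
  proof -
    obtain j where "Q k = Suc j" using Q_pos[of k] by (cases "Q k") auto
    then show ?thesis by (simp add: Q_Suc)
  qed
  then have "a' = Suc (a mod s k)" using cell_odo_Suc a unfolding a_def[symmetric] a'_def[symmetric] by linarith
  then show ?thesis using a' by (simp add: a_def a'_def)
qed

lemma cell_odo_mod:
  assumes "Suc k \<le> i"
  shows "cell (Suc i) (odo x) mod s i = cell (Suc i) x mod s i"
proof -
  have q: "Q (Suc i) div Q k = s i * (Q i div Q k)" "Q (Suc i) div Q (Suc k) = s i * (Q i div Q (Suc k))"
    unfolding Q_Suc[of i] using assms by (auto intro!: div_mult_swap[symmetric] Q_dvd)
  have "int (cell (Suc i) (odo x)) = int (cell (Suc i) x) + int (s i) * (int (Q i div Q k) + int (Q i div Q (Suc k)) - int (Q i))"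
    using int_cell_odo[of "Suc i"] assms unfolding q by (simp add: Q_Suc[of i] algebra_simps)
  then have "int (cell (Suc i) (odo x)) mod int (s i) = int (cell (Suc i) x) mod int (s i)" by simp
  then show ?thesis by (simp only: zmod_int[symmetric] of_nat_eq_iff)
qed

text \<open>The first \<open>k\<close> digits pass from all maximal to all zero while digit
  \<open>k\<close> grows by one, which adds exactly one to the position; later digits stay fixed.
  There is no wraparound, because digit \<open>k\<close> was not maximal.\<close>

lemma xcode_odo: "Suc k \<le> i \<Longrightarrow> xcode i (cell i (odo x)) = Suc (xcode i (cell i x))"
proof (induction i rule: dec_induct)
  case base
  have "xcode k (cell (Suc k) x div s k) = Q k - 1"
    using cell_div[OF x(1), of k] cell_stage[of k] xcode_max[of k] by simp
  moreover have "xcode k (cell (Suc k) (odo x) div s k) = 0"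
    using cell_div[OF odo_range(1)[OF x], of k] cell_odo_stage xcode_0[of k] by simp
  ultimately show ?case
    using Q_pos[of k] unfolding xcode.simps cell_odo_Suc_mod by simp
next
  case (step i)
  then show ?case
    unfolding xcode.simps cell_odo_mod[OF step(1)] cell_div[OF x(1)] cell_div[OF odo_range(1)[OF x]]
    by simp
qed

lemma ycode_odo: "Suc k \<le> i \<Longrightarrow>
  int (ycode i (cell i (odo x))) = int (ycode i (cell i x)) + 2 ^ (i - Suc k) * twist k (cell (Suc k) x)"
proof (induction i rule: dec_induct)
  case base
  then show ?case by (simp only: twist_def cell_odo_Suc) simp
next
  case (step i)
  have e: "Suc i - Suc k = Suc (i - Suc k)" using step(1) by simp
  show ?case
    using step(3)
    unfolding e ycode.simps cell_odo_mod[OF step(1)] cell_div[OF x(1)] cell_div[OF odo_range(1)[OF x]]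
    by (simp add: algebra_simps)
qed

text \<open>The fibre is rotated by exactly the increment of \<open>h\<close>, so the height
  relative to \<open>h\<close> is preserved and only the odometer position moves.\<close>

lemma slice_odo:
  assumes "Suc k \<le> i"
  shows "slice i (frac (y + twist k (cell (Suc k) x) / 2 ^ Suc (Suc k))) (cell i (odo x)) = slice i y (cell i x)"
proof -
  define t where "t = twist k (cell (Suc k) x)"
  define F where "F = \<lfloor>y + t / 2 ^ Suc (Suc k)\<rfloor>"
  have pow: "(2::real) ^ Suc i = 2 ^ (i - Suc k) * 2 ^ Suc (Suc k)"
    using assms by (simp add: power_add[symmetric] del: power_Suc)
  have "2 ^ Suc i * frac (y + t / 2 ^ Suc (Suc k)) =
      2 ^ Suc i * y + real_of_int (2 ^ (i - Suc k) * t - 2 ^ Suc i * F)"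
    unfolding frac_def F_def[symmetric] by (simp add: pow algebra_simps del: power_Suc)
  then have "\<lfloor>2 ^ Suc i * frac (y + t / 2 ^ Suc (Suc k))\<rfloor> =
      \<lfloor>2 ^ Suc i * y\<rfloor> + (2 ^ (i - Suc k) * t - 2 ^ Suc i * F)"
    by (simp only: floor_add_int)
  then have "\<lfloor>2 ^ Suc i * frac (y + t / 2 ^ Suc (Suc k))\<rfloor> - int (ycode i (cell i (odo x))) =
      \<lfloor>2 ^ Suc i * y\<rfloor> - int (ycode i (cell i x)) + 2 ^ Suc i * (- F)"
    using ycode_odo[OF assms] by (simp add: t_def)
  then have "int (slice i (frac (y + t / 2 ^ Suc (Suc k))) (cell i (odo x))) = int (slice i y (cell i x))"
    unfolding int_slice by (simp only: mod_mult_self2)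
  then show ?thesis by (simp add: t_def)
qed

end

definition base_map :: "real \<times> real \<Rightarrow> real \<times> real" where
  "base_map z = (odo (fst z),
     frac (snd z + twist (stage (fst z)) (cell (Suc (stage (fst z))) (fst z)) / 2 ^ Suc (Suc (stage (fst z)))))"

text \<open>Beyond its stage a point advances by one without reduction, and \<open>proj_Suc\<close>
  passes this from \<open>Suc i\<close> to \<open>i\<close>. If the stage exceeds \<open>i\<close>,
  the first \<open>Suc i\<close> digits are maximal and the address ends a run of length
  \<open>Q (Suc i)\<close>, in particular a block, which the second assumption excludes.\<close>

lemma address_base_map:
  assumes z: "0 \<le> fst z" "fst z < 1"
  shows "stage (fst z) < i \<Longrightarrow> address i (base_map z) = Suc (address i z)"
    "\<not> g i dvd Suc (address (Suc i) z) \<Longrightarrow> address i (base_map z) = Suc (address i z) mod q i"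
proof -
  have big: "address i (base_map z) = Suc (address i z)" if "stage (fst z) < i" for i
    unfolding address_def base_map_def fst_conv snd_conv
    using slice_odo[OF z refl, of i] xcode_odo[OF z refl, of i] that by (simp add: Suc_le_eq)
  then show "stage (fst z) < i \<Longrightarrow> address i (base_map z) = Suc (address i z)" .
  assume nd: "\<not> g i dvd Suc (address (Suc i) z)"
  have "stage (fst z) \<le> i"
  proof (rule ccontr)
    assume "\<not> stage (fst z) \<le> i"
    then have "cell (Suc i) (fst z) = Q (Suc i) - 1" by (intro cell_stage[OF z refl]) simp
    then have "address (Suc i) z = Q (Suc i) - 1 + Q (Suc i) * slice (Suc i) (snd z) (cell (Suc i) (fst z))"
      unfolding address_def by (simp only: xcode_max)
    then have "Suc (address (Suc i) z) = Q (Suc i) * Suc (slice (Suc i) (snd z) (cell (Suc i) (fst z)))"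
      using Q_pos[of "Suc i"] by simp
    then have "Q (Suc i) dvd Suc (address (Suc i) z)" by simp
    moreover have "g i dvd Q (Suc i)" by (simp add: Q_Suc_g)
    ultimately show False using nd dvd_trans by blast
  qed
  then have "address (Suc i) (base_map z) = Suc (address (Suc i) z)" by (intro big) simp
  moreover have "address i (base_map z) = proj i (address (Suc i) (base_map z))"
    using odo_range(1)[OF z] by (intro address_proj) (simp add: base_map_def)
  ultimately show "address i (base_map z) = Suc (address i z) mod q i"
    using proj_Suc[OF nd] address_proj[OF z(1), of i] by simp
qed

end

subsection \<open>Realization on the square\<close>

text \<open>A single sequence of unions has to work for all \<open>\<eta>\<close>; a best
  approximation for each \<open>n\<close>, which exists by finiteness, provides it.\<close>

lemma exhaustiveI:
  assumes fin: "\<And>n. finite (\<xi> n)"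
    and approx: "\<And>A \<eta>. A \<in> sets M \<Longrightarrow> 0 < \<eta> \<Longrightarrow>
      \<forall>\<^sub>F n in sequentially. \<exists>\<A>\<subseteq>\<xi> n. measure M (sym_diff A (\<Union>\<A>)) < \<eta>"
  shows "exhaustive M \<xi>"
  unfolding exhaustive_def
proof
  fix A assume A: "A \<in> sets M"
  define f where "f \<A> = measure M (sym_diff A (\<Union>\<A>))" for \<A>
  have "\<forall>n. \<exists>\<A>. is_arg_min f (\<lambda>\<A>. \<A> \<in> Pow (\<xi> n)) \<A>"
    using fin by (intro allI ex_is_arg_min_if_finite) auto
  then obtain \<A> where \<A>: "\<And>n. is_arg_min f (\<lambda>\<A>. \<A> \<in> Pow (\<xi> n)) (\<A> n)" by metis
  show "\<exists>\<A>. (\<forall>n. \<A> n \<subseteq> \<xi> n) \<and> (\<lambda>n. measure M (sym_diff A (\<Union>(\<A> n)))) \<longlonglongrightarrow> 0"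
  proof (intro exI[of _ \<A>] conjI allI)
    show "\<A> n \<subseteq> \<xi> n" for n using \<A>[of n] by (simp add: is_arg_min_def)
    have "(\<lambda>n. f (\<A> n)) \<longlonglongrightarrow> 0"
    proof (rule order_tendstoI)
      fix a :: real assume "a < 0"
      then have "a < f (\<A> n)" for n
        using measure_nonneg[of M "sym_diff A (\<Union>(\<A> n))"] unfolding f_def by linarith
      then show "\<forall>\<^sub>F n in sequentially. a < f (\<A> n)" by simp
    next
      fix a :: real assume "0 < a"
      then show "\<forall>\<^sub>F n in sequentially. f (\<A> n) < a"
      proof (rule eventually_mono[OF approx[OF A]])
        fix n assume "\<exists>\<B>\<subseteq>\<xi> n. measure M (sym_diff A (\<Union>\<B>)) < a"
        then obtain \<B> where B: "\<B> \<subseteq> \<xi> n" "f \<B> < a" by (auto simp: f_def)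
        then have "\<not> f \<B> < f (\<A> n)" using \<A>[of n] by (simp add: is_arg_min_def)
        then show "f (\<A> n) < a" using B(2) by linarith
      qed
    qed
    then show "(\<lambda>n. measure M (sym_diff A (\<Union>(\<A> n)))) \<longlonglongrightarrow> 0" by (simp add: f_def)
  qed
qed

lemma rectangle_lborel:
  fixes a b c d :: real
  assumes "a \<le> b" "c \<le> d"
  shows "{a..<b} \<times> {c..<d} \<in> sets borel" "{a..<b} \<times> {c..<d} \<in> sets lebesgue"
    "measure lebesgue ({a..<b} \<times> {c..<d}) = (b - a) * (d - c)"
    "emeasure lebesgue ({a..<b} \<times> {c..<d}) = ennreal ((b - a) * (d - c))"
proof -
  show 1: "{a..<b} \<times> {c..<d} \<in> sets borel" by (rule borel_Times) auto
  then show 2: "{a..<b} \<times> {c..<d} \<in> sets lebesgue" by (intro sets_completionI_sets) simp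
  have "emeasure lebesgue ({a..<b} \<times> {c..<d}) = emeasure (lborel \<Otimes>\<^sub>M lborel) ({a..<b} \<times> {c..<d})"
    using 1 by (simp add: lborel_prod)
  also have "\<dots> = emeasure lborel {a..<b} * emeasure lborel {c..<d}"
    by (rule lborel.emeasure_pair_measure_Times) auto
  also have "\<dots> = ennreal ((b - a) * (d - c))" using assms by (simp add: ennreal_mult)
  finally show "emeasure lebesgue ({a..<b} \<times> {c..<d}) = ennreal ((b - a) * (d - c))" .
  then show "measure lebesgue ({a..<b} \<times> {c..<d}) = (b - a) * (d - c)"
    using assms by (simp add: measure_def)
qed

context tower_data
begin

text \<open>The grid lines are removed because the odometer maps onto \<open>(0,1)\<close> only.\<close>

definition base_space :: "(real \<times> real) set" where
  "base_space = {z \<in> {0..<1} \<times> {0..<1}. \<forall>k. real (Q k) * fst z \<notin> \<int>}"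

lemma base_spaceD:
  assumes "z \<in> base_space"
  shows "0 \<le> fst z" "fst z < 1" "0 \<le> snd z" "snd z < 1" "real (Q k) * fst z \<notin> \<int>"
  using assms by (auto simp: base_space_def)

lemma grid_negligible: "negligible (({0..<1} \<times> {0..<1}) - base_space)"
proof -
  define H where "H = (\<lambda>(k, n). {z :: real \<times> real. (1, 0) \<bullet> z = real_of_int n / Q k})"
  have "negligible (\<Union>(H ` (UNIV :: (nat \<times> int) set)))"
  proof (rule negligible_countable_Union)
    show "countable (H ` (UNIV :: (nat \<times> int) set))" by simp
    fix S assume "S \<in> H ` (UNIV :: (nat \<times> int) set)"
    then obtain k n where "S = {z :: real \<times> real. (1, 0) \<bullet> z = real_of_int n / Q k}"
      by (auto simp: H_def)
    then show "negligible S" by (simp only:) (rule negligible_hyperplane, simp add: zero_prod_def)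
  qed
  moreover have "({0..<1} \<times> {0..<1}) - base_space \<subseteq> \<Union>(H ` UNIV)"
  proof
    fix z assume "z \<in> ({0..<1} \<times> {0..<1}) - base_space"
    then obtain k where "real (Q k) * fst z \<in> \<int>" by (auto simp: base_space_def)
    then obtain n where "real (Q k) * fst z = of_int n" by (rule Ints_cases)
    then have "(1, 0) \<bullet> z = real_of_int n / Q k"
      using Q_pos[of k] by (simp add: field_simps inner_prod_def)
    then have "z \<in> H (k, n)" by (simp add: H_def)
    then show "z \<in> \<Union>(H ` UNIV)" by blast
  qed
  ultimately show ?thesis by (rule negligible_subset)
qed

lemma base_space_sets: "base_space \<in> sets lebesgue"
proof -
  have "base_space = ({0..<1} \<times> {0..<1}) - (({0..<1} \<times> {0..<1}) - base_space)"
    by (auto simp: base_space_def)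
  also have "\<dots> \<in> sets lebesgue"
    by (rule sets.Diff[OF rectangle_lborel(2) negligible_imp_sets[OF grid_negligible]]) simp_all
  finally show ?thesis .
qed

lemma emeasure_base_space_Int:
  assumes "R \<in> sets lebesgue" "R \<subseteq> {0..<1} \<times> {0..<1}"
  shows "emeasure lebesgue (base_space \<inter> R) = emeasure lebesgue R"
proof -
  let ?N = "({0..<1} \<times> {0..<1}) - base_space"
  have "base_space \<inter> R = R - ?N" using assms(2) by auto
  then show ?thesis
    using emeasure_Diff_null_set[of ?N lebesgue R] grid_negligible assms(1)
    by (simp add: negligible_iff_null_sets)
qed

lemma emeasure_base_space: "emeasure lebesgue base_space = 1"
proof -
  have "base_space = base_space \<inter> ({0..<1} \<times> {0..<1})" by (auto simp: base_space_def)
  then have "emeasure lebesgue base_space = emeasure lebesgue ({0..<1 :: real} \<times> {0..<1 :: real})"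
    using emeasure_base_space_Int[of "{0..<1} \<times> {0..<1}"] rectangle_lborel(2)[of 0 1 0 1] by simp
  then show ?thesis using rectangle_lborel(4)[of 0 1 0 1] by simp
qed

lemma jump_Ints: "Suc k \<le> i \<Longrightarrow> real (Q i) * jump k \<in> \<int>"
proof -
  assume i: "Suc k \<le> i"
  have "real (Q i) * jump k = real (Q i div Q k) + real (Q i div Q (Suc k)) - real (Q i)"
    using i by (simp add: jump_def distrib_left right_diff_distrib real_of_nat_div Q_dvd)
  also have "\<dots> \<in> \<int>" by simp
  finally show ?thesis .
qed

text \<open>\<open>jump k\<close> is a multiple of \<open>1 / Q (Suc k)\<close>, so translation by
  it preserves the set of all grid points, and \<open>base_map\<close> preserves
  \<open>base_space\<close>.\<close>

lemma grid_jump_iff: "(\<exists>i. real (Q i) * (x + jump k) \<in> \<int>) \<longleftrightarrow> (\<exists>i. real (Q i) * x \<in> \<int>)"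
proof -
  have up: "real (Q j) * y \<in> \<int>" if "real (Q i) * y \<in> \<int>" "i \<le> j" for i j y
  proof -
    have "Q i dvd Q j" using that(2) by (rule Q_dvd)
    then obtain n where "Q j = Q i * n" by (rule dvdE)
    then have eq: "real (Q j) * y = real n * (real (Q i) * y)" by simp
    show ?thesis unfolding eq by (intro Ints_mult that(1)) simp
  qed
  show ?thesis
  proof
    assume "\<exists>i. real (Q i) * (x + jump k) \<in> \<int>"
    then obtain i where "real (Q i) * (x + jump k) \<in> \<int>" ..
    then have "real (Q (max i (Suc k))) * (x + jump k) \<in> \<int>" by (rule up) simp
    moreover have "real (Q (max i (Suc k))) * jump k \<in> \<int>" by (rule jump_Ints) simp
    ultimately have "real (Q (max i (Suc k))) * (x + jump k) - real (Q (max i (Suc k))) * jump k \<in> \<int>"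
      by (rule Ints_diff)
    then show "\<exists>i. real (Q i) * x \<in> \<int>" unfolding distrib_left add_diff_cancel_right' by (rule exI)
  next
    assume "\<exists>i. real (Q i) * x \<in> \<int>"
    then obtain i where "real (Q i) * x \<in> \<int>" ..
    then have "real (Q (max i (Suc k))) * x \<in> \<int>" by (rule up) simp
    moreover have "real (Q (max i (Suc k))) * jump k \<in> \<int>" by (rule jump_Ints) simp
    ultimately have "real (Q (max i (Suc k))) * x + real (Q (max i (Suc k))) * jump k \<in> \<int>"
      by (rule Ints_add)
    then show "\<exists>i. real (Q i) * (x + jump k) \<in> \<int>" unfolding distrib_left by (rule exI)
  qed
qed

lemma base_map_bij: "bij_betw base_map base_space base_space"
proof (rule bij_betw_imageI)
  show "inj_on base_map base_space"
  proof (rule inj_onI)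
    fix z w assume z: "z \<in> base_space" and w: "w \<in> base_space" and eq: "base_map z = base_map w"
    have odo: "odo (fst z) = odo (fst w)" using eq by (simp add: base_map_def)
    \<comment> \<open>The branches have disjoint images: stage \<open>k\<close> is mapped into
      \<open>[1 / Q (Suc k), 1 / Q k)\<close>.\<close>
    have nless: "\<not> stage (fst a) < stage (fst b)"
      if "a \<in> base_space" "b \<in> base_space" "odo (fst a) = odo (fst b)" for a b
    proof
      assume "stage (fst a) < stage (fst b)"
      then have "1 / real (Q (stage (fst b))) \<le> 1 / real (Q (Suc (stage (fst a))))"
        by (intro inverse_Q_antimono) simp
      then show False
        using odo_bounds[OF base_spaceD(1,2)[OF that(1)]] odo_bounds[OF base_spaceD(1,2)[OF that(2)]] that(3)
        by linarith
    qed
    have st: "stage (fst z) = stage (fst w)"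
      using nless[OF z w odo] nless[OF w z odo[symmetric]] by linarith
    then have fst: "fst z = fst w" using odo by (simp add: odo_def)
    define t where "t = twist (stage (fst w)) (cell (Suc (stage (fst w))) (fst w)) / 2 ^ Suc (Suc (stage (fst w)))"
    have "frac (snd z + t) = frac (snd w + t)"
      using eq fst by (simp add: base_map_def t_def)
    then have "snd z - snd w = of_int (\<lfloor>snd z + t\<rfloor> - \<lfloor>snd w + t\<rfloor>)"
      by (simp add: frac_def)
    then obtain n :: int where "snd z - snd w = of_int n" by (rule that)
    moreover have "\<bar>snd z - snd w\<bar> < 1" using base_spaceD(3,4)[OF z] base_spaceD(3,4)[OF w] by linarith
    ultimately have "\<bar>n\<bar> < 1" "snd z - snd w = of_int n" by linarith+
    then have "snd z = snd w" by simp
    then show "z = w" using fst by (simp add: prod_eq_iff)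
  qed
  show "base_map ` base_space = base_space"
  proof
    show "base_map ` base_space \<subseteq> base_space"
    proof (rule image_subsetI)
      fix z assume z: "z \<in> base_space"
      have "\<nexists>i. real (Q i) * odo (fst z) \<in> \<int>"
        unfolding odo_def grid_jump_iff using base_spaceD(5)[OF z] by blast
      then show "base_map z \<in> base_space"
        using odo_range[OF base_spaceD(1,2)[OF z]] frac_lt_1
        by (auto simp: base_map_def base_space_def)
    qed
    show "base_space \<subseteq> base_map ` base_space"
    proof
      fix z assume z: "z \<in> base_space"
      define w where "w = fst z"
      have "w \<noteq> 0" using base_spaceD(5)[OF z, of 0] by (auto simp: w_def Q_0)
      then have w: "0 < w" "w < 1" using base_spaceD(1,2)[OF z] by (auto simp: w_def)
      \<comment> \<open>The same intervals exhaust \<open>(0,1)\<close>, so \<open>w\<close>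
        determines the branch it comes from.\<close>
      define k where "k = (LEAST k. 1 / real (Q (Suc k)) \<le> w)"
      have "\<forall>\<^sub>F j in sequentially. 1 / real (Q j) < w"
        using Q_tendsto w(1) by (rule order_tendstoD)
      then obtain j where "\<forall>i\<ge>j. 1 / real (Q i) < w" unfolding eventually_sequentially ..
      then have "1 / real (Q (Suc j)) \<le> w" by (simp add: less_imp_le)
      then have k1: "1 / real (Q (Suc k)) \<le> w" unfolding k_def by (rule LeastI)
      have k2: "w < 1 / real (Q k)"
      proof (cases k)
        case 0
        then show ?thesis using w by (simp add: Q_0)
      next
        case (Suc l)
        then have "\<not> 1 / real (Q (Suc l)) \<le> w" unfolding k_def by (intro not_less_Least) simp
        then show ?thesis using Suc by simp
      qed
      define x where "x = w - jump k"
      have x: "1 - 1 / Q k \<le> x" "x < 1 - 1 / Q (Suc k)" using k1 k2 by (auto simp: x_def jump_def)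
      have st: "stage x = k" by (rule stage_eqI[OF x])
      have "1 / real (Q k) \<le> 1" "0 \<le> 1 / real (Q (Suc k))" using Q_pos[of k] by simp_all
      then have x01: "0 \<le> x" "x < 1" using x by linarith+
      have "\<nexists>i. real (Q i) * (x + jump k) \<in> \<int>" using base_spaceD(5)[OF z] by (auto simp: x_def w_def)
      then have grid: "\<nexists>i. real (Q i) * x \<in> \<int>" unfolding grid_jump_iff .
      define t where "t = twist k (cell (Suc k) x) / 2 ^ Suc (Suc k)"
      define y where "y = frac (snd z - t)"
      have "(x, y) \<in> base_space"
        using x01 grid frac_lt_1[of "snd z - t"] by (auto simp: base_space_def y_def)
      moreover have "base_map (x, y) = z"
      proof (rule prod_eqI)
        have "fst (base_map (x, y)) = x + jump k" by (simp add: base_map_def odo_def st)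
        then show "fst (base_map (x, y)) = fst z" by (simp add: x_def w_def)
        have "frac (y + t) = frac (snd z)"
        proof -
          have "y + t = snd z + of_int (- \<lfloor>snd z - t\<rfloor>)" by (simp add: y_def frac_def)
          then show ?thesis unfolding frac_def by simp
        qed
        also have "\<dots> = snd z" using base_spaceD(3,4)[OF z] by (simp add: frac_eq)
        finally show "snd (base_map (x, y)) = snd z" by (simp add: base_map_def st t_def)
      qed
      ultimately show "z \<in> base_map ` base_space" by (metis image_eqI)
    qed
  qed
qed

text \<open>The stage fixes the horizontal translation, the cell fixes the rotation, and the floor
  fixes the integer removed by \<open>frac\<close>; where all three are constant, the map is a
  translation.\<close>

lemma base_map_mpt: "invertible_mpt (lebesgue_on base_space) base_map"
proof -
  define \<tau> :: "nat \<Rightarrow> nat \<Rightarrow> real" where "\<tau> k a = twist k a / 2 ^ Suc (Suc k)" for k a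
  define \<iota> :: "real \<times> real \<Rightarrow> nat \<times> nat \<times> int" where
    "\<iota> z = (let k = stage (fst z); a = cell (Suc k) (fst z) in (k, a, \<lfloor>snd z + \<tau> k a\<rfloor>))" for z
  define v where "v = (\<lambda>(k, a, e :: int). (jump k, \<tau> k a - e))"
  show ?thesis
  proof (rule invertible_mpt_piecewise_translation[OF base_space_sets base_map_bij])
    fix i :: "nat \<times> nat \<times> int"
    obtain k a e where i: "i = (k, a, e)" by (cases i) auto
    define I1 where "I1 = {1 - 1 / Q k..<1 - 1 / Q (Suc k)} \<inter> {a / Q (Suc k)..<(a + 1) / Q (Suc k)}"
    define I2 where "I2 = {e - \<tau> k a..<e + 1 - \<tau> k a}"
    have "\<iota> z = i \<longleftrightarrow> z \<in> I1 \<times> I2" if z: "z \<in> base_space" for z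
    proof -
      note z' = base_spaceD(1,2)[OF z]
      have 1: "stage (fst z) = k \<longleftrightarrow> 1 - 1 / Q k \<le> fst z \<and> fst z < 1 - 1 / Q (Suc k)"
        using stage[OF z'] stage_eqI by blast
      have 2: "cell (Suc k) (fst z) = a \<longleftrightarrow> a / Q (Suc k) \<le> fst z \<and> fst z < (a + 1) / Q (Suc k)"
        using Q_pos[of "Suc k"] cell_eq_iff[OF z'(1), of "Suc k" a] by (simp add: field_simps)
      have 3: "\<lfloor>snd z + \<tau> k a\<rfloor> = e \<longleftrightarrow> e - \<tau> k a \<le> snd z \<and> snd z < e + 1 - \<tau> k a"
        by (auto simp: floor_eq_iff)
      have "\<iota> z = i \<longleftrightarrow> stage (fst z) = k \<and> cell (Suc k) (fst z) = a \<and> \<lfloor>snd z + \<tau> k a\<rfloor> = e"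
        unfolding \<iota>_def i Let_def by auto
      then show ?thesis unfolding 1 2 3 I1_def I2_def by (auto simp: mem_Times_iff)
    qed
    then have "{z \<in> base_space. \<iota> z = i} = base_space \<inter> (I1 \<times> I2)" by auto
    moreover have "I1 \<times> I2 \<in> sets lebesgue"
      unfolding I1_def I2_def by (intro sets_completionI_sets) (simp, intro borel_Times sets.Int, auto)
    ultimately show "{z \<in> base_space. \<iota> z = i} \<in> sets lebesgue" using base_space_sets by auto
  next
    fix z assume "z \<in> base_space"
    show "base_map z = z + v (\<iota> z)"
      by (simp add: base_map_def odo_def v_def \<iota>_def \<tau>_def Let_def frac_def prod_eq_iff)
  qed
qed

lemma address_fibre:
  assumes i: "i < q k"
  shows "{z \<in> base_space. address k z = i} \<in> sets lebesgue"
    "emeasure lebesgue {z \<in> base_space. address k z = i} = ennreal (1 / q k)"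
proof -
  obtain a e where a: "a < Q k" and e: "e < 2 ^ Suc k"
    and iff: "\<And>x y. x \<in> {0..<1} \<Longrightarrow> y \<in> {0..<1} \<Longrightarrow>
      address k (x, y) = i \<longleftrightarrow> cell k x = a \<and> \<lfloor>2 ^ Suc k * y\<rfloor> = int e"
    using address_eq_iff[OF i] by metis
  define R where "R = {a / Q k..<(a + 1) / Q k} \<times> {e / 2 ^ Suc k..<(e + 1) / 2 ^ Suc k :: real}"
  have Qk: "0 < real (Q k)" using Q_pos by simp
  have P2: "0 < (2 :: real) ^ Suc k" by simp
  have "address k z = i \<longleftrightarrow> z \<in> R" if z: "z \<in> base_space" for z
  proof -
    note z' = base_spaceD(1-4)[OF z]
    have "address k z = i \<longleftrightarrow> cell k (fst z) = a \<and> \<lfloor>2 ^ Suc k * snd z\<rfloor> = int e"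
      using iff[of "fst z" "snd z"] z' by simp
    also have "cell k (fst z) = a \<longleftrightarrow> a / Q k \<le> fst z \<and> fst z < (a + 1) / Q k"
      using Qk cell_eq_iff[OF z'(1), of k a] by (simp add: field_simps)
    also have "\<lfloor>2 ^ Suc k * snd z\<rfloor> = int e \<longleftrightarrow> e / 2 ^ Suc k \<le> snd z \<and> snd z < (e + 1) / 2 ^ Suc k"
      using P2 by (simp add: floor_eq_iff pos_divide_le_eq pos_less_divide_eq mult.commute add.commute del: power_Suc)
    finally show ?thesis by (auto simp: R_def mem_Times_iff)
  qed
  then have eq: "{z \<in> base_space. address k z = i} = base_space \<inter> R" by auto
  have le: "a / Q k \<le> (a + 1) / Q k" "e / 2 ^ Suc k \<le> (e + 1) / (2 ^ Suc k :: real)"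
    by (simp_all add: divide_right_mono)
  have R: "R \<in> sets lebesgue" unfolding R_def by (rule rectangle_lborel(2)[OF le])
  then show "{z \<in> base_space. address k z = i} \<in> sets lebesgue"
    unfolding eq using base_space_sets by auto
  have "R \<subseteq> {0..<1} \<times> {0..<1}"
  proof -
    have "(a + 1) / real (Q k) \<le> 1" using a Qk by simp
    moreover have "real (e + 1) \<le> real (2 ^ Suc k)" using e by (intro of_nat_mono) simp
    then have "(e + 1) / (2 ^ Suc k :: real) \<le> 1" using P2 by (simp add: divide_le_eq_1)
    moreover have "0 \<le> a / real (Q k)" "0 \<le> e / (2 ^ Suc k :: real)" by simp_all
    moreover have "{l..<r} \<subseteq> {0..<1}" if "0 \<le> l" "r \<le> 1" for l r :: real using that by auto
    ultimately show ?thesis unfolding R_def by (intro Sigma_mono) blast+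
  qed
  then have "emeasure lebesgue (base_space \<inter> R) = emeasure lebesgue R" by (rule emeasure_base_space_Int[OF R])
  also have "\<dots> = ennreal (((a + 1) / Q k - a / Q k) * ((e + 1) / 2 ^ Suc k - e / 2 ^ Suc k))"
    unfolding R_def by (rule rectangle_lborel(4)[OF le])
  also have "((a + 1) / Q k - a / Q k) * ((e + 1) / 2 ^ Suc k - e / 2 ^ Suc k) = 1 / q k"
    by (simp add: diff_divide_distrib[symmetric] q_def)
  finally show "emeasure lebesgue {z \<in> base_space. address k z = i} = ennreal (1 / q k)" unfolding eq .
qed

lemma address_grid_close:
  assumes z: "z \<in> base_space" and w: "w \<in> base_space" and eq: "address k z = address k w"
  shows "\<bar>fst z - fst w\<bar> \<le> 1 / Q k" "\<bar>snd z - snd w\<bar> \<le> 1 / 2 ^ Suc k"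
proof -
  obtain a e where iff: "\<And>x y. x \<in> {0..<1} \<Longrightarrow> y \<in> {0..<1} \<Longrightarrow>
      address k (x, y) = address k w \<longleftrightarrow> cell k x = a \<and> \<lfloor>2 ^ Suc k * y\<rfloor> = int e"
    using address_eq_iff[OF address_less, of k w] by metis
  have zz: "cell k (fst z) = a" "\<lfloor>2 ^ Suc k * snd z\<rfloor> = int e"
    using iff[of "fst z" "snd z"] base_spaceD[OF z] eq by simp_all
  have ww: "cell k (fst w) = a" "\<lfloor>2 ^ Suc k * snd w\<rfloor> = int e"
    using iff[of "fst w" "snd w"] base_spaceD[OF w] by simp_all
  have "\<bar>real (Q k) * fst z - real (Q k) * fst w\<bar> \<le> 1"
    using zz(1) ww(1) cell_eq_iff[OF base_spaceD(1)[OF z], of k a] cell_eq_iff[OF base_spaceD(1)[OF w], of k a]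
    by linarith
  then have "real (Q k) * \<bar>fst z - fst w\<bar> \<le> 1"
    by (simp add: right_diff_distrib[symmetric] abs_mult)
  then show "\<bar>fst z - fst w\<bar> \<le> 1 / Q k"
    using Q_pos[of k] by (simp add: pos_le_divide_eq mult.commute)
  have "\<bar>2 ^ Suc k * snd z - 2 ^ Suc k * snd w\<bar> \<le> 1"
    using zz(2) ww(2) by linarith
  then have "2 ^ Suc k * \<bar>snd z - snd w\<bar> \<le> 1"
    by (simp add: right_diff_distrib[symmetric] abs_mult del: power_Suc)
  then show "\<bar>snd z - snd w\<bar> \<le> 1 / 2 ^ Suc k"
    by (simp add: pos_le_divide_eq mult.commute del: power_Suc)
qed

abbreviation base_measure :: "(real \<times> real) measure" where
  "base_measure \<equiv> lebesgue_on base_space"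

lemma sets_base: "A \<in> sets base_measure \<longleftrightarrow> A \<in> sets lebesgue \<and> A \<subseteq> base_space"
  using base_space_sets by (auto simp: sets_restrict_space_iff)

lemma emeasure_base: "A \<subseteq> base_space \<Longrightarrow> emeasure base_measure A = emeasure lebesgue A"
  using base_space_sets by (simp add: emeasure_restrict_space)

lemma finite_measure_base: "finite_measure base_measure"
  by (rule finite_measureI) (simp add: emeasure_base emeasure_base_space)

lemma address_fibres:
  shows "{z \<in> base_space. address k z \<in> I} \<in> sets base_measure"
    "measure base_measure {z \<in> base_space. address k z \<in> I} = card (I \<inter> {..<q k}) / q k"
proof -
  interpret finite_measure base_measure by (rule finite_measure_base)
  have eq: "{z \<in> base_space. address k z \<in> I} = (\<Union>i\<in>I \<inter> {..<q k}. {z \<in> base_space. address k z = i})"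
    using address_less by auto
  have sets: "{z \<in> base_space. address k z = i} \<in> sets base_measure" if "i < q k" for i
    using address_fibre(1)[OF that] by (auto simp: sets_base)
  show "{z \<in> base_space. address k z \<in> I} \<in> sets base_measure"
    unfolding eq using sets by (intro sets.finite_UN) auto
  have "measure base_measure {z \<in> base_space. address k z = i} = 1 / q k" if "i < q k" for i
    using address_fibre(2)[OF that] emeasure_base[of "{z \<in> base_space. address k z = i}"]
    by (simp add: measure_def)
  then have "(\<Sum>i\<in>I \<inter> {..<q k}. measure base_measure {z \<in> base_space. address k z = i}) = card (I \<inter> {..<q k}) / q k"
    by simp
  moreover have "measure base_measure (\<Union>i\<in>I \<inter> {..<q k}. {z \<in> base_space. address k z = i}) =
      (\<Sum>i\<in>I \<inter> {..<q k}. measure base_measure {z \<in> base_space. address k z = i})"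
    using sets by (intro finite_measure_finite_Union) (auto simp: disjoint_family_on_def)
  ultimately show "measure base_measure {z \<in> base_space. address k z \<in> I} = card (I \<inter> {..<q k}) / q k"
    unfolding eq by simp
qed

text \<open>Inner regularity replaces \<open>A\<close> by a closed set \<open>K\<close>. The union
  of the rectangles of stage \<open>k\<close> meeting \<open>K\<close> decreases to
  \<open>K\<close>, because their diameters tend to 0 and \<open>K\<close> is closed; hence its
  measure converges to that of \<open>K\<close>.\<close>

lemma base_exhaustive:
  "exhaustive base_measure (\<lambda>k. (\<lambda>i. {z \<in> base_space. address k z = i}) ` {..<q k})"
proof (rule exhaustiveI)
  interpret finite_measure base_measure by (rule finite_measure_base)
  show "finite ((\<lambda>i. {z \<in> base_space. address k z = i}) ` {..<q k})" for k by simp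
  fix A and \<eta> :: real assume "A \<in> sets base_measure" and \<eta>: "0 < \<eta>"
  then have A: "A \<in> sets lebesgue" "A \<subseteq> base_space" by (auto simp: sets_base)
  have "0 < \<eta> / 2" using \<eta> by simp
  then obtain K where K: "closed K" "K \<subseteq> A" "A - K \<in> lmeasurable"
      "emeasure lebesgue (A - K) < ennreal (\<eta> / 2)"
    by (rule sets_lebesgue_inner_closed[OF A(1)])
  have KU: "K \<subseteq> base_space" using K A by auto
  have Ks: "K \<in> sets base_measure" using K(1) KU by (auto simp: sets_base)
  have mAK: "measure base_measure (A - K) < \<eta> / 2"
  proof -
    have "emeasure base_measure (A - K) < ennreal (\<eta> / 2)" using K(4) A by (subst emeasure_base) auto
    then show ?thesis using \<eta> by (simp add: emeasure_eq_measure ennreal_less_iff)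
  qed
  define E where "E k = {z \<in> base_space. address k z \<in> address k ` K}" for k
  have E: "E k \<in> sets base_measure" for k unfolding E_def by (rule address_fibres)
  have dec: "decseq E"
  proof (rule decseq_SucI, rule subsetI)
    fix k z assume "z \<in> E (Suc k)"
    then obtain w where w: "z \<in> base_space" "w \<in> K" "address (Suc k) z = address (Suc k) w"
      by (auto simp: E_def)
    then have "address k z = address k w"
      using address_proj[of z k] address_proj[of w k] base_spaceD(1) KU by (metis subsetD)
    then show "z \<in> E k" using w by (auto simp: E_def)
  qed
  have Int: "(\<Inter>k. E k) = K"
  proof
    show "K \<subseteq> (\<Inter>k. E k)" using KU by (auto simp: E_def)
    show "(\<Inter>k. E k) \<subseteq> K"
    proof
      fix z assume z: "z \<in> (\<Inter>k. E k)"
      then have zU: "z \<in> base_space" by (auto simp: E_def)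
      have "address k z \<in> address k ` K" for k using z by (simp add: E_def)
      then have "\<forall>k. \<exists>w. w \<in> K \<and> address k z = address k w" by (simp only: image_iff Bex_def simp_thms)
      from choice[OF this] obtain w where "\<forall>k. w k \<in> K \<and> address k z = address k (w k)" ..
      then have w: "\<And>k. w k \<in> K" "\<And>k. address k z = address k (w k)" by simp_all
      have "(\<lambda>k. dist (w k) z) \<longlonglongrightarrow> 0"
      proof (rule tendsto_sandwich[OF _ _ tendsto_const])
        show "\<forall>\<^sub>F k in sequentially. 0 \<le> dist (w k) z" by simp
        show "\<forall>\<^sub>F k in sequentially. dist (w k) z \<le> 1 / real (Q k) + (1 / 2) * (1 / 2) ^ k"
        proof (intro always_eventually allI)
          fix k
          have "dist (w k) z \<le> dist (fst (w k)) (fst z) + dist (snd (w k)) (snd z)"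
            unfolding dist_prod_def by (rule sqrt_sum_squares_le_sum) auto
          also have "\<dots> \<le> 1 / real (Q k) + 1 / 2 ^ Suc k"
            using address_grid_close[OF zU _ w(2)] w(1) KU
            by (intro add_mono) (auto simp: dist_real_def abs_minus_commute)
          finally show "dist (w k) z \<le> 1 / real (Q k) + (1 / 2) * (1 / 2) ^ k"
            by (simp add: power_one_over)
        qed
        have "(\<lambda>k. (1 / 2 :: real) * (1 / 2) ^ k) \<longlonglongrightarrow> 0"
          by (intro tendsto_mult_right_zero LIMSEQ_realpow_zero) auto
        then show "(\<lambda>k. 1 / real (Q k) + (1 / 2) * (1 / 2) ^ k) \<longlonglongrightarrow> 0"
          using tendsto_add[OF Q_tendsto] by fastforce
      qed
      then have "w \<longlonglongrightarrow> z" by (subst tendsto_dist_iff)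
      then show "z \<in> K" by (rule closed_sequentially[OF K(1) w(1)])
    qed
  qed
  have "range E \<subseteq> sets base_measure" using E by blast
  from finite_Lim_measure_decseq[OF this dec]
  have "(\<lambda>k. measure base_measure (E k)) \<longlonglongrightarrow> measure base_measure K" unfolding Int .
  then have "\<forall>\<^sub>F k in sequentially. measure base_measure (E k) < measure base_measure K + \<eta> / 2"
    using \<eta> by (intro order_tendstoD) auto
  then show "\<forall>\<^sub>F k in sequentially. \<exists>\<A>\<subseteq>(\<lambda>i. {z \<in> base_space. address k z = i}) ` {..<q k}.
      measure base_measure (sym_diff A (\<Union>\<A>)) < \<eta>"
  proof (rule eventually_mono)
    fix k assume less: "measure base_measure (E k) < measure base_measure K + \<eta> / 2"
    define \<A> where "\<A> = (\<lambda>i. {z \<in> base_space. address k z = i}) ` (address k ` K)"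
    have U: "\<Union>\<A> = E k" by (auto simp: \<A>_def E_def)
    have "K \<subseteq> E k" using KU by (auto simp: E_def)
    then have EK: "measure base_measure (E k - K) < \<eta> / 2"
      using less finite_measure_Diff[OF E Ks] by simp
    have sets: "A - K \<in> sets base_measure" "E k - K \<in> sets base_measure"
      using A E[of k] Ks by (auto simp: sets_base)
    have "measure base_measure (sym_diff A (\<Union>\<A>)) \<le> measure base_measure ((A - K) \<union> (E k - K))"
      unfolding U using \<open>K \<subseteq> E k\<close> K(2) sets by (intro finite_measure_mono) auto
    also have "\<dots> \<le> measure base_measure (A - K) + measure base_measure (E k - K)"
      using sets by (rule measure_Un_le)
    also have "\<dots> < \<eta>" using EK mAK by simp
    finally have "measure base_measure (sym_diff A (\<Union>\<A>)) < \<eta>" .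
    moreover have "\<A> \<subseteq> (\<lambda>i. {z \<in> base_space. address k z = i}) ` {..<q k}"
      using address_less by (auto simp: \<A>_def)
    ultimately show "\<exists>\<A>\<subseteq>(\<lambda>i. {z \<in> base_space. address k z = i}) ` {..<q k}.
      measure base_measure (sym_diff A (\<Union>\<A>)) < \<eta>" by blast
  qed
qed

lemma card_multiples: "card {t. t < q (Suc k) \<and> g k dvd Suc t} \<le> q (Suc k) div g k"
proof -
  have "{t. t < q (Suc k) \<and> g k dvd Suc t} \<subseteq> (\<lambda>j. g k * j - 1) ` {1..q (Suc k) div g k}"
  proof
    fix t assume t: "t \<in> {t. t < q (Suc k) \<and> g k dvd Suc t}"
    then obtain j where j: "Suc t = g k * j" by (auto elim: dvdE)
    then have "j \<noteq> 0" by (metis mult_0_right nat.distinct(1))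
    moreover have "j * g k \<le> q (Suc k)" using j t by (simp add: mult.commute)
    then have "j \<le> q (Suc k) div g k" using g_pos[of k] by (simp add: less_eq_div_iff_mult_less_eq)
    moreover have "t = g k * j - 1" using j by simp
    ultimately show "t \<in> (\<lambda>j. g k * j - 1) ` {1..q (Suc k) div g k}" by auto
  qed
  then show ?thesis
    using surj_card_le[of "{1..q (Suc k) div g k}"] by simp
qed

lemma base_realization: "tower_realization Q m b c base_measure base_map address"
proof -
  interpret finite_measure base_measure by (rule finite_measure_base)
  have sp: "space base_measure = base_space" by simp
  show ?thesis
  proof (intro tower_realization.intro mpt_space.intro finite_measure_axioms tower_data_axioms
      mpt_space_axioms.intro tower_realization_axioms.intro base_map_mpt, unfold sp)
    show "measure base_measure base_space = 1"
      using emeasure_base[of base_space] emeasure_base_space by (simp add: measure_def)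
  next
    fix k
    show "address k \<in> measurable base_measure (count_space UNIV)"
    proof (rule measurableI)
      fix I :: "nat set"
      have "address k -` I \<inter> space base_measure = {z \<in> base_space. address k z \<in> I}" by auto
      then show "address k -` I \<inter> space base_measure \<in> sets base_measure" using address_fibres(1) by simp
    qed simp
  next
    fix z k assume z: "z \<in> base_space"
    show "address k z < q k" by (rule address_less)
    show "address k z = proj k (address (Suc k) z)" by (rule address_proj[OF base_spaceD(1)[OF z]])
  next
    fix i k assume i: "i < q k"
    then have "{i} \<inter> {..<q k} = {i}" by auto
    then show "measure base_measure {z \<in> base_space. address k z = i} = 1 / q k"
      using address_fibres(2)[of k "{i}"] by simp
  next
    fix k
    \<comment> \<open>By \<open>address_base_map\<close> the step can fail only if the rectangle of
      stage \<open>Suc k\<close> is the last one of a block.\<close>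
    let ?I = "{t. g k dvd Suc t}"
    have "measure base_measure {z \<in> base_space. address k (base_map z) \<noteq> Suc (address k z) mod q k} \<le>
        measure base_measure {z \<in> base_space. address (Suc k) z \<in> ?I}"
    proof (rule finite_measure_mono[OF _ address_fibres(1)])
      show "{z \<in> base_space. address k (base_map z) \<noteq> Suc (address k z) mod q k} \<subseteq>
          {z \<in> base_space. address (Suc k) z \<in> ?I}"
        using address_base_map(2) base_spaceD(1,2) by blast
    qed
    also have "\<dots> = card (?I \<inter> {..<q (Suc k)}) / q (Suc k)" by (rule address_fibres(2))
    also have "?I \<inter> {..<q (Suc k)} = {t. t < q (Suc k) \<and> g k dvd Suc t}" by auto
    also have "card \<dots> / q (Suc k) \<le> (q (Suc k) / g k) / q (Suc k)"
    proof (intro divide_right_mono)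
      show "real (card {t. t < q (Suc k) \<and> g k dvd Suc t}) \<le> q (Suc k) / g k"
        using card_multiples[of k] of_nat_div_le_of_nat[of "q (Suc k)" "g k", where 'a = real]
        by linarith
    qed simp
    also have "\<dots> = 1 / g k" using q_pos[of "Suc k"] by simp
    finally show "measure base_measure {z \<in> base_space. address k (base_map z) \<noteq> Suc (address k z) mod q k} \<le> 1 / g k" .
  qed (rule base_exhaustive)
qed

end

subsection \<open>Embedding into the disc\<close>

definition chord :: "real \<Rightarrow> real" where
  "chord x = sqrt (max 0 (1 - x\<^sup>2))"

text \<open>The area of the disc to the left of \<open>x\<close>. Starting at \<open>-2\<close>
  changes nothing, as \<open>chord\<close> vanishes there, and makes the function differentiable
  from both sides at \<open>-1\<close>.\<close>

definition cap_area :: "real \<Rightarrow> real" where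
  "cap_area x = integral {-2..x} (\<lambda>x. 2 * chord x)"

text \<open>The value \<open>\<pi>\<close> of \<open>disc_area\<close> is not needed.\<close>

definition disc_area :: real where
  "disc_area = cap_area 1"

definition cap_fraction :: "real \<Rightarrow> real" where
  "cap_fraction x = cap_area x / disc_area"

lemma chord_continuous: "continuous_on A chord"
  unfolding chord_def by (intro continuous_intros)

lemma chord_measurable [measurable]: "chord \<in> borel_measurable borel"
  by (rule borel_measurable_continuous_onI[OF chord_continuous])

lemma chord_nonneg: "0 \<le> chord x"
  by (simp add: chord_def)

lemma square_less_one: "-1 < x \<Longrightarrow> x < 1 \<Longrightarrow> x\<^sup>2 < 1" for x :: real
  by (simp add: power2_less_1_iff abs_less_iff)

lemma chord_pos: "-1 < x \<Longrightarrow> x < 1 \<Longrightarrow> 0 < chord x"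
  using square_less_one[of x] by (simp add: chord_def)

lemma chord_zero: "1 \<le> \<bar>x\<bar> \<Longrightarrow> chord x = 0"
  using one_le_power[of "\<bar>x\<bar>" 2] by (simp add: chord_def)

lemma cap_area_deriv:
  assumes "-2 < x" "x < 2"
  shows "(cap_area has_real_derivative 2 * chord x) (at x)"
proof -
  have "((\<lambda>x. integral {-2..x} (\<lambda>x. 2 * chord x)) has_real_derivative 2 * chord x) (at x within {-2..2})"
    using assms by (intro integral_has_real_derivative continuous_intros chord_continuous) auto
  then show ?thesis
    using assms at_within_Icc_at[of "-2" x 2] by (simp add: cap_area_def[abs_def])
qed

lemma cap_area_minus_one: "cap_area (-1) = 0"
proof -
  have "cap_area (-1) = integral {-2..-1} (\<lambda>x :: real. 0 :: real)"
    unfolding cap_area_def by (intro integral_cong) (auto intro!: chord_zero)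
  then show ?thesis by simp
qed

lemma cap_area_strict_mono:
  assumes "-1 \<le> x" "x < y" "y \<le> 1"
  shows "cap_area x < cap_area y"
proof (rule DERIV_pos_imp_increasing_open[OF assms(2)])
  fix z assume "x < z" "z < y"
  then show "\<exists>d. (cap_area has_real_derivative d) (at z) \<and> 0 < d"
    using assms by (intro exI[of _ "2 * chord z"] conjI cap_area_deriv) (auto intro!: chord_pos)
next
  show "continuous_on {x..y} cap_area"
  proof (rule DERIV_continuous_on)
    fix z assume "z \<in> {x..y}"
    then show "(cap_area has_real_derivative 2 * chord z) (at z within {x..y})"
      using assms by (intro has_field_derivative_at_within[OF cap_area_deriv]) auto
  qed
qed

lemma disc_area_pos: "0 < disc_area"
  using cap_area_strict_mono[of "-1" 1] by (simp add: disc_area_def cap_area_minus_one)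

lemma cap_fraction:
  shows cap_fraction_minus_one: "cap_fraction (-1) = 0" and cap_fraction_one: "cap_fraction 1 = 1"
    and cap_fraction_strict_mono: "-1 \<le> x \<Longrightarrow> x < y \<Longrightarrow> y \<le> 1 \<Longrightarrow> cap_fraction x < cap_fraction y"
    and cap_fraction_deriv: "-2 < x \<Longrightarrow> x < 2 \<Longrightarrow> (cap_fraction has_real_derivative 2 * chord x / disc_area) (at x)"
proof -
  show "cap_fraction (-1) = 0" by (simp add: cap_fraction_def cap_area_minus_one)
  show "cap_fraction 1 = 1" using disc_area_pos by (simp add: cap_fraction_def disc_area_def)
  show "-1 \<le> x \<Longrightarrow> x < y \<Longrightarrow> y \<le> 1 \<Longrightarrow> cap_fraction x < cap_fraction y"
    unfolding cap_fraction_def by (intro divide_strict_right_mono cap_area_strict_mono disc_area_pos)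
  show "-2 < x \<Longrightarrow> x < 2 \<Longrightarrow> (cap_fraction has_real_derivative 2 * chord x / disc_area) (at x)"
    unfolding cap_fraction_def[abs_def] by (intro DERIV_cdivide cap_area_deriv)
qed

lemma cap_fraction_continuous: "continuous_on {-1..1} cap_fraction"
proof (rule DERIV_continuous_on)
  fix z :: real assume "z \<in> {-1..1}"
  then show "(cap_fraction has_real_derivative 2 * chord z / disc_area) (at z within {-1..1})"
    by (intro has_field_derivative_at_within[OF cap_fraction_deriv]) auto
qed

text \<open>\<open>cap_fraction\<close> is the distribution function of the horizontal coordinate on
  the disc, with density \<open>2 * chord x / disc_area\<close>; the claim is the substitution
  \<open>s = cap_fraction x\<close>.\<close>

lemma cap_substitution:
  fixes h :: "real \<Rightarrow> ennreal"
  assumes [measurable]: "h \<in> borel_measurable borel"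
  shows "(\<integral>\<^sup>+x. h (cap_fraction x) * ennreal (2 * chord x) * indicator {-1..1} x \<partial>lborel) =
    ennreal disc_area * (\<integral>\<^sup>+x. h x * indicator {0..1} x \<partial>lborel)"
proof -
  have "(\<integral>\<^sup>+x. h x * indicator {cap_fraction (-1)..cap_fraction 1} x \<partial>lborel) =
      (\<integral>\<^sup>+x. h (cap_fraction x) * ennreal (2 * chord x / disc_area) * indicator {-1..1} x \<partial>lborel)"
  proof (rule nn_integral_substitution_aux)
    show "continuous_on {-1..1} (\<lambda>x. 2 * chord x / disc_area)"
      using disc_area_pos by (intro continuous_intros chord_continuous) auto
    fix x :: real assume "x \<in> {-1..1}"
    then show "(cap_fraction has_real_derivative 2 * chord x / disc_area) (at x)"
      by (intro cap_fraction_deriv) auto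
    show "0 \<le> 2 * chord x / disc_area" using disc_area_pos chord_nonneg[of x] by simp
  qed auto
  then have "ennreal disc_area * (\<integral>\<^sup>+x. h x * indicator {0..1} x \<partial>lborel) =
      ennreal disc_area * (\<integral>\<^sup>+x. h (cap_fraction x) * ennreal (2 * chord x / disc_area) * indicator {-1..1} x \<partial>lborel)"
    by (simp add: cap_fraction_minus_one cap_fraction_one)
  also have "\<dots> = (\<integral>\<^sup>+x. ennreal disc_area * (h (cap_fraction x) * ennreal (2 * chord x / disc_area) * indicator {-1..1} x) \<partial>lborel)"
  proof (rule nn_integral_cmult[symmetric])
    \<comment> \<open>Continuity of \<open>cap_fraction\<close> is established on
      \<open>[-1,1]\<close>, so it is cut off there to obtain a Borel function; the outer indicator
      hides the change.\<close>
    have "(\<lambda>x. h (cap_fraction x * indicator {-1..1} x) * ennreal (2 * chord x / disc_area) * indicator {-1..1} x) \<in> borel_measurable lborel"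
    proof -
      have "(\<lambda>x. indicator {-1..1} x *\<^sub>R cap_fraction x) \<in> borel_measurable borel"
        by (rule borel_measurable_continuous_on_indicator[OF _ cap_fraction_continuous]) simp
      then have [measurable]: "(\<lambda>x. cap_fraction x * indicator {-1..1} x) \<in> borel_measurable borel"
        by (simp add: mult.commute)
      show ?thesis by measurable
    qed
    also have "(\<lambda>x. h (cap_fraction x * indicator {-1..1} x) * ennreal (2 * chord x / disc_area) * indicator {-1..1} x) =
        (\<lambda>x. h (cap_fraction x) * ennreal (2 * chord x / disc_area) * indicator {-1..1} x)"
      by (auto simp: indicator_def)
    finally show "(\<lambda>x. h (cap_fraction x) * ennreal (2 * chord x / disc_area) * indicator {-1..1} x) \<in> borel_measurable lborel" .
  qed
  also have "\<dots> = (\<integral>\<^sup>+x. h (cap_fraction x) * ennreal (2 * chord x) * indicator {-1..1} x \<partial>lborel)"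
  proof (rule nn_integral_cong)
    fix x :: real
    have "ennreal disc_area * ennreal (2 * chord x / disc_area) = ennreal (2 * chord x)"
      using disc_area_pos chord_nonneg[of x] by (simp add: ennreal_mult[symmetric])
    then show "ennreal disc_area * (h (cap_fraction x) * ennreal (2 * chord x / disc_area) * indicator {-1..1} x) =
        h (cap_fraction x) * ennreal (2 * chord x) * indicator {-1..1} x"
      by (metis mult.assoc mult.left_commute)
  qed
  finally show ?thesis by simp
qed

lemma sets_lborel_prod: "sets (lborel \<Otimes>\<^sub>M lborel) = (sets borel :: (real \<times> real) set set)"
  unfolding lborel_prod by (rule sets_lborel)

lemma disc_iff: "(x, y) \<in> disc_domain \<longleftrightarrow> x\<^sup>2 + y\<^sup>2 \<le> 1"
  by (simp add: disc_domain_def norm_Pair)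

lemma emeasure_disc: "emeasure lborel disc_domain = ennreal disc_area"
proof -
  have "closed disc_domain" by (simp add: disc_domain_def)
  then have cl: "disc_domain \<in> sets (lborel \<Otimes>\<^sub>M lborel)"
    unfolding sets_lborel_prod by (rule borel_closed)
  have "emeasure lborel disc_domain = emeasure (lborel \<Otimes>\<^sub>M lborel) disc_domain"
    unfolding lborel_prod ..
  also have "\<dots> = (\<integral>\<^sup>+x. emeasure lborel (Pair x -` disc_domain) \<partial>lborel)"
    by (rule lborel.emeasure_pair_measure_alt[OF cl])
  also have "\<dots> = (\<integral>\<^sup>+x. 1 * ennreal (2 * chord x) * indicator {-1..1} x \<partial>lborel)"
  proof (rule nn_integral_cong)
    fix x :: real
    show "emeasure lborel (Pair x -` disc_domain) = 1 * ennreal (2 * chord x) * indicator {-1..1} x"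
    proof (cases "x \<in> {-1..1}")
      case True
      then have "x\<^sup>2 \<le> 1" using abs_square_le_1[of x] by (simp add: abs_le_iff)
      then have ch: "chord x = sqrt (1 - x\<^sup>2)" by (simp add: chord_def)
      have "x\<^sup>2 + y\<^sup>2 \<le> 1 \<longleftrightarrow> \<bar>y\<bar> \<le> chord x" for y
        unfolding ch using real_sqrt_le_iff[of "y\<^sup>2" "1 - x\<^sup>2"] real_sqrt_abs[of y] by linarith
      then have "Pair x -` disc_domain = {- chord x..chord x}"
        by (auto simp: disc_iff abs_le_iff)
      then show ?thesis using True chord_nonneg[of x] by simp
    next
      case False
      then have "1 < \<bar>x\<bar>" by auto
      then have "1 < x\<^sup>2" using one_less_power[of "\<bar>x\<bar>" 2] by simp
      then have "\<not> x\<^sup>2 + y\<^sup>2 \<le> 1" for y using zero_le_power2[of y] by linarith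
      then have "Pair x -` disc_domain = {}" by (auto simp: disc_iff)
      then show ?thesis using False by simp
    qed
  qed
  also have "\<dots> = ennreal disc_area * (\<integral>\<^sup>+x. 1 * indicator {0..1} x \<partial>(lborel :: real measure))"
    by (rule cap_substitution) simp
  finally show ?thesis by simp
qed

section \<open>The map from the strip to the disc\<close>

definition cap_inverse :: "real \<Rightarrow> real" where
  "cap_inverse s = Sup (insert (-1) {x \<in> {-1..1}. cap_fraction x \<le> s})"

text \<open>This quantile function is monotone on the whole line, since the inserted
  \<open>-1\<close> keeps the set under \<open>Sup\<close> nonempty; monotone functions are
  Borel.\<close>

lemma cap_inverse_measurable [measurable]: "cap_inverse \<in> borel_measurable borel"
proof (rule borel_measurable_mono, rule monoI)
  fix s t :: real assume "s \<le> t"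
  then show "cap_inverse s \<le> cap_inverse t"
    unfolding cap_inverse_def by (intro cSup_subset_mono) (auto intro!: bdd_aboveI[of _ 1])
qed

lemma cap_inverse_cap_fraction:
  assumes "-1 < x" "x < 1"
  shows "cap_inverse (cap_fraction x) = x"
proof -
  have "insert (-1) {y \<in> {-1..1}. cap_fraction y \<le> cap_fraction x} = {-1..x}"
  proof (intro set_eqI iffI)
    fix y assume y: "y \<in> insert (-1) {y \<in> {-1..1}. cap_fraction y \<le> cap_fraction x}"
    show "y \<in> {-1..x}"
    proof (rule ccontr)
      assume "y \<notin> {-1..x}"
      then have "x < y" "y \<le> 1" "cap_fraction y \<le> cap_fraction x" using y assms by auto
      then show False using cap_fraction_strict_mono[of x y] assms by linarith
    qed
  next
    fix y assume "y \<in> {-1..x}"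
    moreover from this have "cap_fraction y \<le> cap_fraction x"
      using cap_fraction_strict_mono[of y x] assms by (cases "y = x") auto
    ultimately show "y \<in> insert (-1) {y \<in> {-1..1}. cap_fraction y \<le> cap_fraction x}"
      using assms by auto
  qed
  then show ?thesis using assms by (simp add: cap_inverse_def)
qed

lemma cap_inverse:
  assumes "0 < s" "s < 1"
  shows "-1 < cap_inverse s" "cap_inverse s < 1" "cap_fraction (cap_inverse s) = s"
proof -
  have "\<exists>x. -1 \<le> x \<and> x \<le> 1 \<and> cap_fraction x = s"
    using assms cap_fraction_continuous
    by (intro IVT') (auto simp: cap_fraction_minus_one cap_fraction_one)
  then obtain x where x: "-1 \<le> x" "x \<le> 1" "cap_fraction x = s" by blast
  have "x \<noteq> -1" "x \<noteq> 1" using x(3) assms cap_fraction_minus_one cap_fraction_one by auto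
  then have x': "-1 < x" "x < 1" using x by auto
  then show "-1 < cap_inverse s" "cap_inverse s < 1" "cap_fraction (cap_inverse s) = s"
    using cap_inverse_cap_fraction[OF x'] x(3) by auto
qed

text \<open>A Knothe-Rosenblatt map: the quantile function horizontally, then an affine map onto the
  vertical chord. The stretching factors \<open>disc_area / (2 * chord x)\<close> and
  \<open>2 * chord x\<close> have the constant product \<open>disc_area\<close>.\<close>

definition disc_map :: "real \<times> real \<Rightarrow> real \<times> real" where
  "disc_map z = (cap_inverse (fst z), (2 * snd z - 1) * chord (cap_inverse (fst z)))"

text \<open>The image under \<open>disc_map\<close> for subsets of \<open>strip\<close>, written
  through the inverse map so that Borel measurability and vertical sections can be read off.\<close>

definition disc_preimage :: "(real \<times> real) set \<Rightarrow> (real \<times> real) set" where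
  "disc_preimage A = {z. fst z \<in> {-1<..<1} \<and> (cap_fraction (fst z), (snd z / chord (fst z) + 1) / 2) \<in> A}"

abbreviation strip :: "(real \<times> real) set" where
  "strip \<equiv> {0<..<1} \<times> {0..<1}"

lemma disc_map_inverse:
  assumes "z \<in> strip"
  shows "fst (disc_map z) \<in> {-1<..<1}"
    "(cap_fraction (fst (disc_map z)), (snd (disc_map z) / chord (fst (disc_map z)) + 1) / 2) = z"
proof -
  have s: "0 < fst z" "fst z < 1" using assms by auto
  show "fst (disc_map z) \<in> {-1<..<1}" using cap_inverse[OF s] by (simp add: disc_map_def)
  have "0 < chord (cap_inverse (fst z))" using cap_inverse[OF s] by (intro chord_pos)
  then show "(cap_fraction (fst (disc_map z)), (snd (disc_map z) / chord (fst (disc_map z)) + 1) / 2) = z"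
    using cap_inverse[OF s] by (simp add: disc_map_def prod_eq_iff)
qed

lemma disc_map_inj: "inj_on disc_map strip"
  by (rule inj_onI) (metis disc_map_inverse(2))

lemma disc_map_image:
  assumes "A \<subseteq> strip"
  shows "disc_map ` A = disc_preimage A"
proof (intro set_eqI iffI)
  fix z assume "z \<in> disc_map ` A"
  then obtain w where "w \<in> A" "z = disc_map w" by blast
  then show "z \<in> disc_preimage A"
    using disc_map_inverse[of w] assms by (auto simp: disc_preimage_def)
next
  fix z assume "z \<in> disc_preimage A"
  then have z: "-1 < fst z" "fst z < 1" "(cap_fraction (fst z), (snd z / chord (fst z) + 1) / 2) \<in> A"
    by (auto simp: disc_preimage_def)
  have "disc_map (cap_fraction (fst z), (snd z / chord (fst z) + 1) / 2) = z"
  proof -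
    have "(2 * ((y / r + 1) / 2) - 1) * r = y" if "0 < r" for y r :: real
      using that by (simp add: field_simps)
    from this[OF chord_pos[OF z(1,2)]] show ?thesis
      by (simp only: disc_map_def prod_eq_iff fst_conv snd_conv cap_inverse_cap_fraction[OF z(1,2)])
  qed
  then show "z \<in> disc_map ` A" using z(3) by (metis image_eqI)
qed

lemma disc_map_in_disc: "z \<in> strip \<Longrightarrow> disc_map z \<in> disc_domain"
proof -
  assume z: "z \<in> strip"
  have s: "0 < fst z" "fst z < 1" using z by auto
  define x where "x = cap_inverse (fst z)"
  have x: "-1 < x" "x < 1" using cap_inverse[OF s] by (simp_all add: x_def)
  have "(2 * snd z - 1)\<^sup>2 \<le> 1" using z abs_square_le_1[of "2 * snd z - 1"] by (auto simp: abs_le_iff)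
  then have "(2 * snd z - 1)\<^sup>2 * (chord x)\<^sup>2 \<le> 1 * (chord x)\<^sup>2" by (intro mult_right_mono) auto
  moreover have "(chord x)\<^sup>2 = 1 - x\<^sup>2" using square_less_one[OF x] by (simp add: chord_def)
  ultimately show ?thesis
    using disc_iff[of x "(2 * snd z - 1) * chord x"] by (simp add: disc_map_def x_def power_mult_distrib)
qed

lemma disc_map_measurable: "disc_map \<in> borel_measurable borel"
  unfolding disc_map_def borel_prod[symmetric] by measurable

lemma disc_preimage_borel:
  assumes "A \<in> sets borel"
  shows "disc_preimage A \<in> sets borel"
proof -
  have "(\<lambda>x. indicator {-1..1} x *\<^sub>R cap_fraction x) \<in> borel_measurable borel"
    by (rule borel_measurable_continuous_on_indicator[OF _ cap_fraction_continuous]) simp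
  then have [measurable]: "(\<lambda>x. indicator {-1..1} x * cap_fraction x) \<in> borel_measurable borel" by simp
  define f where "f z = (indicator {-1..1} (fst z) * cap_fraction (fst z), (snd z / chord (fst z) + 1) / 2)" for z
  have f: "f \<in> borel_measurable borel"
    unfolding f_def borel_prod[symmetric] by measurable
  have "disc_preimage A = ({-1<..<1} \<times> UNIV) \<inter> (f -` A \<inter> space borel)"
    by (auto simp: disc_preimage_def f_def indicator_def)
  moreover have "{-1<..<1 :: real} \<times> (UNIV :: real set) \<in> sets borel" by (rule borel_Times) auto
  ultimately show ?thesis using measurable_sets[OF f assms] by simp
qed

text \<open>Fubini: the section over \<open>x\<close> is an affine copy, with ratio
  \<open>2 * chord x\<close>, of the section of \<open>A\<close> over \<open>cap_fraction x\<close>,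
  and \<open>cap_substitution\<close> absorbs this ratio.\<close>

lemma emeasure_disc_preimage:
  assumes A: "A \<in> sets borel" "A \<subseteq> strip"
  shows "emeasure lborel (disc_preimage A) = ennreal disc_area * emeasure lborel A"
proof -
  define h where "h s = emeasure lborel (Pair s -` A)" for s
  have A': "A \<in> sets (lborel \<Otimes>\<^sub>M lborel)" using A(1) unfolding sets_lborel_prod .
  have h: "h \<in> borel_measurable borel"
    using lborel.measurable_emeasure_Pair[OF A'] by (simp add: h_def[abs_def])
  have S: "Pair s -` A \<in> sets borel" for s
    using sets_Pair1[OF A'] by simp
  have "emeasure lborel (disc_preimage A) = emeasure (lborel \<Otimes>\<^sub>M lborel) (disc_preimage A)"
    unfolding lborel_prod ..
  also have "\<dots> = (\<integral>\<^sup>+x. emeasure lborel (Pair x -` disc_preimage A) \<partial>lborel)"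
    using disc_preimage_borel[OF A(1)] unfolding sets_lborel_prod[symmetric]
    by (rule lborel.emeasure_pair_measure_alt)
  also have "\<dots> = (\<integral>\<^sup>+x. h (cap_fraction x) * ennreal (2 * chord x) * indicator {-1..1} x \<partial>lborel)"
  proof (rule nn_integral_cong)
    fix x :: real
    show "emeasure lborel (Pair x -` disc_preimage A) = h (cap_fraction x) * ennreal (2 * chord x) * indicator {-1..1} x"
    proof (cases "x \<in> {-1<..<1}")
      case True
      then have c: "0 < chord x" by (intro chord_pos) auto
      have "Pair x -` disc_preimage A = (\<lambda>t. (2 * chord x) *\<^sub>R t + (- chord x)) ` (Pair (cap_fraction x) -` A)"
      proof (intro set_eqI iffI)
        fix y assume "y \<in> Pair x -` disc_preimage A"
        then have "(y / chord x + 1) / 2 \<in> Pair (cap_fraction x) -` A" by (simp add: disc_preimage_def)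
        moreover have "y = (2 * chord x) *\<^sub>R ((y / chord x + 1) / 2) + (- chord x)" using c by (simp add: field_simps)
        ultimately show "y \<in> (\<lambda>t. (2 * chord x) *\<^sub>R t + (- chord x)) ` (Pair (cap_fraction x) -` A)" by (rule image_eqI[rotated])
      next
        fix y assume "y \<in> (\<lambda>t. (2 * chord x) *\<^sub>R t + (- chord x)) ` (Pair (cap_fraction x) -` A)"
        then obtain t where t: "(cap_fraction x, t) \<in> A" "y = 2 * chord x * t - chord x" by auto
        then have "(y / chord x + 1) / 2 = t" using c by (simp add: field_simps)
        then show "y \<in> Pair x -` disc_preimage A" using t True by (simp add: disc_preimage_def)
      qed
      then have "emeasure lebesgue (Pair x -` disc_preimage A) = ennreal (2 * chord x) * emeasure lebesgue (Pair (cap_fraction x) -` A)"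
        using emeasure_lebesgue_affine[of "2 * chord x" "- chord x" "Pair (cap_fraction x) -` A"] c by simp
      moreover have "Pair x -` disc_preimage A \<in> sets borel"
        using sets_Pair1[of "disc_preimage A" lborel lborel x] disc_preimage_borel[OF A(1)]
        unfolding sets_lborel_prod sets_lborel .
      ultimately have "emeasure lborel (Pair x -` disc_preimage A) = ennreal (2 * chord x) * h (cap_fraction x)"
        using S[of "cap_fraction x"] by (simp add: h_def)
      then show ?thesis using True by (simp add: mult.commute)
    next
      case False
      then have "Pair x -` disc_preimage A = {}" by (auto simp: disc_preimage_def)
      moreover have "chord x = 0 \<or> x \<notin> {-1..1}" using False chord_zero[of x] by auto
      ultimately show ?thesis by auto
    qed
  qed
  also have "\<dots> = ennreal disc_area * (\<integral>\<^sup>+s. h s * indicator {0..1} s \<partial>lborel)"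
    by (rule cap_substitution[OF h])
  also have "(\<integral>\<^sup>+s. h s * indicator {0..1} s \<partial>lborel) = (\<integral>\<^sup>+s. h s \<partial>lborel)"
  proof (rule nn_integral_cong)
    fix s :: real
    show "h s * indicator {0..1} s = h s"
    proof (cases "s \<in> {0..1}")
      case False
      then have "Pair s -` A = {}" using A(2) by auto
      then show ?thesis by (simp add: h_def)
    qed simp
  qed
  also have "\<dots> = emeasure (lborel \<Otimes>\<^sub>M lborel) A"
    unfolding h_def by (rule lborel.emeasure_pair_measure_alt[OF A', symmetric])
  finally show ?thesis by (simp add: lborel_prod)
qed

lemma strip_borel: "strip \<in> sets borel"
  by (rule borel_Times) auto

text \<open>The Borel part is covered by \<open>emeasure_disc_preimage\<close>. The remaining part
  lies in a Borel null set within \<open>strip\<close>, whose image is null by the same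
  formula.\<close>

lemma disc_map_lebesgue:
  assumes A: "A \<in> sets lebesgue" "A \<subseteq> strip"
  shows "disc_map ` A \<in> sets lebesgue"
    "emeasure lebesgue (disc_map ` A) = ennreal disc_area * emeasure lebesgue A"
proof -
  obtain S N N' where A_eq: "A = S \<union> N" and N: "N \<subseteq> N'" and N': "N' \<in> null_sets lborel" and S: "S \<in> sets lborel"
    using A(1) by (rule sets_completionE)
  define B where "B = N' \<inter> strip"
  have B: "B \<in> sets borel" "B \<subseteq> strip" using N' strip_borel by (auto simp: B_def)
  have "emeasure lborel B \<le> emeasure lborel N'" using N' by (intro emeasure_mono) (auto simp: B_def)
  then have "emeasure lborel B = 0" using N' by (simp add: null_sets_def)
  then have "emeasure lborel (disc_preimage B) = 0" using emeasure_disc_preimage[OF B] by simp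
  then have null: "disc_preimage B \<in> null_sets lborel"
    using disc_preimage_borel[OF B(1)] by (simp add: null_sets_def)
  have "N \<subseteq> B" using N A_eq A(2) by (auto simp: B_def)
  then have "disc_map ` N \<subseteq> disc_preimage B" using disc_map_image[OF B(2)] by blast
  then have imN: "disc_map ` N \<in> null_sets lebesgue"
    using null null_sets_completionI null_sets_completion_subset by blast
  have SA: "S \<in> sets borel" "S \<subseteq> strip" using S A_eq A(2) by auto
  have imS: "disc_map ` S = disc_preimage S" by (rule disc_map_image[OF SA(2)])
  have imS_sets: "disc_map ` S \<in> sets lborel" unfolding imS using disc_preimage_borel[OF SA(1)] by simp
  have im: "disc_map ` A = disc_map ` S \<union> disc_map ` N" by (simp add: A_eq image_Un)
  show "disc_map ` A \<in> sets lebesgue" unfolding im using imS_sets imN by auto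
  have "emeasure lebesgue (disc_map ` A) = emeasure lebesgue (disc_map ` S)"
    unfolding im using imS_sets imN by (intro emeasure_Un_null_set) auto
  also have "\<dots> = emeasure lborel (disc_preimage S)" using imS_sets by (simp add: imS)
  also have "\<dots> = ennreal disc_area * emeasure lborel S" by (rule emeasure_disc_preimage[OF SA])
  also have "emeasure lborel S = emeasure lebesgue (S \<union> N)"
  proof -
    have "N \<in> null_sets lebesgue" using N N' null_sets_completionI null_sets_completion_subset by blast
    then have "emeasure lebesgue (S \<union> N) = emeasure lebesgue S" using S by (intro emeasure_Un_null_set) auto
    then show ?thesis using S by simp
  qed
  finally show "emeasure lebesgue (disc_map ` A) = ennreal disc_area * emeasure lebesgue A"
    by (simp add: A_eq)
qed

text \<open>The preimage \<open>B\<close> of a Borel null set has its image inside that null set; as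
  areas are multiplied by \<open>disc_area > 0\<close>, \<open>B\<close> is null as well.\<close>

lemma disc_map_vimage_lebesgue:
  assumes "A \<in> sets lebesgue"
  shows "{z \<in> strip. disc_map z \<in> A} \<in> sets lebesgue"
proof -
  obtain S N N' where A_eq: "A = S \<union> N" and N: "N \<subseteq> N'" and N': "N' \<in> null_sets lborel" and S: "S \<in> sets lborel"
    using assms by (rule sets_completionE)
  have pre: "{z \<in> strip. disc_map z \<in> D} \<in> sets borel" if "D \<in> sets borel" for D
  proof -
    have "{z \<in> strip. disc_map z \<in> D} = strip \<inter> (disc_map -` D \<inter> space borel)" by auto
    then show ?thesis using measurable_sets[OF disc_map_measurable that] strip_borel by auto
  qed
  define B where "B = {z \<in> strip. disc_map z \<in> N'}"
  have B: "B \<in> sets borel" "B \<subseteq> strip" using N' pre[of N'] by (auto simp: B_def null_sets_def)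
  have "disc_preimage B \<subseteq> N'" unfolding disc_map_image[OF B(2), symmetric] by (auto simp: B_def)
  then have "emeasure lborel (disc_preimage B) \<le> emeasure lborel N'" using N' by (intro emeasure_mono) auto
  then have "ennreal disc_area * emeasure lborel B = 0"
    unfolding emeasure_disc_preimage[OF B] using N' by (simp add: null_sets_def)
  then have "B \<in> null_sets lborel" using disc_area_pos B(1) by (simp add: null_sets_def)
  moreover have "{z \<in> strip. disc_map z \<in> N} \<subseteq> B" using N by (auto simp: B_def)
  ultimately have "{z \<in> strip. disc_map z \<in> N} \<in> null_sets lebesgue"
    using null_sets_completionI null_sets_completion_subset by blast
  moreover have "{z \<in> strip. disc_map z \<in> A} = {z \<in> strip. disc_map z \<in> S} \<union> {z \<in> strip. disc_map z \<in> N}"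
    by (auto simp: A_eq)
  moreover have "{z \<in> strip. disc_map z \<in> S} \<in> sets lebesgue"
    using pre S by (intro sets_completionI_sets) simp
  ultimately show ?thesis by auto
qed

section \<open>Embeddings into the normalized torus, disc and annulus\<close>

lemma embedding_normalized_lebesgue:
  fixes X U :: "'a::euclidean_space set"
  assumes X: "X \<in> sets lebesgue" "emeasure lebesgue X = ennreal \<kappa>" "0 < \<kappa>"
    and U: "U \<in> sets lebesgue"
    and inj: "inj_on \<psi> U" and maps: "\<psi> ` U \<subseteq> X"
    and image: "\<And>A. A \<in> sets lebesgue \<Longrightarrow> A \<subseteq> U \<Longrightarrow> \<psi> ` A \<in> sets lebesgue"
    and emeasure_image: "\<And>A. A \<in> sets lebesgue \<Longrightarrow> A \<subseteq> U \<Longrightarrow>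
      emeasure lebesgue (\<psi> ` A) = ennreal \<kappa> * emeasure lebesgue A"
    and vimage: "\<And>A. A \<in> sets lebesgue \<Longrightarrow> {z \<in> U. \<psi> z \<in> A} \<in> sets lebesgue"
  shows "finite_measure (normalized_lebesgue X)"
    "measure (normalized_lebesgue X) (space (normalized_lebesgue X)) = 1"
    "\<psi> \<in> measurable (lebesgue_on U) (normalized_lebesgue X)"
    "\<And>A. A \<in> sets (lebesgue_on U) \<Longrightarrow> \<psi> ` A \<in> sets (normalized_lebesgue X)"
    "\<And>A. A \<in> sets (lebesgue_on U) \<Longrightarrow> emeasure (normalized_lebesgue X) (\<psi> ` A) = emeasure (lebesgue_on U) A"
proof -
  have sets_X: "A \<in> sets (normalized_lebesgue X) \<longleftrightarrow> A \<in> sets lebesgue \<and> A \<subseteq> X" for A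
    using X by (auto simp: normalized_lebesgue_def sets_restrict_space_iff)
  have sets_U: "A \<in> sets (lebesgue_on U) \<longleftrightarrow> A \<in> sets lebesgue \<and> A \<subseteq> U" for A
    using U by (auto simp: sets_restrict_space_iff)
  have space_X: "space (normalized_lebesgue X) = X" by (simp add: normalized_lebesgue_def)
  have em: "emeasure (normalized_lebesgue X) A = emeasure lebesgue A / ennreal \<kappa>"
    if "A \<in> sets lebesgue" "A \<subseteq> X" for A
  proof -
    have "emeasure (normalized_lebesgue X) A = emeasure (lebesgue_on X) (X \<inter> A) / emeasure (lebesgue_on X) X"
      unfolding normalized_lebesgue_def using X that
      by (intro emeasure_uniform_measure) (auto simp: sets_restrict_space_iff)
    also have "X \<inter> A = A" using that by auto
    finally show ?thesis using X that by (simp add: emeasure_restrict_space)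
  qed
  have one: "ennreal \<kappa> / ennreal \<kappa> = 1" using X(3) by (simp add: divide_ennreal)
  have tot: "emeasure (normalized_lebesgue X) X = 1" using em[of X] X one by simp
  show "finite_measure (normalized_lebesgue X)" by (rule finite_measureI) (simp add: space_X tot)
  show "measure (normalized_lebesgue X) (space (normalized_lebesgue X)) = 1"
    by (simp add: space_X measure_def tot)
  show "\<psi> \<in> measurable (lebesgue_on U) (normalized_lebesgue X)"
  proof (rule measurableI)
    fix x assume "x \<in> space (lebesgue_on U)"
    then show "\<psi> x \<in> space (normalized_lebesgue X)" using maps by (auto simp: space_X)
  next
    fix A assume "A \<in> sets (normalized_lebesgue X)"
    then have "A \<in> sets lebesgue" by (simp add: sets_X)
    moreover have "\<psi> -` A \<inter> space (lebesgue_on U) = {z \<in> U. \<psi> z \<in> A}" by auto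
    ultimately show "\<psi> -` A \<inter> space (lebesgue_on U) \<in> sets (lebesgue_on U)"
      using vimage by (auto simp: sets_U)
  qed
  fix A assume "A \<in> sets (lebesgue_on U)"
  then have A: "A \<in> sets lebesgue" "A \<subseteq> U" by (auto simp: sets_U)
  have im: "\<psi> ` A \<in> sets lebesgue" "\<psi> ` A \<subseteq> X" using image[OF A] maps A(2) by auto
  show "\<psi> ` A \<in> sets (normalized_lebesgue X)" using im by (simp add: sets_X)
  have "emeasure (normalized_lebesgue X) (\<psi> ` A) = ennreal \<kappa> * emeasure lebesgue A / ennreal \<kappa>"
    by (simp add: em[OF im] emeasure_image[OF A])
  also have "\<dots> = (ennreal \<kappa> / ennreal \<kappa>) * emeasure lebesgue A"
    by (simp add: divide_ennreal_def mult.commute mult.left_commute)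
  also have "\<dots> = emeasure (lebesgue_on U) A" using A U one by (simp add: emeasure_restrict_space)
  finally show "emeasure (normalized_lebesgue X) (\<psi> ` A) = emeasure (lebesgue_on U) A" .
qed

lemma ex_embedding:
  fixes X U :: "(real \<times> real) set"
  assumes X: "X \<in> {torus_domain, disc_domain, annulus_domain}"
    and U: "U \<in> sets lebesgue" "U \<subseteq> strip"
  obtains \<psi> where "finite_measure (normalized_lebesgue X)"
    "measure (normalized_lebesgue X) (space (normalized_lebesgue X)) = 1"
    "inj_on \<psi> U" "\<psi> \<in> measurable (lebesgue_on U) (normalized_lebesgue X)"
    "\<And>A. A \<in> sets (lebesgue_on U) \<Longrightarrow> \<psi> ` A \<in> sets (normalized_lebesgue X)"
    "\<And>A. A \<in> sets (lebesgue_on U) \<Longrightarrow> emeasure (normalized_lebesgue X) (\<psi> ` A) = emeasure (lebesgue_on U) A"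
proof (cases "X = disc_domain")
  case True
  have cl: "closed disc_domain" by (simp add: disc_domain_def)
  have X': "X \<in> sets lebesgue" "emeasure lebesgue X = ennreal disc_area"
    using cl emeasure_disc by (simp_all add: True)
  have inj: "inj_on disc_map U" using disc_map_inj U(2) by (rule inj_on_subset)
  have maps: "disc_map ` U \<subseteq> X" using disc_map_in_disc U(2) True by blast
  have vimage: "{z \<in> U. disc_map z \<in> A} \<in> sets lebesgue" if "A \<in> sets lebesgue" for A
  proof -
    have "{z \<in> U. disc_map z \<in> A} = U \<inter> {z \<in> strip. disc_map z \<in> A}" using U(2) by auto
    then show ?thesis using disc_map_vimage_lebesgue[OF that] U(1) by auto
  qed
  have im: "disc_map ` A \<in> sets lebesgue"
      "emeasure lebesgue (disc_map ` A) = ennreal disc_area * emeasure lebesgue A"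
    if "A \<in> sets lebesgue" "A \<subseteq> U" for A
    using disc_map_lebesgue[OF that(1) subset_trans[OF that(2) U(2)]] .
  note E = embedding_normalized_lebesgue[OF X' disc_area_pos U(1) inj maps im vimage]
  show ?thesis by (rule that[OF E(1,2) inj E(3-5)])
next
  case False
  then have "X = torus_domain \<or> X = annulus_domain" using X by blast
  then have "X \<in> sets lebesgue \<and> emeasure lebesgue X = ennreal 1"
  proof
    assume "X = torus_domain"
    then show ?thesis using rectangle_lborel(2,4)[of 0 1 0 1] by (simp add: torus_domain_def)
  next
    assume X: "X = annulus_domain"
    have b: "annulus_domain \<in> sets borel" unfolding annulus_domain_def by (rule borel_Times) auto
    have "emeasure lborel annulus_domain = emeasure (lborel \<Otimes>\<^sub>M lborel) ({0..<1 :: real} \<times> {0..1 :: real})"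
      by (simp add: lborel_prod annulus_domain_def)
    also have "\<dots> = emeasure lborel {0..<1 :: real} * emeasure lborel {0..1 :: real}"
      by (rule lborel.emeasure_pair_measure_Times) auto
    finally show ?thesis using X b by simp
  qed
  then have X': "X \<in> sets lebesgue" "emeasure lebesgue X = ennreal 1" by blast+
  have maps: "(\<lambda>z. z) ` U \<subseteq> X"
    using U(2) \<open>X = torus_domain \<or> X = annulus_domain\<close> by (auto simp: torus_domain_def annulus_domain_def)
  have inj: "inj_on (\<lambda>z. z) U" by simp
  have vimage: "{z \<in> U. z \<in> A} \<in> sets lebesgue" if "A \<in> sets lebesgue" for A
    using sets.Int[OF U(1) that] by (simp add: Int_def)
  show ?thesis
    by (rule that[OF embedding_normalized_lebesgue(1,2)[OF X' zero_less_one U(1) inj maps _ _ vimage] inj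
        embedding_normalized_lebesgue(3-5)[OF X' zero_less_one U(1) inj maps _ _ vimage]]) auto
qed

subsection \<open>Choice of the parameters\<close>

lemma eventually_powr_dominates:
  fixes A \<epsilon> :: real
  assumes "0 < \<epsilon>"
  shows "\<forall>\<^sub>F n in sequentially. A * real n \<le> 2 powr (\<epsilon> * real n)"
  using assms by real_asymp

text \<open>All large \<open>\<rho>\<close> qualify, because the exponential wins over the linear
  term. Only \<open>v k\<close> and \<open>Q k\<close> enter, so \<open>Q (Suc k)\<close> can be
  computed from the choice, as in \<open>widths\<close>.\<close>

definition choose_\<rho> :: "(nat \<Rightarrow> real) \<Rightarrow> nat \<Rightarrow> nat \<Rightarrow> nat" where
  "choose_\<rho> v k Qk = (SOME \<rho>. 32 * real \<rho> * (2 ^ Suc k * real Qk) * 2 ^ Suc k \<le> 2 powr (\<rho> / Suc k) \<and>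
     real (Suc k) * v k \<le> real \<rho> \<and> Suc k \<le> \<rho>)"

lemma choose_\<rho>:
  "32 * real (choose_\<rho> v k Qk) * (2 ^ Suc k * real Qk) * 2 ^ Suc k \<le> 2 powr (choose_\<rho> v k Qk / Suc k)"
  "real (Suc k) * v k \<le> real (choose_\<rho> v k Qk)" "Suc k \<le> choose_\<rho> v k Qk"
proof -
  have "\<forall>\<^sub>F n in sequentially. (32 * (2 ^ Suc k * real Qk) * 2 ^ Suc k) * real n \<le> 2 powr ((1 / Suc k) * real n)"
    by (rule eventually_powr_dominates) simp
  moreover have "\<forall>\<^sub>F n in sequentially. real (Suc k) * v k \<le> real n"
    using filterlim_real_sequentially by (simp add: filterlim_at_top)
  ultimately have "\<forall>\<^sub>F n in sequentially. 32 * real n * (2 ^ Suc k * real Qk) * 2 ^ Suc k \<le> 2 powr (n / Suc k) \<and>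
     real (Suc k) * v k \<le> real n \<and> Suc k \<le> n"
    using eventually_ge_at_top[of "Suc k"]
    by eventually_elim (simp add: ac_simps)
  then have "\<exists>n. 32 * real n * (2 ^ Suc k * real Qk) * 2 ^ Suc k \<le> 2 powr (n / Suc k) \<and>
     real (Suc k) * v k \<le> real n \<and> Suc k \<le> n"
    using eventually_happens trivial_limit_sequentially by blast
  from someI_ex[OF this]
  show "32 * real (choose_\<rho> v k Qk) * (2 ^ Suc k * real Qk) * 2 ^ Suc k \<le> 2 powr (choose_\<rho> v k Qk / Suc k)"
    "real (Suc k) * v k \<le> real (choose_\<rho> v k Qk)" "Suc k \<le> choose_\<rho> v k Qk"
    unfolding choose_\<rho>_def[symmetric] by blast+
qed

primrec widths :: "(nat \<Rightarrow> real) \<Rightarrow> nat \<Rightarrow> nat" where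
  "widths v 0 = 1"
| "widths v (Suc k) = (let \<rho> = choose_\<rho> v k (widths v k) in
     2 ^ \<rho> * (8 * \<rho>) * (2 ^ Suc k * nat \<lceil>2 powr (\<rho> / v k)\<rceil>) * widths v k)"

text \<open>The parameters are fixed before any measure space is given; the second conclusion then
  applies to every realization, in particular to the transported one.\<close>

lemma ex_scaled_tower:
  fixes v :: "nat \<Rightarrow> real"
  assumes v: "\<And>k. 0 < v k"
  obtains Q m b c \<rho> C where "tower_data Q m b"
    "\<And>M T p. tower_realization Q m b c M T (p :: nat \<Rightarrow> 'a \<Rightarrow> nat) \<Longrightarrow> scaled_tower Q m b c M T p \<rho> v C"
proof -
  define Q where "Q = widths v"
  define \<rho> where "\<rho> k = choose_\<rho> v k (Q k)" for k
  define m where "m k = 2 ^ Suc k * nat \<lceil>2 powr (\<rho> k / v k)\<rceil>" for k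
  define b where "b k = 2 ^ \<rho> k * (8 * \<rho> k)" for k
  have "\<forall>k. \<exists>C :: nat \<Rightarrow> nat set. (\<forall>i<2 ^ \<rho> k. C i \<subseteq> {..<8 * \<rho> k}) \<and>
     (\<forall>i<2 ^ \<rho> k. \<forall>j<2 ^ \<rho> k. i \<noteq> j \<longrightarrow> \<rho> k \<le> card (sym_diff (C i) (C j)))"
    using gilbert_varshamov_code by (rule allI)
  from choice[OF this] obtain C :: "nat \<Rightarrow> nat \<Rightarrow> nat set" where
    C: "\<forall>k. (\<forall>i<2 ^ \<rho> k. C k i \<subseteq> {..<8 * \<rho> k}) \<and>
     (\<forall>i<2 ^ \<rho> k. \<forall>j<2 ^ \<rho> k. i \<noteq> j \<longrightarrow> \<rho> k \<le> card (sym_diff (C k i) (C k j)))" ..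
  define c where "c k \<beta> \<longleftrightarrow> \<beta> mod (8 * \<rho> k) \<in> C k (\<beta> div (8 * \<rho> k))" for k \<beta>
  have \<rho>: "32 * real (\<rho> k) * (2 ^ Suc k * real (Q k)) * 2 ^ Suc k \<le> 2 powr (\<rho> k / Suc k)"
    "real (Suc k) * v k \<le> real (\<rho> k)" "Suc k \<le> \<rho> k" for k
    unfolding \<rho>_def by (rule choose_\<rho>)+
  have td: "tower_data Q m b"
  proof
    fix k
    show "Q 0 = 1" by (simp add: Q_def)
    show "Q (Suc k) = b k * m k * Q k"
      by (simp only: Q_def widths.simps Let_def b_def m_def \<rho>_def)
    have "1 * 8 \<le> 2 ^ \<rho> k * (8 * \<rho> k)" using \<rho>(3)[of k] by (intro mult_le_mono) auto
    then show "2 \<le> b k" by (simp add: b_def)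
    have "0 < nat \<lceil>2 powr (\<rho> k / v k)\<rceil>" using powr_gt_zero[of 2 "\<rho> k / v k"] by linarith
    then show "0 < m k" unfolding m_def by simp
    show "2 ^ Suc k dvd m k" unfolding m_def by (rule dvd_triv_left)
  qed
  show ?thesis
  proof (rule that[OF td])
    fix M :: "'a measure" and T and p :: "nat \<Rightarrow> 'a \<Rightarrow> nat" assume "tower_realization Q m b c M T p"
    then interpret tower_realization Q m b c M T p .
    show "scaled_tower Q m b c M T p \<rho> v C"
    proof
      fix k \<beta> i j
      show "0 < v k" by (rule v)
      show "b k = 2 ^ \<rho> k * (8 * \<rho> k)" by (rule b_def)
      show "m k = 2 ^ Suc k * nat \<lceil>2 powr (\<rho> k / v k)\<rceil>" by (rule m_def)
      show "c k \<beta> \<longleftrightarrow> \<beta> mod (8 * \<rho> k) \<in> C k (\<beta> div (8 * \<rho> k))" by (rule c_def)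
      show "i < 2 ^ \<rho> k \<Longrightarrow> C k i \<subseteq> {..<8 * \<rho> k}" using C by simp
      show "i < 2 ^ \<rho> k \<Longrightarrow> j < 2 ^ \<rho> k \<Longrightarrow> i \<noteq> j \<Longrightarrow> \<rho> k \<le> card (sym_diff (C k i) (C k j))"
        using C by simp
      show "32 * real (\<rho> k) * real (q k) * 2 ^ Suc k \<le> 2 powr (\<rho> k / Suc k)"
        using \<rho>(1)[of k] by (simp add: q_def del: power_Suc)
      show "real (Suc k) * v k \<le> real (\<rho> k)" "Suc k \<le> \<rho> k" by (rule \<rho>)+
    qed
  qed
qed

text \<open>For \<open>0 < u < \<infinity>\<close> the constant sequence works. Since
  \<open>v k\<close> has to be positive and finite, \<open>u = 0\<close> and
  \<open>u = \<infinity>\<close> are approached by \<open>1 / Suc k\<close> and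
  \<open>Suc k\<close>.\<close>

lemma ex_speeds:
  fixes u :: ennreal
  obtains v :: "nat \<Rightarrow> real" where "\<And>k. 0 < v k"
    "\<And>t. 0 < t \<Longrightarrow> u < ennreal t \<Longrightarrow> \<forall>\<^sub>F k in sequentially. (1 + 1 / Suc k) * v k \<le> t"
    "\<And>t. 0 < t \<Longrightarrow> ennreal t < u \<Longrightarrow> \<forall>\<^sub>F k in sequentially. t * (1 / v k + 1 / Suc k) \<le> 1"
proof (cases u)
  case top
  show ?thesis
  proof (rule that[of "\<lambda>k. real (Suc k)"])
    fix t :: real assume "0 < t"
    have "((\<lambda>k. t * (1 / real (Suc k) + 1 / real (Suc k))) \<longlongrightarrow> 0) sequentially" by real_asymp
    then have "\<forall>\<^sub>F k in sequentially. t * (1 / real (Suc k) + 1 / real (Suc k)) < 1"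
      by (rule order_tendstoD) simp
    then show "\<forall>\<^sub>F k in sequentially. t * (1 / real (Suc k) + 1 / real (Suc k)) \<le> 1"
      by (rule eventually_mono) simp
  qed (use top in auto)
next
  case (real r)
  show ?thesis
  proof (cases "r = 0")
    case True
    show ?thesis
    proof (rule that[of "\<lambda>k. 1 / real (Suc k)"])
      fix t :: real assume "0 < t"
      have "((\<lambda>k. (1 + 1 / real (Suc k)) * (1 / real (Suc k))) \<longlongrightarrow> 0) sequentially" by real_asymp
      then have "\<forall>\<^sub>F k in sequentially. (1 + 1 / real (Suc k)) * (1 / real (Suc k)) < t"
        using \<open>0 < t\<close> by (rule order_tendstoD)
      then show "\<forall>\<^sub>F k in sequentially. (1 + 1 / real (Suc k)) * (1 / real (Suc k)) \<le> t"
        by (rule eventually_mono) simp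
    qed (use real True in auto)
  next
    case False
    then have r: "0 < r" using real by simp
    show ?thesis
    proof (rule that[of "\<lambda>k. r"])
      fix t :: real assume t: "0 < t" "u < ennreal t"
      have "((\<lambda>k. (1 + 1 / real (Suc k)) * r) \<longlongrightarrow> r) sequentially" by real_asymp
      moreover have "r < t" using t real r by (simp add: ennreal_less_iff)
      ultimately have "\<forall>\<^sub>F k in sequentially. (1 + 1 / real (Suc k)) * r < t" by (rule order_tendstoD)
      then show "\<forall>\<^sub>F k in sequentially. (1 + 1 / real (Suc k)) * r \<le> t"
        by (rule eventually_mono) simp
    next
      fix t :: real assume t: "0 < t" "ennreal t < u"
      have "((\<lambda>k. t * (1 / r + 1 / real (Suc k))) \<longlongrightarrow> t / r) sequentially" by real_asymp
      moreover have "t / r < 1" using t real r by (simp add: ennreal_less_iff)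
      ultimately have "\<forall>\<^sub>F k in sequentially. t * (1 / r + 1 / real (Suc k)) < 1" by (rule order_tendstoD)
      then show "\<forall>\<^sub>F k in sequentially. t * (1 / r + 1 / real (Suc k)) \<le> 1"
        by (rule eventually_mono) simp
    qed (rule r)
  qed
qed

text \<open>Since \<open>Q 0 = 1\<close>, the grid of stage 0 already contains the line at 0, where
  the map to the disc would degenerate.\<close>

lemma (in tower_data) base_space_strip: "base_space \<subseteq> strip"
proof
  fix z assume z: "z \<in> base_space"
  then have "fst z \<noteq> 0" using base_spaceD(5)[OF z, of 0] by auto
  then show "z \<in> strip" using base_spaceD(1-4)[OF z] by (auto simp: mem_Times_iff)
qed

theorem theorem1p4:
  fixes X :: "(real \<times> real) set" and u :: ennreal
  assumes "X \<in> {torus_domain, disc_domain, annulus_domain}"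
  shows "\<exists>T. invertible_mpt (normalized_lebesgue X) T \<and>
             good_cyclic_approximation (normalized_lebesgue X) T \<and>
             upper_slow_entropy (\<lambda>n t. real n powr t) (normalized_lebesgue X) T = u"
proof -
  obtain v :: "nat \<Rightarrow> real" where v: "\<And>k. 0 < v k"
    and upper: "\<And>t. 0 < t \<Longrightarrow> u < ennreal t \<Longrightarrow> \<forall>\<^sub>F k in sequentially. (1 + 1 / Suc k) * v k \<le> t"
    and lower: "\<And>t. 0 < t \<Longrightarrow> ennreal t < u \<Longrightarrow> \<forall>\<^sub>F k in sequentially. t * (1 / v k + 1 / Suc k) \<le> 1"
    using ex_speeds[of u] by blast
  obtain Q m b c \<rho> C where td: "tower_data Q m b"
    and scaled: "\<And>M T p. tower_realization Q m b c M T (p :: nat \<Rightarrow> real \<times> real \<Rightarrow> nat) \<Longrightarrow>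
      scaled_tower Q m b c M T p \<rho> v C"
    using ex_scaled_tower[of v, OF v] by blast
  interpret tower_data Q m b c by (rule td)
  interpret base: tower_realization Q m b c base_measure base_map address
    by (rule base_realization)
  obtain \<psi> where \<psi>: "finite_measure (normalized_lebesgue X)"
    "measure (normalized_lebesgue X) (space (normalized_lebesgue X)) = 1"
    "inj_on \<psi> base_space" "\<psi> \<in> measurable base_measure (normalized_lebesgue X)"
    "\<And>A. A \<in> sets base_measure \<Longrightarrow> \<psi> ` A \<in> sets (normalized_lebesgue X)"
    "\<And>A. A \<in> sets base_measure \<Longrightarrow> emeasure (normalized_lebesgue X) (\<psi> ` A) = emeasure base_measure A"
    using ex_embedding[OF assms base_space_sets base_space_strip] by blast
  have "inj_on \<psi> (space base_measure)" using \<psi>(3) by simp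
  from base.transport[OF \<psi>(1,2) this \<psi>(4,5,6)]
  obtain T p where "tower_realization Q m b c (normalized_lebesgue X) T p" by blast
  then interpret scaled_tower Q m b c "normalized_lebesgue X" T p \<rho> v C by (rule scaled)
  show ?thesis
    using mpt good_cyclic_approximation[OF q_over_g] upper_slow_entropy_eq[OF upper lower] by blast
qed

end
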